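(* Suppose $S$ is a self-adjoint restriction of $T_{\max}$ (with separated boundary conditions if $\tau$ is in the limit-circle case at both endpoints) and $z\in\rho(S)$. Let $u_a$ and $u_b$ be nontrivial solutions of $(\tau-z)u=0$ such that, for each endpoint $c\in\{a,b\}$, $u_c$ satisfies the boundary condition of $S$ at $c$ if $\tau$ is in the limit-circle case at $c$, and $u_c$ lies in $L^2((a,b);r(x)dx)$ near $c$ if $\tau$ is in the limit-point case at $c$. Then the resolvent $R_z=(S-zI)^{-1}$ is given by $$R_zg(x)=\int_a^bG_z(x,y)g(y)\,r(y)dy,\quad x\in(a,b),\ g\in L^2((a,b);r(x)dx),$$ where $$G_z(x,y)=\frac1{W(u_b,u_a)}\begin{cases} u_a(y)u_b(x), & y\in(a,x], \\ u_a(x)u_b(y), & y\in[x,b). \end{cases}$$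
   Context: Setting. $(a,b)\subseteq\mathbb R$ is an open interval (possibly unbounded); $p,q,r,s$ are Lebesgue measurable and real-valued a.e. on $(a,b)$, with $p^{-1},q,r,s\in L^1_{\mathrm{loc}}((a,b);dx)$, $r>0$ and $p\neq0$ a.e. For $f\in AC_{\mathrm{loc}}((a,b))$ put $f^{[1]}=p(f'+sf)$, $\mathfrak D_\tau=\{f\in AC_{\mathrm{loc}}((a,b)) : f^{[1]}\in AC_{\mathrm{loc}}((a,b))\}$, and $\tau f=\frac1r\big(-(f^{[1]})'+sf^{[1]}+qf\big)$ for $f\in\mathfrak D_\tau$. The Wronskian is $W(f,g)=fg^{[1]}-f^{[1]}g$; it is constant for two solutions of $(\tau-z)u=0$. In $L^2((a,b);r(x)dx)$ the maximal operator is $T_{\max}f=\tau f$, $\operatorname{dom}(T_{\max})=\{g\in L^2((a,b);r\,dx): g\in\mathfrak D_\tau,\ \tau g\in L^2((a,b);r\,dx)\}$. A function lies in $L^2((a,b);r\,dx)$ near $a$ (resp. $b$) if it lies in $L^2((a,c);r\,dx)$ (resp. $L^2((c,b);r\,dx)$) for each $c\in(a,b)$. If $f,g\in\mathfrak D_\tau$ and $f,\tau f,g,\tau g$ lie in $L^2$ near an endpoint, the limit of $W(f,g)$ at that endpoint exists. $\tau$ is in the limit-circle case at an endpoint if for each $z\in\mathbb C$ all solutions of $(\tau-z)u=0$ lie in $L^2$ near that endpoint, and in the limit-point case if for each $z\in\mathbb C$ some solution does not; exactly one alternative holds at each endpoint. Form of $S$. A self-adjoint restriction $S$ of $T_{\max}$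 (with separated boundary conditions if $\tau$ is limit-circle at both endpoints) is $\tau$ restricted to those $g\in\operatorname{dom}(T_{\max})$ which satisfy, at each limit-circle endpoint $c$, the boundary condition $W(g,\overline{v_c})(c)=0$, where $v_c\in\operatorname{dom}(T_{\max})$ is a fixed function with $W(v_c,\overline{v_c})(c)=0$ and $W(h,\overline{v_c})(c)\neq0$ for some $h\in\operatorname{dom}(T_{\max})$; no condition is imposed at limit-point endpoints. "$u$ satisfies the boundary condition at $c$" means $W(u,\overline{v_c})(c)=0$. *)

theory Defs
  imports "HOL-Analysis.Analysis"
begin

section \<open>Square integrable functions and operators on them\<close>

text \<open>Elements of the Hilbert space are represented by functions; two of them are the same
  element when they agree almost everywhere.\<close>

definition weighted :: "real set \<Rightarrow> (real \<Rightarrow> real) \<Rightarrow> real measure" where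
  "weighted A r = density (lebesgue_on A) (\<lambda>x. ennreal (r x))"

definition L2 :: "'a measure \<Rightarrow> ('a \<Rightarrow> complex) set" where
  "L2 M = {f \<in> borel_measurable M. integrable M (\<lambda>x. (norm (f x))\<^sup>2)}"

definition L2_inner :: "'a measure \<Rightarrow> ('a \<Rightarrow> complex) \<Rightarrow> ('a \<Rightarrow> complex) \<Rightarrow> complex" where
  "L2_inner M f g = (LINT x|M. cnj (f x) * g x)"

definition L2_norm :: "'a measure \<Rightarrow> ('a \<Rightarrow> complex) \<Rightarrow> real" where
  "L2_norm M f = sqrt (LINT x|M. (norm (f x))\<^sup>2)"

text \<open>An operator is given by its graph \<open>S\<close>, a set of pairs of representatives that need not be
  closed under almost everywhere equality. This allows the first component to be the
  (locally absolutely) continuous representative of its class.\<close>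

type_synonym 'a graph = "(('a \<Rightarrow> complex) \<times> ('a \<Rightarrow> complex)) set"

definition ae_closure :: "'a measure \<Rightarrow> 'a graph \<Rightarrow> 'a graph" where
  "ae_closure M S = {(f, h). f \<in> L2 M \<and> h \<in> L2 M \<and>
     (\<exists>(f', h') \<in> S. (AE x in M. f x = f' x) \<and> (AE x in M. h x = h' x))}"

definition adjoint_graph :: "'a measure \<Rightarrow> 'a graph \<Rightarrow> 'a graph" where
  "adjoint_graph M S = {(f, h). f \<in> L2 M \<and> h \<in> L2 M \<and>
     (\<forall>(f', h') \<in> S. L2_inner M f h' = L2_inner M h f')}"

definition densely_defined :: "'a measure \<Rightarrow> 'a graph \<Rightarrow> bool" where
  "densely_defined M S \<longleftrightarrow>
     (\<forall>g \<in> L2 M. \<forall>e > 0. \<exists>(f, h) \<in> S. L2_norm M (\<lambda>x. g x - f x) < e)"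

definition self_adjoint_op :: "'a measure \<Rightarrow> 'a graph \<Rightarrow> bool" where
  "self_adjoint_op M S \<longleftrightarrow> densely_defined M S \<and> adjoint_graph M S = ae_closure M S"

text \<open>\<open>z\<close> is in the resolvent set iff \<open>S - z\<close> is a bijection of the domain of \<open>S\<close>
  onto the whole space (modulo almost everywhere equality) with bounded inverse.\<close>

definition resolvent_set :: "'a measure \<Rightarrow> 'a graph \<Rightarrow> complex set" where
  "resolvent_set M S = {z.
     (\<forall>(f, h) \<in> S. (AE x in M. h x - z * f x = 0) \<longrightarrow> (AE x in M. f x = 0)) \<and>
     (\<forall>g \<in> L2 M. \<exists>(f, h) \<in> S. AE x in M. h x - z * f x = g x) \<and>
     (\<exists>C. \<forall>(f, h) \<in> S. L2_norm M f \<le> C * L2_norm M (\<lambda>x. h x - z * f x))}"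

text \<open>The representative is taken from the domain of \<open>S\<close>. For the differential operators below
  such representatives are continuous on the interval, hence determined there pointwise.\<close>

definition resolvent ::
    "'a measure \<Rightarrow> 'a graph \<Rightarrow> complex \<Rightarrow> ('a \<Rightarrow> complex) \<Rightarrow> ('a \<Rightarrow> complex)" where
  "resolvent M S z g = (SOME f. \<exists>h. (f, h) \<in> S \<and> (AE x in M. h x - z * f x = g x))"


section \<open>Local integrability and absolute continuity\<close>

definition L1_loc :: "ereal \<Rightarrow> ereal \<Rightarrow> (real \<Rightarrow> real) \<Rightarrow> bool" where
  "L1_loc a b f \<longleftrightarrow>
     (\<forall>c d. a < ereal c \<longrightarrow> c \<le> d \<longrightarrow> ereal d < b \<longrightarrow> integrable (lebesgue_on {c..d}) f)"

definition abs_cont_on :: "real \<Rightarrow> real \<Rightarrow> (real \<Rightarrow> complex) \<Rightarrow> bool" where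
  "abs_cont_on c d f \<longleftrightarrow> (\<forall>\<epsilon>>0. \<exists>\<delta>>0. \<forall>(n::nat) x y.
     (\<forall>i<n. c \<le> x i \<and> x i \<le> y i \<and> y i \<le> d) \<longrightarrow>
     (\<forall>i<n. \<forall>j<n. i \<noteq> j \<longrightarrow> {x i<..<y i} \<inter> {x j<..<y j} = {}) \<longrightarrow>
     (\<Sum>i<n. y i - x i) < \<delta> \<longrightarrow>
     (\<Sum>i<n. norm (f (y i) - f (x i))) < \<epsilon>)"

definition AC_loc :: "ereal \<Rightarrow> ereal \<Rightarrow> (real \<Rightarrow> complex) \<Rightarrow> bool" where
  "AC_loc a b f \<longleftrightarrow>
     (\<forall>c d. a < ereal c \<longrightarrow> c \<le> d \<longrightarrow> ereal d < b \<longrightarrow> abs_cont_on c d f)"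


section \<open>The differential expression\<close>

text \<open>The expression \<open>p (f' + s f)\<close> is only defined almost everywhere, so the quasi-derivative is
  its locally absolutely continuous representative, which is unique on the interval.\<close>

definition is_quasi_deriv ::
    "ereal \<Rightarrow> ereal \<Rightarrow> (real \<Rightarrow> real) \<Rightarrow> (real \<Rightarrow> real) \<Rightarrow>
     (real \<Rightarrow> complex) \<Rightarrow> (real \<Rightarrow> complex) \<Rightarrow> bool" where
  "is_quasi_deriv a b p s f f1 \<longleftrightarrow> AC_loc a b f1 \<and>
     (AE x in lebesgue_on (einterval a b).
        \<exists>f'. (f has_vector_derivative f') (at x) \<and>
             f1 x = complex_of_real (p x) * (f' + complex_of_real (s x) * f x))"

definition D_tau ::
    "ereal \<Rightarrow> ereal \<Rightarrow> (real \<Rightarrow> real) \<Rightarrow> (real \<Rightarrow> real) \<Rightarrow> (real \<Rightarrow> complex) set" where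
  "D_tau a b p s = {f. AC_loc a b f \<and> (\<exists>f1. is_quasi_deriv a b p s f f1)}"

definition quasi_deriv ::
    "ereal \<Rightarrow> ereal \<Rightarrow> (real \<Rightarrow> real) \<Rightarrow> (real \<Rightarrow> real) \<Rightarrow>
     (real \<Rightarrow> complex) \<Rightarrow> (real \<Rightarrow> complex)" where
  "quasi_deriv a b p s f = (SOME f1. is_quasi_deriv a b p s f f1)"

text \<open>\<open>tau_eq a b p q r s f h\<close> means that \<open>f\<close> is in the domain of the expression \<open>\<tau>\<close> and
  \<open>\<tau> f = h\<close> almost everywhere on the interval.\<close>

definition tau_eq ::
    "ereal \<Rightarrow> ereal \<Rightarrow> (real \<Rightarrow> real) \<Rightarrow> (real \<Rightarrow> real) \<Rightarrow> (real \<Rightarrow> real) \<Rightarrow> (real \<Rightarrow> real) \<Rightarrow>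
     (real \<Rightarrow> complex) \<Rightarrow> (real \<Rightarrow> complex) \<Rightarrow> bool" where
  "tau_eq a b p q r s f h \<longleftrightarrow> f \<in> D_tau a b p s \<and>
     (AE x in lebesgue_on (einterval a b).
        \<exists>f1'. (quasi_deriv a b p s f has_vector_derivative f1') (at x) \<and>
              h x = 1 / complex_of_real (r x) *
                (- f1' + complex_of_real (s x) * quasi_deriv a b p s f x
                 + complex_of_real (q x) * f x))"

definition is_solution ::
    "ereal \<Rightarrow> ereal \<Rightarrow> (real \<Rightarrow> real) \<Rightarrow> (real \<Rightarrow> real) \<Rightarrow> (real \<Rightarrow> real) \<Rightarrow> (real \<Rightarrow> real) \<Rightarrow>
     complex \<Rightarrow> (real \<Rightarrow> complex) \<Rightarrow> bool" where
  "is_solution a b p q r s z u \<longleftrightarrow> tau_eq a b p q r s u (\<lambda>x. z * u x)"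

definition wronskian ::
    "ereal \<Rightarrow> ereal \<Rightarrow> (real \<Rightarrow> real) \<Rightarrow> (real \<Rightarrow> real) \<Rightarrow>
     (real \<Rightarrow> complex) \<Rightarrow> (real \<Rightarrow> complex) \<Rightarrow> real \<Rightarrow> complex" where
  "wronskian a b p s f g x = f x * quasi_deriv a b p s g x - quasi_deriv a b p s f x * g x"

definition T_max ::
    "ereal \<Rightarrow> ereal \<Rightarrow> (real \<Rightarrow> real) \<Rightarrow> (real \<Rightarrow> real) \<Rightarrow> (real \<Rightarrow> real) \<Rightarrow> (real \<Rightarrow> real) \<Rightarrow>
     real graph" where
  "T_max a b p q r s = {(f, h). f \<in> L2 (weighted (einterval a b) r) \<and>
     h \<in> L2 (weighted (einterval a b) r) \<and> tau_eq a b p q r s f h}"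


section \<open>Behaviour at the endpoints\<close>

text \<open>In the following \<open>c\<close> is one of the two endpoints \<open>a\<close>, \<open>b\<close>.\<close>

definition L2_near :: "ereal \<Rightarrow> ereal \<Rightarrow> (real \<Rightarrow> real) \<Rightarrow> ereal \<Rightarrow> (real \<Rightarrow> complex) \<Rightarrow> bool" where
  "L2_near a b r c f \<longleftrightarrow> (\<forall>d \<in> einterval a b.
     f \<in> L2 (weighted (if c = a then einterval a (ereal d) else einterval (ereal d) b) r))"

definition limit_circle ::
    "ereal \<Rightarrow> ereal \<Rightarrow> (real \<Rightarrow> real) \<Rightarrow> (real \<Rightarrow> real) \<Rightarrow> (real \<Rightarrow> real) \<Rightarrow> (real \<Rightarrow> real) \<Rightarrow>
     ereal \<Rightarrow> bool" where
  "limit_circle a b p q r s c \<longleftrightarrow>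
     (\<forall>z u. is_solution a b p q r s z u \<longrightarrow> L2_near a b r c u)"

definition limit_point ::
    "ereal \<Rightarrow> ereal \<Rightarrow> (real \<Rightarrow> real) \<Rightarrow> (real \<Rightarrow> real) \<Rightarrow> (real \<Rightarrow> real) \<Rightarrow> (real \<Rightarrow> real) \<Rightarrow>
     ereal \<Rightarrow> bool" where
  "limit_point a b p q r s c \<longleftrightarrow>
     (\<forall>z. \<exists>u. is_solution a b p q r s z u \<and> \<not> L2_near a b r c u)"

text \<open>\<open>wronskian_at a b p s c f g w\<close> means \<open>W(f,g)(c) = w\<close>, as a limit from within the interval.\<close>

definition wronskian_at ::
    "ereal \<Rightarrow> ereal \<Rightarrow> (real \<Rightarrow> real) \<Rightarrow> (real \<Rightarrow> real) \<Rightarrow> ereal \<Rightarrow>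
     (real \<Rightarrow> complex) \<Rightarrow> (real \<Rightarrow> complex) \<Rightarrow> complex \<Rightarrow> bool" where
  "wronskian_at a b p s c f g w \<longleftrightarrow>
     ((\<lambda>x. wronskian a b p s f g (real_of_ereal x)) \<longlongrightarrow> w) (if c = a then at_right a else at_left b)"

definition bc_function ::
    "ereal \<Rightarrow> ereal \<Rightarrow> (real \<Rightarrow> real) \<Rightarrow> (real \<Rightarrow> real) \<Rightarrow> (real \<Rightarrow> real) \<Rightarrow> (real \<Rightarrow> real) \<Rightarrow>
     ereal \<Rightarrow> (real \<Rightarrow> complex) \<Rightarrow> bool" where
  "bc_function a b p q r s c v \<longleftrightarrow> v \<in> Domain (T_max a b p q r s) \<and>
     wronskian_at a b p s c v (\<lambda>x. cnj (v x)) 0 \<and>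
     (\<exists>h \<in> Domain (T_max a b p q r s). \<exists>w. w \<noteq> 0 \<and> wronskian_at a b p s c h (\<lambda>x. cnj (v x)) w)"

definition satisfies_bc ::
    "ereal \<Rightarrow> ereal \<Rightarrow> (real \<Rightarrow> real) \<Rightarrow> (real \<Rightarrow> real) \<Rightarrow> ereal \<Rightarrow>
     (real \<Rightarrow> complex) \<Rightarrow> (real \<Rightarrow> complex) \<Rightarrow> bool" where
  "satisfies_bc a b p s c v u \<longleftrightarrow> wronskian_at a b p s c u (\<lambda>x. cnj (v x)) 0"

text \<open>The Wronskian of two solutions for the same \<open>z\<close> is constant on the interval, so it may be
  evaluated at \<open>x\<close>.\<close>

definition green_function ::
    "ereal \<Rightarrow> ereal \<Rightarrow> (real \<Rightarrow> real) \<Rightarrow> (real \<Rightarrow> real) \<Rightarrow>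
     (real \<Rightarrow> complex) \<Rightarrow> (real \<Rightarrow> complex) \<Rightarrow> real \<Rightarrow> real \<Rightarrow> complex" where
  "green_function a b p s ua ub x y =
     1 / wronskian a b p s ub ua x * (if y \<le> x then ua y * ub x else ua x * ub y)"

end

theory Submission
  imports Defs
begin

text \<open>If \<open>u\<^sub>a\<close> and \<open>u\<^sub>b\<close> were linearly dependent, \<open>u\<^sub>a\<close> would be square integrable and satisfy both
  boundary conditions, so \<open>z\<close> would be an eigenvalue of \<open>S\<close>; hence the constant Wronskian is nonzero.
  For \<open>g\<close> vanishing outside a compact interval, variation of constants shows that
  \<open>f(x) = \<integral> G\<^sub>z(x,y) g(y) r(y) dy\<close> solves \<open>(\<tau> - z) f = g\<close>, and \<open>f\<close> is a multiple of \<open>u\<^sub>a\<close>, \<open>u\<^sub>b\<close>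
  near the two endpoints, so it lies in the domain of \<open>S\<close> and equals the resolvent applied to \<open>g\<close>.
  General \<open>g\<close> follows by truncation, since the resolvent is bounded and the integral depends
  continuously on \<open>g\<close> for fixed \<open>x\<close>. The hypotheses on \<open>u\<^sub>a\<close>, \<open>u\<^sub>b\<close> distinguish limit circle and limit point,
  so Weyl's alternative is needed; it rests on the existence of a fundamental system, which is
  obtained by Picard iteration for absolutely continuous functions.\<close>

section \<open>Absolutely continuous functions and the fundamental theorem of calculus\<close>

text \<open>Two obstacles shape the details. Derivatives exist only almost everywhere, and
  \<open>quasi_deriv\<close> and \<open>resolvent\<close> are choices among representatives. The
  equation is therefore recast as a first order system that carries the quasi-derivative along, and
  all calculus passes through the two halves of the fundamental theorem: an absolutely continuous
  function is the integral of its a.e. derivative, and a primitive has its integrand as a.e.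
  derivative. Identities that hold a.e. between continuous functions then become pointwise ones. The
  other obstacle is the boundary condition, a limit of a Wronskian against a fixed function.
  Compactly supported data avoid computing any such limit: the condition is linear and depends only
  on values near the endpoint, so it is inherited from the given solutions. For general data the
  integral is not visibly in the domain, and the constant in the resolvent bound, which is the same
  for all truncations, replaces a direct estimate.\<close>

lemma abs_cont_on_sum:
  assumes "abs_cont_on c d f" "\<epsilon> > 0"
  obtains \<delta> where "\<delta> > 0"
    "\<forall>P lo hi. finite (P :: 'i set) \<longrightarrow> (\<forall>i\<in>P. c \<le> lo i \<and> lo i \<le> hi i \<and> hi i \<le> d) \<longrightarrow>
       (\<forall>i\<in>P. \<forall>j\<in>P. i \<noteq> j \<longrightarrow> {lo i<..<hi i} \<inter> {lo j<..<hi j} = {}) \<longrightarrow>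
       (\<Sum>i\<in>P. hi i - lo i) < \<delta> \<longrightarrow> (\<Sum>i\<in>P. norm (f (hi i) - f (lo i))) < \<epsilon>"
proof -
  obtain \<delta> where d: "\<delta> > 0" and *: "\<forall>(n::nat) x y. (\<forall>i<n. c \<le> x i \<and> x i \<le> y i \<and> y i \<le> d) \<longrightarrow>
     (\<forall>i<n. \<forall>j<n. i \<noteq> j \<longrightarrow> {x i<..<y i} \<inter> {x j<..<y j} = {}) \<longrightarrow>
     (\<Sum>i<n. y i - x i) < \<delta> \<longrightarrow>
     (\<Sum>i<n. norm (f (y i) - f (x i))) < \<epsilon>"
    by (rule assms(1)[unfolded abs_cont_on_def, rule_format, OF assms(2), THEN exE]) (erule conjE, rule that, assumption+)
  show ?thesis
  proof (rule that[OF d], intro allI impI)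
    fix P :: "'i set" and lo hi :: "'i \<Rightarrow> real"
    assume P: "finite P" "\<forall>i\<in>P. c \<le> lo i \<and> lo i \<le> hi i \<and> hi i \<le> d"
      "\<forall>i\<in>P. \<forall>j\<in>P. i \<noteq> j \<longrightarrow> {lo i<..<hi i} \<inter> {lo j<..<hi j} = {}"
      "(\<Sum>i\<in>P. hi i - lo i) < \<delta>"
    \<comment> \<open>The definition indexes intervals by \<open>i < n\<close>, while a tagged
      division is a set of pairs; an enumeration of \<open>P\<close> mediates between the
      two.\<close>
    obtain h where h: "bij_betw h {..<card P} P"
      using ex_bij_betw_nat_finite[OF P(1)] by (auto simp: atLeast0LessThan)
    have hP: "h i \<in> P" if "i < card P" for i using h that by (auto simp: bij_betw_def)
    have inj: "h i \<noteq> h j" if "i < card P" "j < card P" "i \<noteq> j" for i j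
      using h that by (auto simp: bij_betw_def inj_on_def)
    have "(\<Sum>i<card P. norm (f (hi (h i)) - f (lo (h i)))) < \<epsilon>"
    proof (rule *[rule_format])
      show "(\<Sum>i<card P. hi (h i) - lo (h i)) < \<delta>"
        using P(4) sum.reindex_bij_betw[OF h, of "\<lambda>i. hi i - lo i"] by simp
    qed (use hP P(2,3) inj in blast)+
    then show "(\<Sum>i\<in>P. norm (f (hi i) - f (lo i))) < \<epsilon>"
      using sum.reindex_bij_betw[OF h, of "\<lambda>i. norm (f (hi i) - f (lo i))"] by simp
  qed
qed

text \<open>Disjointness is asked of the open intervals only, because neighbours in a tagged
  division share endpoints.\<close>

lemma sum_length_le_measure:
  fixes lo hi :: "'i \<Rightarrow> real"
  assumes "finite P" "\<And>i. i \<in> P \<Longrightarrow> lo i \<le> hi i"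
    "\<And>i j. i \<in> P \<Longrightarrow> j \<in> P \<Longrightarrow> i \<noteq> j \<Longrightarrow> {lo i<..<hi i} \<inter> {lo j<..<hi j} = {}"
    "\<And>i. i \<in> P \<Longrightarrow> {lo i<..<hi i} \<subseteq> U" "U \<in> lmeasurable"
  shows "(\<Sum>i\<in>P. hi i - lo i) \<le> measure lebesgue U"
proof -
  have "(\<Sum>i\<in>P. hi i - lo i) = (\<Sum>i\<in>P. measure lebesgue {lo i<..<hi i})"
    using assms(2) by (intro sum.cong) auto
  also have "\<dots> = measure lebesgue (\<Union>i\<in>P. {lo i<..<hi i})"
    by (rule measure_finite_Union[symmetric]) (use assms in \<open>auto simp: disjoint_family_on_def\<close>)
  also have "\<dots> \<le> measure lebesgue U"
  proof (rule measure_mono_fmeasurable)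
    show "(\<Union>i\<in>P. {lo i<..<hi i}) \<subseteq> U" using assms(4) by (rule UN_least)
    show "(\<Union>i\<in>P. {lo i<..<hi i}) \<in> sets lebesgue" using assms(1) by (intro sets.finite_UN) auto
  qed fact
  finally show ?thesis .
qed

text \<open>Around a point of the exceptional null set the gauge is an open set of small measure, so the
  tagged intervals there contribute little by absolute continuity; no differentiability
  theorem is needed.\<close>

lemma abs_cont_on_has_integral:
  fixes f f' :: "real \<Rightarrow> complex"
  assumes "c \<le> d" "abs_cont_on c d f" "negligible N"
    and der: "\<And>x. x \<in> {c..d} - N \<Longrightarrow> (f has_vector_derivative f' x) (at x within {c..d})"
  shows "(f' has_integral (f d - f c)) {c..d}"
proof -
  \<comment> \<open>On the null set \<open>f'\<close> is arbitrary. With value 0 there, a tag in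
    \<open>N\<close> contributes nothing but the increment of \<open>f\<close>; the final spike
    argument returns to \<open>f'\<close>.\<close>
  define g where "g x = (if x \<in> N then 0 else f' x)" for x
  have "(g has_integral (f d - f c)) {c..d}"
    unfolding has_integral_real
  proof (intro allI impI)
    fix e :: real assume e: "e > 0"
    \<comment> \<open>Good tags will cost \<open>e1\<close> times the length of their interval,
      hence at most \<open>e/2\<close> in total; the summand 1 covers the case
      \<open>c = d\<close>.\<close>
    define e1 where "e1 = e / 2 / (d - c + 1)"
    have e1: "e1 > 0" using e assms(1) by (auto simp: e1_def)
    obtain \<delta> where d: "\<delta> > 0" and *:
      "\<forall>P lo hi. finite (P :: (real \<times> real set) set) \<longrightarrow> (\<forall>i\<in>P. c \<le> lo i \<and> lo i \<le> hi i \<and> hi i \<le> d) \<longrightarrow>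
       (\<forall>i\<in>P. \<forall>j\<in>P. i \<noteq> j \<longrightarrow> {lo i<..<hi i} \<inter> {lo j<..<hi j} = {}) \<longrightarrow>
       (\<Sum>i\<in>P. hi i - lo i) < \<delta> \<longrightarrow> (\<Sum>i\<in>P. norm (f (hi i) - f (lo i))) < e/2"
      by (rule abs_cont_on_sum[OF assms(2) half_gt_zero[OF e], where 'i = "real \<times> real set"])
    obtain U where U: "open U" "N \<subseteq> U" "U \<in> lmeasurable" "measure lebesgue U < \<delta>"
    proof -
      have N: "N \<in> lmeasurable" "measure lebesgue N = 0"
        using assms(3) by (auto simp: negligible_iff_measure)
      obtain U where "open U" "N \<subseteq> U" "U - N \<in> lmeasurable" "emeasure lebesgue (U - N) < ennreal \<delta>"
        using sets_lebesgue_outer_open[of N \<delta>] N d by (metis fmeasurableD)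
      moreover have "U = (U - N) \<union> N" using \<open>N \<subseteq> U\<close> by auto
      then have "U \<in> lmeasurable" using \<open>U - N \<in> lmeasurable\<close> N(1) by (metis fmeasurable.Un)
      moreover have "measure lebesgue U = measure lebesgue (U - N)"
        using measure_negligible_symdiff \<open>U - N \<in> lmeasurable\<close> assms(3)
        by (metis measure_Diff_null_set negligible_iff_null_sets \<open>U \<in> lmeasurable\<close> fmeasurableD)
      moreover have "measure lebesgue (U - N) < \<delta>"
        using \<open>emeasure lebesgue (U - N) < ennreal \<delta>\<close> \<open>U - N \<in> lmeasurable\<close> d
        by (metis emeasure_eq_measure2 ennreal_less_iff measure_nonneg)
      ultimately show ?thesis using that by metis
    qed
    have "\<exists>\<rho>>0. \<forall>y\<in>{c..d}. norm (y - x) < \<rho> \<longrightarrow> norm (f y - f x - (y - x) *\<^sub>R f' x) \<le> e1 * norm (y - x)"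
      if "x \<in> {c..d} - N" for x
      using der[OF that] e1 unfolding has_vector_derivative_def has_derivative_within_alt by blast
    then obtain \<rho> where \<rho>: "\<And>x. x \<in> {c..d} - N \<Longrightarrow> \<rho> x > 0"
      "\<And>x y. x \<in> {c..d} - N \<Longrightarrow> y \<in> {c..d} \<Longrightarrow> norm (y - x) < \<rho> x \<Longrightarrow>
         norm (f y - f x - (y - x) *\<^sub>R f' x) \<le> e1 * norm (y - x)"
      by metis
    \<comment> \<open>\<open>UNIV\<close> is a dummy value, since every tag of a division of
      \<open>{c..d}\<close> lies in \<open>{c..d}\<close>.\<close>
    define \<gamma> where "\<gamma> x = (if x \<in> N then U else if x \<in> {c..d} then ball x (\<rho> x) else UNIV)" for x
    have gauge: "gauge \<gamma>"
      using U \<rho>(1) by (intro gaugeI) (auto simp: \<gamma>_def)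
    moreover have "norm ((\<Sum>(x,K)\<in>p. measure lborel K *\<^sub>R g x) - (f d - f c)) < e"
      if p: "p tagged_division_of {c..d}" "\<gamma> fine p" for p
    proof -
      note pD = tagged_division_ofD[OF p(1)]
      have fp: "finite p" using pD(1) .
      have K: "\<exists>u v. K = {u..v} \<and> u \<le> v \<and> Inf K = u \<and> Sup K = v \<and> c \<le> u \<and> v \<le> d \<and> x \<in> {u..v}"
        if xK: "(x,K) \<in> p" for x K
      proof -
        obtain u v where "K = {u..v}" using pD(4)[OF xK] by auto
        moreover have "x \<in> K" "K \<subseteq> {c..d}" using pD(2,3)[OF xK] by auto
        ultimately show ?thesis by auto
      qed
      define lo :: "real \<times> real set \<Rightarrow> real" where "lo = (\<lambda>i. Inf (snd i))"
      define hi :: "real \<times> real set \<Rightarrow> real" where "hi = (\<lambda>i. Sup (snd i))"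
      have lohi: "c \<le> lo i \<and> lo i \<le> hi i \<and> hi i \<le> d \<and> snd i = {lo i..hi i} \<and> fst i \<in> {lo i..hi i}" if ip: "i \<in> p" for i
      proof -
        obtain x L where i: "i = (x, L)" by force
        obtain u v where "L = {u..v}" "u \<le> v" "Inf L = u" "Sup L = v" "c \<le> u" "v \<le> d" "x \<in> {u..v}"
          using K[of x L] ip i by blast
        then show ?thesis unfolding i lo_def hi_def by simp
      qed
      have disj: "{lo i<..<hi i} \<inter> {lo j<..<hi j} = {}" if "i \<in> p" "j \<in> p" "i \<noteq> j" for i j
      proof -
        have "interior (snd i) \<inter> interior (snd j) = {}"
          using pD(5)[of "fst i" "snd i" "fst j" "snd j"] that by auto
        then show ?thesis using lohi[OF that(1)] lohi[OF that(2)]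
          by (metis interior_atLeastAtMost_real)
      qed
      have fine: "snd i \<subseteq> \<gamma> (fst i)" if "i \<in> p" for i
        using p(2) that by (cases i) (auto simp: fine_def)
      define A where "A = {i \<in> p. fst i \<in> N}"
      have "(\<Sum>i\<in>A. hi i - lo i) \<le> measure lebesgue U"
      proof (rule sum_length_le_measure)
        fix i assume "i \<in> A"
        then show "{lo i<..<hi i} \<subseteq> U"
          using fine[of i] lohi[of i] by (auto simp: A_def \<gamma>_def)
      qed (use fp lohi disj U in \<open>auto simp: A_def\<close>)
      then have 1: "(\<Sum>i\<in>A. norm (f (hi i) - f (lo i))) < e/2"
        using U(4) by (intro *[rule_format]) (use fp lohi disj in \<open>auto simp: A_def\<close>)
      have 2: "norm (measure lborel (snd i) *\<^sub>R g (fst i) - (f (hi i) - f (lo i))) \<le> e1 * (hi i - lo i)" if "i \<in> p - A" for i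
      proof -
        have x: "fst i \<in> {c..d} - N" "i \<in> p" using that lohi[of i] by (auto simp: A_def)
        let ?x = "fst i"
        have sub: "{lo i..hi i} \<subseteq> ball ?x (\<rho> ?x)" using fine[OF x(2)] lohi[OF x(2)] x(1) by (auto simp: \<gamma>_def)
        then have "lo i \<in> ball ?x (\<rho> ?x)" "hi i \<in> ball ?x (\<rho> ?x)" using lohi[OF x(2)] by force+
        then have a: "norm (f (lo i) - f ?x - (lo i - ?x) *\<^sub>R f' ?x) \<le> e1 * norm (lo i - ?x)"
          "norm (f (hi i) - f ?x - (hi i - ?x) *\<^sub>R f' ?x) \<le> e1 * norm (hi i - ?x)"
          using \<rho>(2)[OF x(1), of "lo i"] \<rho>(2)[OF x(1), of "hi i"] lohi[OF x(2)]
          by (auto simp: dist_norm norm_minus_commute)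
        \<comment> \<open>Straddling: the tag lies between \<open>lo i\<close> and
          \<open>hi i\<close>, so the two first order errors at the tag add up to \<open>e1\<close>
          times the distances to both ends, which is \<open>e1\<close> times the length.\<close>
        have "measure lborel (snd i) *\<^sub>R g ?x - (f (hi i) - f (lo i)) =
          (f (lo i) - f ?x - (lo i - ?x) *\<^sub>R f' ?x) - (f (hi i) - f ?x - (hi i - ?x) *\<^sub>R f' ?x)"
          using x lohi[OF x(2)] by (auto simp: g_def algebra_simps)
        then have "norm (measure lborel (snd i) *\<^sub>R g ?x - (f (hi i) - f (lo i))) \<le>
          e1 * norm (lo i - ?x) + e1 * norm (hi i - ?x)"
          using a norm_triangle_ineq4 by (smt (verit, best))
        also have "\<dots> = e1 * (hi i - lo i)" using lohi[OF x(2)] by (auto simp: algebra_simps)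
        finally show ?thesis .
      qed
      have "(\<Sum>i\<in>p - A. hi i - lo i) \<le> measure lebesgue {c..d}"
      proof (rule sum_length_le_measure)
        fix i assume "i \<in> p - A"
        then show "{lo i<..<hi i} \<subseteq> {c..d}" using lohi[of i] by auto
      qed (use fp lohi disj in auto)
      then have "(\<Sum>i\<in>p - A. hi i - lo i) \<le> d - c" using assms(1) by simp
      then have "e1 * (\<Sum>i\<in>p - A. hi i - lo i) \<le> e1 * (d - c)" using e1 by simp
      also have "\<dots> \<le> e/2" using e assms(1) by (simp add: e1_def field_simps)
      finally have 3: "(\<Sum>i\<in>p - A. norm (measure lborel (snd i) *\<^sub>R g (fst i) - (f (hi i) - f (lo i)))) \<le> e/2"
        using sum_mono[OF 2, of "p - A" "\<lambda>i. i"] by (simp add: sum_distrib_left)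
      have 4: "(\<Sum>i\<in>A. norm (measure lborel (snd i) *\<^sub>R g (fst i) - (f (hi i) - f (lo i)))) < e/2"
      proof -
        have "(\<Sum>i\<in>A. norm (measure lborel (snd i) *\<^sub>R g (fst i) - (f (hi i) - f (lo i)))) = (\<Sum>i\<in>A. norm (f (hi i) - f (lo i)))"
          by (rule sum.cong) (auto simp: A_def g_def norm_minus_commute)
        with 1 show ?thesis by simp
      qed
      have "(\<Sum>(x,K)\<in>p. measure lborel K *\<^sub>R g x) - (f d - f c) =
         (\<Sum>i\<in>p. measure lborel (snd i) *\<^sub>R g (fst i) - (f (hi i) - f (lo i)))"
        using additive_tagged_division_1[OF assms(1) p(1), of f]
        by (simp add: sum_subtractf split_def lo_def hi_def)
      also have "norm \<dots> \<le> (\<Sum>i\<in>p. norm (measure lborel (snd i) *\<^sub>R g (fst i) - (f (hi i) - f (lo i))))"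
        by (rule norm_sum)
      also have "\<dots> = (\<Sum>i\<in>p - A. norm (measure lborel (snd i) *\<^sub>R g (fst i) - (f (hi i) - f (lo i)))) +
          (\<Sum>i\<in>A. norm (measure lborel (snd i) *\<^sub>R g (fst i) - (f (hi i) - f (lo i))))"
        using fp by (intro sum.subset_diff) (auto simp: A_def)
      also have "\<dots> < e" using 3 4 by linarith
      finally show ?thesis .
    qed
    ultimately show "\<exists>\<gamma>. gauge \<gamma> \<and> (\<forall>\<D>. \<D> tagged_division_of {c..d} \<and> \<gamma> fine \<D> \<longrightarrow>
        norm ((\<Sum>(x,k)\<in>\<D>. measure lborel k *\<^sub>R g x) - (f d - f c)) < e)"
      by (intro exI[of _ \<gamma>] conjI allI impI) auto
  qed
  then show ?thesis
    by (rule has_integral_spike[OF assms(3), rotated]) (auto simp: g_def)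
qed

text \<open>By Henstock's lemma, finitely many disjoint short intervals on which \<open>f\<close> misrepresents its mean
  have small total length, and by Vitali's theorem such intervals cover almost all bad points.\<close>

lemma henstock_negligible:
  fixes f :: "real \<Rightarrow> complex"
  assumes int: "f integrable_on {c..d}" and k: "k > 0"
  shows "negligible {x. \<forall>\<delta>>0. \<exists>u v. c \<le> u \<and> u \<le> x \<and> x \<le> v \<and> v \<le> d \<and> u < v \<and> v - u < \<delta> \<and>
     k * (v - u) \<le> norm ((v - u) *\<^sub>R f x - integral {u..v} f)}" (is "negligible ?E")
  unfolding negligible_outer_le
proof (intro allI impI)
  fix e :: real assume e: "e > 0"
  \<comment> \<open>The tolerance is \<open>k * e\<close> because each bad interval contributes at
    least \<open>k\<close> times its length to the Henstock sum; the total length then stays below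
    \<open>e\<close>.\<close>
  obtain \<gamma> where \<gamma>: "gauge \<gamma>" "\<And>p. p tagged_partial_division_of (cbox c d) \<Longrightarrow> \<gamma> fine p \<Longrightarrow>
       sum (\<lambda>(x,k). norm(measure lborel k *\<^sub>R f x - integral k f)) p < k * e"
    using Henstock_lemma[of f c d "k * e"] int e k by auto
  define I where "I = {(x,u,v). c \<le> u \<and> u \<le> x \<and> x \<le> v \<and> v \<le> d \<and> u < v \<and> {u..v} \<subseteq> \<gamma> x \<and>
     k * (v - u) \<le> norm ((v - u) *\<^sub>R f x - integral {u..v} f)}"
  \<comment> \<open>Vitali's theorem speaks of balls, so \<open>{u..v}\<close> is written as the
    ball about its midpoint. The tag \<open>x\<close> is kept in the triple because Henstock's lemma
    pairs the interval with \<open>x\<close>, not with its centre.\<close>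
  define m where "m = (\<lambda>(x::real,u::real,v::real). (u + v) / 2)"
  define \<rho> where "\<rho> = (\<lambda>(x::real,u::real,v::real). (v - u) / 2)"
  have cb: "cball (m (x,u,v)) (\<rho> (x,u,v)) = {u..v}" for x u v
    by (simp add: m_def \<rho>_def cball_eq_atLeastAtMost field_simps)
  have "\<exists>i. i \<in> I \<and> x \<in> cball (m i) (\<rho> i) \<and> \<rho> i < \<delta>" if x: "x \<in> ?E" and "\<delta> > 0" for x \<delta>
  proof -
    obtain \<eta> where \<eta>: "\<eta> > 0" "ball x \<eta> \<subseteq> \<gamma> x"
      using \<gamma>(1) by (meson gaugeD openE)
    obtain u v where uv: "c \<le> u \<and> u \<le> x \<and> x \<le> v \<and> v \<le> d \<and> u < v \<and> v - u < min \<eta> \<delta> \<and>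
       k * (v - u) \<le> norm ((v - u) *\<^sub>R f x - integral {u..v} f)"
      using x[unfolded mem_Collect_eq, rule_format, of "min \<eta> \<delta>"] \<open>\<delta> > 0\<close> \<eta>(1) by auto
    have "{u..v} \<subseteq> ball x \<eta>" using uv by (auto simp: dist_real_def)
    then have "(x,u,v) \<in> I" using uv \<eta>(2) unfolding I_def by blast
    moreover have "x \<in> cball (m (x,u,v)) (\<rho> (x,u,v))" unfolding cb using uv by auto
    moreover have "\<rho> (x,u,v) < \<delta>" using uv by (auto simp: \<rho>_def)
    ultimately show ?thesis by blast
  qed
  then have vit: "\<And>x \<delta>. x \<in> ?E \<Longrightarrow> 0 < \<delta> \<Longrightarrow> \<exists>i. i \<in> I \<and> x \<in> cball (m i) (\<rho> i) \<and> \<rho> i < \<delta>"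
    by blast
  have pos: "\<And>i. i \<in> I \<Longrightarrow> 0 < \<rho> i" by (auto simp: I_def \<rho>_def)
  obtain C where C: "countable C" "C \<subseteq> I"
     "pairwise (\<lambda>i j. disjnt (cball (m i) (\<rho> i)) (cball (m j) (\<rho> j))) C"
     "negligible(?E - (\<Union>i \<in> C. cball (m i) (\<rho> i)))"
    by (rule Vitali_covering_theorem_cballs[OF pos vit])
  \<comment> \<open>Henstock's lemma handles only finite families; since the bound is uniform in
    \<open>F\<close>, it passes to the countable union.\<close>
  have fin: "measure lebesgue (\<Union>i\<in>F. cball (m i) (\<rho> i)) \<le> e" if F: "F \<subseteq> C" "finite F" for F
  proof -
    define h where "h = (\<lambda>i::real\<times>real\<times>real. (fst i, cball (m i) (\<rho> i)))"
    have FI: "i \<in> I" if "i \<in> F" for i using F C that by auto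
    have dis: "cball (m i) (\<rho> i) \<inter> cball (m j) (\<rho> j) = {}" if "i \<in> F" "j \<in> F" "i \<noteq> j" for i j
      using C(3) F that by (auto simp: pairwise_def disjnt_def)
    have x: "fst i \<in> cball (m i) (\<rho> i)" if "i \<in> F" for i
    proof (cases i)
      case (fields x u v)
      then show ?thesis using FI[OF that] by (simp add: cb I_def)
    qed
    have inj: "inj_on h F"
      using dis x unfolding inj_on_def h_def by (metis Int_iff empty_iff prod.inject)
    have "h ` F tagged_partial_division_of cbox c d"
      unfolding tagged_partial_division_of_def
    proof (intro conjI allI impI)
      show "finite (h ` F)" using F by auto
      fix y K assume "(y,K) \<in> h ` F"
      then obtain i where i: "i \<in> F" "y = fst i" "K = cball (m i) (\<rho> i)" by (auto simp: h_def)
      obtain x' u v where iv: "i = (x',u,v)" by (metis prod_cases3)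
      show "y \<in> K" using x i by auto
      show "K \<subseteq> cbox c d" using FI[OF i(1)] i(3) unfolding iv cb by (auto simp: I_def)
      show "\<exists>a b. K = cbox a b" using i(3) unfolding iv cb by (metis box_real(2))
    next
      fix y1 K1 y2 K2
      assume "(y1, K1) \<in> h ` F \<and> (y2, K2) \<in> h ` F \<and> (y1, K1) \<noteq> (y2, K2)"
      then obtain i j where "i \<in> F" "j \<in> F" "(y1, K1) = h i" "(y2, K2) = h j" "h i \<noteq> h j"
        by (metis imageE)
      then have "i \<in> F" "j \<in> F" "i \<noteq> j" "K1 = cball (m i) (\<rho> i)" "K2 = cball (m j) (\<rho> j)"
        by (auto simp: h_def)
      then show "interior K1 \<inter> interior K2 = {}"
        using dis interior_subset by blast
    qed
    moreover have "\<gamma> fine h ` F"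
      unfolding fine_def
    proof (intro ballI)
      fix i assume "i \<in> h ` F"
      then obtain x' u v where "i = h (x', u, v)" "(x', u, v) \<in> F" by (metis imageE prod_cases3)
      then show "case i of (x, k) \<Rightarrow> k \<subseteq> \<gamma> x"
        using FI[of "(x',u,v)"] by (simp add: h_def cb I_def)
    qed
    ultimately have "sum (\<lambda>(x,k). norm(measure lborel k *\<^sub>R f x - integral k f)) (h ` F) < k * e"
      by (rule \<gamma>(2))
    then have "(\<Sum>i\<in>F. norm(measure lborel (cball (m i) (\<rho> i)) *\<^sub>R f (fst i) - integral (cball (m i) (\<rho> i)) f)) < k * e"
      by (subst (asm) sum.reindex[OF inj]) (simp add: h_def o_def)
    moreover have "k * measure lborel (cball (m i) (\<rho> i)) \<le>
        norm(measure lborel (cball (m i) (\<rho> i)) *\<^sub>R f (fst i) - integral (cball (m i) (\<rho> i)) f)" if "i \<in> F" for i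
    proof (cases i)
      case (fields x u v)
      then show ?thesis using FI[OF that] unfolding fields cb by (simp add: I_def)
    qed
    then have "k * (\<Sum>i\<in>F. measure lborel (cball (m i) (\<rho> i))) \<le>
       (\<Sum>i\<in>F. norm(measure lborel (cball (m i) (\<rho> i)) *\<^sub>R f (fst i) - integral (cball (m i) (\<rho> i)) f))"
      by (simp add: sum_distrib_left sum_mono)
    ultimately have "(\<Sum>i\<in>F. measure lborel (cball (m i) (\<rho> i))) < e"
      using k by (smt (verit) mult_le_cancel_left_pos)
    moreover have "measure lebesgue (\<Union>i\<in>F. cball (m i) (\<rho> i)) \<le> (\<Sum>i\<in>F. measure lebesgue (cball (m i) (\<rho> i)))"
      by (rule measure_UNION_le) (use F in auto)
    ultimately show ?thesis by simp
  qed
  have U: "(\<Union>i\<in>C. cball (m i) (\<rho> i)) \<in> lmeasurable \<and> measure lebesgue (\<Union>i\<in>C. cball (m i) (\<rho> i)) \<le> e"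
    using fmeasurable_UN_bound[OF C(1) _ fin] measure_UN_bound[OF C(1) _ fin] by auto
  let ?T = "(\<Union>i\<in>C. cball (m i) (\<rho> i)) \<union> (?E - (\<Union>i \<in> C. cball (m i) (\<rho> i)))"
  have "?T \<in> lmeasurable" using U C(4) by (intro fmeasurable.Un) (auto simp: negligible_iff_measure)
  moreover have "measure lebesgue ?T \<le> e"
    using U C(4) by (subst measure_Un_null_set) (auto simp: negligible_iff_null_sets)
  ultimately show "\<exists>T. ?E \<subseteq> T \<and> T \<in> lmeasurable \<and> measure lebesgue T \<le> e"
    by (intro exI[of _ ?T]) auto
qed

text \<open>The sets of \<open>henstock_negligible\<close> for the thresholds 1/(n+1) have a
  negligible union. Off this union, intervals with \<open>x\<close> as right or left endpoint
  control the difference quotients from both sides.\<close>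

lemma indefinite_integral_AE_derivative:
  fixes f G :: "real \<Rightarrow> complex"
  assumes int: "f integrable_on {c..d}"
    and G: "\<And>u v. c \<le> u \<Longrightarrow> u \<le> v \<Longrightarrow> v \<le> d \<Longrightarrow> G v - G u = integral {u..v} f"
  shows "\<exists>N. negligible N \<and> (\<forall>x \<in> {c<..<d} - N. (G has_vector_derivative f x) (at x))"
proof -
  define E where "E n = {x. \<forall>\<delta>>0. \<exists>u v. c \<le> u \<and> u \<le> x \<and> x \<le> v \<and> v \<le> d \<and> u < v \<and> v - u < \<delta> \<and>
     inverse (Suc n) * (v - u) \<le> norm ((v - u) *\<^sub>R f x - integral {u..v} f)}" for n :: nat
  have "negligible (E n)" for n unfolding E_def by (rule henstock_negligible[OF int]) simp
  then have "negligible (\<Union>n. E n)" by (intro negligible_countable_Union) auto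
  moreover have "(G has_vector_derivative f x) (at x)" if x: "x \<in> {c<..<d} - (\<Union>n. E n)" for x
    unfolding has_vector_derivative_def has_derivative_at_alt
  proof (intro conjI allI impI bounded_linear_scaleR_left)
    fix e :: real assume "e > 0"
    then obtain n where n: "inverse (Suc n) < e" using reals_Archimedean by blast
    obtain \<delta> where \<delta>: "\<delta> > 0" "\<And>u v. c \<le> u \<Longrightarrow> u \<le> x \<Longrightarrow> x \<le> v \<Longrightarrow> v \<le> d \<Longrightarrow> u < v \<Longrightarrow> v - u < \<delta> \<Longrightarrow>
     norm ((v - u) *\<^sub>R f x - integral {u..v} f) < inverse (Suc n) * (v - u)"
    proof -
      have "x \<notin> E n" using x by blast
      then obtain \<delta> where "\<delta> > 0" "\<not> (\<exists>u v. c \<le> u \<and> u \<le> x \<and> x \<le> v \<and> v \<le> d \<and> u < v \<and> v - u < \<delta> \<and>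
         inverse (Suc n) * (v - u) \<le> norm ((v - u) *\<^sub>R f x - integral {u..v} f))"
        unfolding E_def by blast
      then show ?thesis by (intro that[of \<delta>]) (metis not_le)+
    qed
    \<comment> \<open>The additional minima keep \<open>y\<close> inside \<open>{c..d}\<close>,
      where the increments of \<open>G\<close> are known.\<close>
    let ?\<delta> = "min \<delta> (min (x - c) (d - x))"
    have "norm (G y - G x - (y - x) *\<^sub>R f x) \<le> e * norm (y - x)" if y: "norm (y - x) < ?\<delta>" for y
    proof -
      consider "y = x" | "x < y" | "y < x" by linarith
      then show ?thesis
      proof cases
        case 2
        then have "norm ((y - x) *\<^sub>R f x - integral {x..y} f) < inverse (Suc n) * (y - x)"
          using y x by (intro \<delta>(2)) auto
        also have "\<dots> \<le> e * (y - x)" using n 2 by (intro mult_right_mono) auto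
        finally show ?thesis using G[of x y] x y 2 by (auto simp: norm_minus_commute)
      next
        case 3
        then have "norm ((x - y) *\<^sub>R f x - integral {y..x} f) < inverse (Suc n) * (x - y)"
          using y x by (intro \<delta>(2)) auto
        also have "\<dots> \<le> e * (x - y)" using n 3 by (intro mult_right_mono) auto
        finally have "norm ((x - y) *\<^sub>R f x - integral {y..x} f) < e * norm (y - x)" using 3 by auto
        moreover have "G y - G x - (y - x) *\<^sub>R f x = (x - y) *\<^sub>R f x - integral {y..x} f"
          using G[of y x] x y 3 by (auto simp: algebra_simps)
        ultimately show ?thesis by simp
      qed auto
    qed
    then show "\<exists>\<delta>>0. \<forall>y. norm (y - x) < \<delta> \<longrightarrow> norm (G y - G x - (y - x) *\<^sub>R f x) \<le> e * norm (y - x)"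
      using \<delta>(1) x by (intro exI[of _ ?\<delta>]) auto
  qed
  ultimately show ?thesis by blast
qed

section \<open>Open intervals, continuity and algebra of absolutely continuous functions, and
  absolute continuity of the integral\<close>

lemma einterval_lebesgue [simp, measurable]: "einterval a b \<in> sets lebesgue"
  by (simp add: sets_completionI_sets)

lemma AE_einterval_iff_negligible:
  "(AE x in lebesgue_on (einterval a b). P x) \<longleftrightarrow> negligible {x \<in> einterval a b. \<not> P x}"
  by (auto simp: AE_restrict_space_iff eventually_ae_filter_negligible intro: negligible_subset)

lemma einterval_subset: "c \<in> einterval a b \<Longrightarrow> d \<in> einterval a b \<Longrightarrow> {c..d} \<subseteq> einterval a b"
  by (auto simp: einterval_iff) (meson ereal_less_eq(3) le_less_trans less_le_trans)+

lemma einterval_box: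
  assumes "x \<in> einterval a b"
  obtains c d where "c < x" "x < d" "c \<in> einterval a b" "d \<in> einterval a b"
proof -
  obtain e where e: "e > 0" "ball x e \<subseteq> einterval a b"
    using assms open_einterval by (meson openE)
  have "x - e/2 \<in> ball x e" "x + e/2 \<in> ball x e" using e by (auto simp: dist_real_def)
  then show ?thesis using e by (intro that[of "x - e/2" "x + e/2"]) auto
qed

lemma abs_cont_on_continuous:
  assumes "abs_cont_on c d f"
  shows "continuous_on {c..d} f"
  unfolding continuous_on_iff
proof (intro ballI allI impI)
  fix x \<epsilon> :: real assume x: "x \<in> {c..d}" and e: "\<epsilon> > 0"
  obtain \<delta> where d: "\<delta> > 0" and *: "\<forall>(n::nat) x y. (\<forall>i<n. c \<le> x i \<and> x i \<le> y i \<and> y i \<le> d) \<longrightarrow>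
     (\<forall>i<n. \<forall>j<n. i \<noteq> j \<longrightarrow> {x i<..<y i} \<inter> {x j<..<y j} = {}) \<longrightarrow>
     (\<Sum>i<n. y i - x i) < \<delta> \<longrightarrow> (\<Sum>i<n. norm (f (y i) - f (x i))) < \<epsilon>"
    using assms[unfolded abs_cont_on_def, rule_format, OF e] by blast
  have "dist (f y) (f x) < \<epsilon>" if "y \<in> {c..d}" "dist y x < \<delta>" for y
    using *[rule_format, of 1 "\<lambda>_. min x y" "\<lambda>_. max x y"] x that
    by (cases "x \<le> y") (auto simp: dist_norm norm_minus_commute)
  then show "\<exists>\<delta>>0. \<forall>y\<in>{c..d}. dist y x < \<delta> \<longrightarrow> dist (f y) (f x) < \<epsilon>" using d by blast
qed

text \<open>A single comparison of increments from which sums, products and functions that agree on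
  the interval all inherit absolute continuity.\<close>

lemma abs_cont_on_dominated:
  assumes "abs_cont_on c d f" "abs_cont_on c d g"
    and bd: "\<And>x y. x \<in> {c..d} \<Longrightarrow> y \<in> {c..d} \<Longrightarrow> norm (h y - h x) \<le> M * (norm (f y - f x) + norm (g y - g x))"
    and M: "M > 0"
  shows "abs_cont_on c d h"
  unfolding abs_cont_on_def
proof (intro allI impI)
  fix \<epsilon> :: real assume "\<epsilon> > 0"
  then have e: "\<epsilon>/M/2 > 0" using M by simp
  obtain \<delta>1 where d1: "\<delta>1 > 0" and 1: "\<forall>(n::nat) x y. (\<forall>i<n. c \<le> x i \<and> x i \<le> y i \<and> y i \<le> d) \<longrightarrow>
     (\<forall>i<n. \<forall>j<n. i \<noteq> j \<longrightarrow> {x i<..<y i} \<inter> {x j<..<y j} = {}) \<longrightarrow>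
     (\<Sum>i<n. y i - x i) < \<delta>1 \<longrightarrow> (\<Sum>i<n. norm (f (y i) - f (x i))) < \<epsilon>/M/2"
    using assms(1)[unfolded abs_cont_on_def, rule_format, OF e] by blast
  obtain \<delta>2 where d2: "\<delta>2 > 0" and 2: "\<forall>(n::nat) x y. (\<forall>i<n. c \<le> x i \<and> x i \<le> y i \<and> y i \<le> d) \<longrightarrow>
     (\<forall>i<n. \<forall>j<n. i \<noteq> j \<longrightarrow> {x i<..<y i} \<inter> {x j<..<y j} = {}) \<longrightarrow>
     (\<Sum>i<n. y i - x i) < \<delta>2 \<longrightarrow> (\<Sum>i<n. norm (g (y i) - g (x i))) < \<epsilon>/M/2"
    using assms(2)[unfolded abs_cont_on_def, rule_format, OF e] by blast
  show "\<exists>\<delta>>0. \<forall>(n::nat) x y. (\<forall>i<n. c \<le> x i \<and> x i \<le> y i \<and> y i \<le> d) \<longrightarrow>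
     (\<forall>i<n. \<forall>j<n. i \<noteq> j \<longrightarrow> {x i<..<y i} \<inter> {x j<..<y j} = {}) \<longrightarrow>
     (\<Sum>i<n. y i - x i) < \<delta> \<longrightarrow> (\<Sum>i<n. norm (h (y i) - h (x i))) < \<epsilon>"
  proof (intro exI[of _ "min \<delta>1 \<delta>2"] conjI allI impI)
    fix n :: nat and x y
    assume *: "\<forall>i<n. c \<le> x i \<and> x i \<le> y i \<and> y i \<le> d"
     "\<forall>i<n. \<forall>j<n. i \<noteq> j \<longrightarrow> {x i<..<y i} \<inter> {x j<..<y j} = {}" "(\<Sum>i<n. y i - x i) < min \<delta>1 \<delta>2"
    have "(\<Sum>i<n. norm (h (y i) - h (x i))) \<le> (\<Sum>i<n. M * (norm (f (y i) - f (x i)) + norm (g (y i) - g (x i))))"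
      using * by (intro sum_mono bd) (auto intro: order_trans)
    also have "\<dots> = M * ((\<Sum>i<n. norm (f (y i) - f (x i))) + (\<Sum>i<n. norm (g (y i) - g (x i))))"
      by (simp only: sum.distrib flip: sum_distrib_left)
    also have "\<dots> < M * (\<epsilon>/M/2 + \<epsilon>/M/2)"
      using 1[rule_format, of n x y] 2[rule_format, of n x y] * M
      by (intro mult_strict_left_mono add_strict_mono) auto
    also have "\<dots> = \<epsilon>" using M by simp
    finally show "(\<Sum>i<n. norm (h (y i) - h (x i))) < \<epsilon>" .
  qed (use d1 d2 in auto)
qed

lemma abs_cont_on_add:
  assumes "abs_cont_on c d f" "abs_cont_on c d g"
  shows "abs_cont_on c d (\<lambda>x. f x + g x)"
proof (rule abs_cont_on_dominated[OF assms, where M=1])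
  fix x y
  show "norm (f y + g y - (f x + g x)) \<le> 1 * (norm (f y - f x) + norm (g y - g x))"
    by (simp add: add_diff_add norm_triangle_ineq)
qed simp

lemma abs_cont_on_mult:
  assumes "abs_cont_on c d f" "abs_cont_on c d g"
  shows "abs_cont_on c d (\<lambda>x. f x * g x)"
proof -
  have "bounded (f ` {c..d})" "bounded (g ` {c..d})"
    by (intro compact_imp_bounded compact_continuous_image abs_cont_on_continuous assms compact_Icc)+
  then obtain F G where FG: "F > 0" "G > 0" "\<And>x. x \<in> {c..d} \<Longrightarrow> norm (f x) \<le> F" "\<And>x. x \<in> {c..d} \<Longrightarrow> norm (g x) \<le> G"
    unfolding bounded_pos by (metis imageI)
  show ?thesis
  proof (rule abs_cont_on_dominated[OF assms, where M="F + G"])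
    fix x y assume xy: "x \<in> {c..d}" "y \<in> {c..d}"
    have "f y * g y - f x * g x = (f y - f x) * g y + f x * (g y - g x)" by (simp add: algebra_simps)
    also have "norm \<dots> \<le> norm (f y - f x) * norm (g y) + norm (f x) * norm (g y - g x)"
      by (metis norm_mult norm_triangle_ineq)
    also have "\<dots> \<le> norm (f y - f x) * (F + G) + (F + G) * norm (g y - g x)"
      using FG xy by (intro add_mono mult_left_mono mult_right_mono) (auto intro: add_increasing add_increasing2 less_imp_le)
    also have "\<dots> = (F + G) * (norm (f y - f x) + norm (g y - g x))" by (simp add: algebra_simps)
    finally show "norm (f y * g y - f x * g x) \<le> (F + G) * (norm (f y - f x) + norm (g y - g x))" .
  qed (use FG in auto)
qed

text \<open>By dominated convergence the excess of \<open>norm (g x)\<close> over a high level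
  \<open>B\<close> has small integral. The remaining part is bounded by \<open>B\<close>, so it
  integrates to at most \<open>B\<close> times the measure of the set.\<close>

lemma integrable_small_on_small_sets:
  fixes g :: "'a \<Rightarrow> 'b::{banach,second_countable_topology}"
  assumes g: "integrable M g" and e: "\<epsilon> > 0"
  obtains B where "B > 0" "(LINT x|M. norm (g x) - min (norm (g x)) B) < \<epsilon>"
proof -
  have [measurable]: "g \<in> borel_measurable M" using g by auto
  have "(\<lambda>n. LINT x|M. norm (g x) - min (norm (g x)) (real n)) \<longlonglongrightarrow> (LINT x|M. 0)"
  proof (rule integral_dominated_convergence[where w="\<lambda>x. norm (g x)"])
    show "AE x in M. (\<lambda>n. norm (g x) - min (norm (g x)) (real n)) \<longlonglongrightarrow> 0"
    proof (rule AE_I2)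
      fix x
      have "\<forall>\<^sub>F n in sequentially. norm (g x) - min (norm (g x)) (real n) = 0"
        using eventually_ge_at_top[of "nat \<lceil>norm (g x)\<rceil>"]
        by eventually_elim (simp add: min_def nat_le_iff ceiling_le_iff)
      then show "(\<lambda>n. norm (g x) - min (norm (g x)) (real n)) \<longlonglongrightarrow> 0"
        by (rule tendsto_eventually)
    qed
  qed (use g in auto)
  then have "\<forall>\<^sub>F n in sequentially. (LINT x|M. norm (g x) - min (norm (g x)) (real n)) < \<epsilon>"
    using e by (intro order_tendstoD(2)) auto
  then have "\<forall>\<^sub>F n in sequentially. (LINT x|M. norm (g x) - min (norm (g x)) (real n)) < \<epsilon> \<and> n > 0"
    using eventually_gt_at_top by (rule eventually_conj)
  then obtain n where "(LINT x|M. norm (g x) - min (norm (g x)) (real n)) < \<epsilon>" "n > 0"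
    using eventually_happens sequentially_bot by blast
  then show ?thesis by (intro that[of n]) auto
qed

text \<open>Split \<open>norm (g t)\<close> into a part bounded by \<open>B\<close> and the excess
  \<open>h\<close>. The first costs \<open>B\<close> times the total length, which the choice of the
  length bound \<open>\<epsilon>/2/B\<close> keeps below half of the tolerance; the second costs at
  most the whole integral of \<open>h\<close>, however many intervals there are.\<close>

lemma integral_abs_cont_on:
  fixes g G :: "real \<Rightarrow> complex"
  assumes g: "integrable (lebesgue_on {c..d}) g"
    and G: "\<And>u v. c \<le> u \<Longrightarrow> u \<le> v \<Longrightarrow> v \<le> d \<Longrightarrow> G v - G u = integral {u..v} g"
  shows "abs_cont_on c d G"
  unfolding abs_cont_on_def
proof (intro allI impI)
  fix \<epsilon> :: real assume e: "\<epsilon> > 0"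
  let ?M = "lebesgue_on {c..d}"
  obtain B where B: "B > 0" "(LINT x|?M. norm (g x) - min (norm (g x)) B) < \<epsilon>/2"
    using integrable_small_on_small_sets[OF g, of "\<epsilon>/2"] e by auto
  have gm[measurable]: "g \<in> borel_measurable ?M" using g by auto
  define h where "h x = norm (g x) - min (norm (g x)) B" for x
  have h: "integrable ?M h" "\<And>x. h x \<ge> 0" unfolding h_def
    by (rule Bochner_Integration.integrable_bound[where f="\<lambda>x. norm (g x)"]) (use g B in \<open>auto simp: min_def\<close>)
  have "(\<Sum>i<n. norm (G (y i) - G (x i))) < \<epsilon>"
    if xy: "\<forall>i<n. c \<le> x i \<and> x i \<le> y i \<and> y i \<le> d"
     and dj: "\<forall>i<n. \<forall>j<n. i \<noteq> j \<longrightarrow> {x i<..<y i} \<inter> {x j<..<y j} = {}" and sm: "(\<Sum>i<n. y i - x i) < \<epsilon>/2/B"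
    for n :: nat and x y
  proof -
    have im: "{x i<..<y i} \<in> sets ?M" if "i < n" for i
      using xy that by (intro sets_restrict_space_iff[THEN iffD2]) force+
    have 1: "norm (G (y i) - G (x i)) \<le> B * (y i - x i) + (LINT t|?M. indicator {x i<..<y i} t * h t)" if i: "i < n" for i
    proof -
      have sub: "{x i..y i} \<subseteq> {c..d}" "{x i<..<y i} \<subseteq> {c..d}" using xy i by force+
      have gi: "integrable ?M (\<lambda>t. indicator {x i<..<y i} t *\<^sub>R g t)"
        using im[OF i] g by (intro integrable_mult_indicator) auto
      have hi: "integrable ?M (\<lambda>t. indicator {x i<..<y i} t * h t)"
        using im[OF i] h integrable_mult_indicator[of "{x i<..<y i}" ?M h] by simp
      have fin: "integrable ?M (\<lambda>t. B * indicator {x i<..<y i} t)"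
        using im[OF i] finite_measure.emeasure_finite[OF finite_measure_lebesgue_on, of "{c..d}"]
        by (intro integrable_mult_right integrable_real_indicator) (auto simp: less_top)
      have "G (y i) - G (x i) = integral {x i<..<y i} g"
        using G[of "x i" "y i"] xy i by (simp add: integral_open_interval_real)
      also have "\<dots> = integral {c..d} (\<lambda>t. indicator {x i<..<y i} t *\<^sub>R g t)"
        using integral_restrict_Int[of "{c..d}" "{x i<..<y i}" g] sub
        by (simp add: indicator_scaleR_eq_if Int_absorb1 Int_absorb2)
      also have "\<dots> = (LINT t|?M. indicator {x i<..<y i} t *\<^sub>R g t)"
        by (rule lebesgue_integral_eq_integral[OF gi, symmetric]) auto
      also have "norm \<dots> \<le> (LINT t|?M. B * indicator {x i<..<y i} t + indicator {x i<..<y i} t * h t)"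
      proof (rule Bochner_Integration.integral_norm_bound_integral[OF gi])
        fix t
        show "norm (indicator {x i<..<y i} t *\<^sub>R g t) \<le> B * indicator {x i<..<y i} t + indicator {x i<..<y i} t * h t"
          by (auto simp: h_def indicator_def)
      qed (intro Bochner_Integration.integrable_add fin hi)
      also have "\<dots> = B * (LINT t|?M. indicator {x i<..<y i} t) + (LINT t|?M. indicator {x i<..<y i} t * h t)"
        using fin hi by simp
      also have "(LINT t|?M. indicator {x i<..<y i} t) = y i - x i"
        using im[OF i] sub xy[rule_format, OF i] by (simp add: measure_restrict_space Int_absorb2)
      finally show ?thesis .
    qed
    have "(\<Sum>i<n. (LINT t|?M. indicator {x i<..<y i} t * h t)) = (LINT t|?M. (\<Sum>i<n. indicator {x i<..<y i} t * h t))"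
      using im h integrable_mult_indicator[of _ ?M h] by (intro Bochner_Integration.integral_sum[symmetric]) auto
    also have "\<dots> \<le> (LINT t|?M. h t)"
    proof (rule integral_mono)
      show "integrable ?M (\<lambda>t. \<Sum>i<n. indicator {x i<..<y i} t * h t)"
        using im h integrable_mult_indicator[of _ ?M h] by (intro Bochner_Integration.integrable_sum) auto
      fix t
      \<comment> \<open>Disjointness: a point lies in at most one of the open intervals, so the
        excess is never counted twice.\<close>
      have "(\<Sum>i<n. indicator {x i<..<y i} t :: real) \<le> 1"
      proof (cases "\<exists>j<n. t \<in> {x j<..<y j}")
        case True
        then obtain j where j: "j < n" "t \<in> {x j<..<y j}" by blast
        have "t \<notin> {x i<..<y i}" if "i < n" "i \<noteq> j" for i
          using dj[rule_format, OF that(1) j(1) that(2)] j(2) by blast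
        then have "(\<Sum>i<n. indicator {x i<..<y i} t :: real) = (\<Sum>i<n. if i = j then 1 else 0)"
          using j by (intro sum.cong) (auto simp: indicator_def)
        then show ?thesis using j by simp
      next
        case False
        then have "(\<Sum>i<n. indicator {x i<..<y i} t :: real) = 0"
          by (intro sum.neutral) (auto simp: indicator_def)
        then show ?thesis by simp
      qed
      then have "(\<Sum>i<n. indicator {x i<..<y i} t :: real) * h t \<le> 1 * h t"
        using h(2) by (rule mult_right_mono)
      then show "(\<Sum>i<n. indicator {x i<..<y i} t * h t) \<le> h t" by (simp add: sum_distrib_right)
    qed (rule h)
    finally have 2: "(\<Sum>i<n. (LINT t|?M. indicator {x i<..<y i} t * h t)) < \<epsilon>/2"
      using B(2) by (simp add: h_def)
    have "(\<Sum>i<n. norm (G (y i) - G (x i))) \<le> (\<Sum>i<n. B * (y i - x i) + (LINT t|?M. indicator {x i<..<y i} t * h t))"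
      by (rule sum_mono) (use 1 in auto)
    also have "\<dots> = B * (\<Sum>i<n. y i - x i) + (\<Sum>i<n. (LINT t|?M. indicator {x i<..<y i} t * h t))"
      by (simp add: sum_distrib_left sum.distrib)
    also have "B * (\<Sum>i<n. y i - x i) < \<epsilon>/2"
      using sm B(1) by (simp add: field_simps)
    finally show ?thesis using 2 by linarith
  qed
  then show "\<exists>\<delta>>0. \<forall>(n::nat) x y. (\<forall>i<n. c \<le> x i \<and> x i \<le> y i \<and> y i \<le> d) \<longrightarrow>
     (\<forall>i<n. \<forall>j<n. i \<noteq> j \<longrightarrow> {x i<..<y i} \<inter> {x j<..<y j} = {}) \<longrightarrow>
     (\<Sum>i<n. y i - x i) < \<delta> \<longrightarrow> (\<Sum>i<n. norm (G (y i) - G (x i))) < \<epsilon>"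
    using e B(1) by (intro exI[of _ "\<epsilon>/2/B"]) auto
qed

section \<open>Absolutely continuous functions with a given derivative almost everywhere\<close>

definition loc_integrable :: "ereal \<Rightarrow> ereal \<Rightarrow> (real \<Rightarrow> complex) \<Rightarrow> bool" where
  "loc_integrable a b g \<longleftrightarrow> (\<forall>c \<in> einterval a b. \<forall>d \<in> einterval a b. integrable (lebesgue_on {c..d}) g)"

text \<open>The a.e. derivative is an explicit argument instead of an existential at each point, so
  the product rule and the integral equation become rules about pairs.\<close>

definition AC_deriv :: "ereal \<Rightarrow> ereal \<Rightarrow> (real \<Rightarrow> complex) \<Rightarrow> (real \<Rightarrow> complex) \<Rightarrow> bool" where
  "AC_deriv a b f f' \<longleftrightarrow> AC_loc a b f \<and>
     (AE x in lebesgue_on (einterval a b). (f has_vector_derivative f' x) (at x))"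

lemma AC_locD: "AC_loc a b f \<Longrightarrow> c \<in> einterval a b \<Longrightarrow> d \<in> einterval a b \<Longrightarrow> c \<le> d \<Longrightarrow> abs_cont_on c d f"
  by (auto simp: AC_loc_def einterval_iff)

lemma AC_locI: "(\<And>c d. c \<in> einterval a b \<Longrightarrow> d \<in> einterval a b \<Longrightarrow> c \<le> d \<Longrightarrow> abs_cont_on c d f) \<Longrightarrow> AC_loc a b f"
  unfolding AC_loc_def einterval_iff
  by (smt (verit) ereal_less_eq(3) le_less_trans less_le_trans)

lemma AC_loc_continuous:
  assumes "AC_loc a b f"
  shows "continuous_on (einterval a b) f"
proof (rule continuous_at_imp_continuous_on, rule ballI)
  fix x assume "x \<in> einterval a b"
  then obtain c d where cd: "c < x" "x < d" "c \<in> einterval a b" "d \<in> einterval a b" by (rule einterval_box)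
  then have "continuous_on {c..d} f" by (intro abs_cont_on_continuous AC_locD[OF assms]) auto
  then show "isCont f x" using cd by (intro continuous_on_interior[of "{c..d}"]) auto
qed

lemma AC_deriv_continuous: "AC_deriv a b f f' \<Longrightarrow> continuous_on (einterval a b) f"
  by (auto simp: AC_deriv_def intro: AC_loc_continuous)

text \<open>Because \<open>has_integral\<close> is the gauge integral, the integrability of
  \<open>f'\<close> is part of the conclusion.\<close>

lemma AC_deriv_has_integral:
  assumes f: "AC_deriv a b f f'" and cd: "c \<in> einterval a b" "d \<in> einterval a b" "c \<le> d"
  shows "(f' has_integral (f d - f c)) {c..d}"
proof (rule abs_cont_on_has_integral[OF cd(3)])
  show "abs_cont_on c d f" using f cd by (auto simp: AC_deriv_def AC_locD)
  show "negligible {x \<in> einterval a b. \<not> (f has_vector_derivative f' x) (at x)}"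
    using f by (simp add: AC_deriv_def AE_einterval_iff_negligible)
  fix x assume "x \<in> {c..d} - {x \<in> einterval a b. \<not> (f has_vector_derivative f' x) (at x)}"
  then have "(f has_vector_derivative f' x) (at x)" using einterval_subset[OF cd(1,2)] by auto
  then show "(f has_vector_derivative f' x) (at x within {c..d})"
    by (rule has_vector_derivative_at_within)
qed

lemma AC_loc_cong:
  assumes "AC_loc a b f" "\<And>x. x \<in> einterval a b \<Longrightarrow> g x = f x"
  shows "AC_loc a b g"
proof (rule AC_locI)
  fix c d assume cd: "c \<in> einterval a b" "d \<in> einterval a b" "c \<le> d"
  have "norm (g y - g x) \<le> 1 * (norm (f y - f x) + norm (f y - f x))" if "x \<in> {c..d}" "y \<in> {c..d}" for x y
    using assms(2) that einterval_subset[OF cd(1,2)] by (auto simp: subset_eq)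
  then show "abs_cont_on c d g"
    by (rule abs_cont_on_dominated[OF AC_locD[OF assms(1) cd] AC_locD[OF assms(1) cd]]) auto
qed

lemma AC_deriv_cong:
  assumes "AC_deriv a b f f'" "\<And>x. x \<in> einterval a b \<Longrightarrow> g x = f x"
    "AE x in lebesgue_on (einterval a b). g' x = f' x"
  shows "AC_deriv a b g g'"
  unfolding AC_deriv_def
proof
  show "AC_loc a b g" using assms by (auto simp: AC_deriv_def intro: AC_loc_cong)
  have "AE x in lebesgue_on (einterval a b). (f has_vector_derivative f' x) (at x)"
    using assms(1) by (simp add: AC_deriv_def)
  then have "AE x in lebesgue_on (einterval a b). (f has_vector_derivative f' x) (at x) \<and> g' x = f' x"
    using assms(3) by auto
  then show "AE x in lebesgue_on (einterval a b). (g has_vector_derivative g' x) (at x)"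
  proof (rule lebesgue_on_mono)
    fix x assume *: "(f has_vector_derivative f' x) (at x) \<and> g' x = f' x" "x \<in> einterval a b"
    then show "(g has_vector_derivative g' x) (at x)"
      using has_vector_derivative_transform_within_open[of f "f' x" x "einterval a b" g] assms(2) by auto
  qed
qed

lemma AC_deriv_add:
  assumes "AC_deriv a b f f'" "AC_deriv a b g g'"
  shows "AC_deriv a b (\<lambda>x. f x + g x) (\<lambda>x. f' x + g' x)"
  using assms unfolding AC_deriv_def
  by (auto intro!: AC_locI abs_cont_on_add intro: AC_locD derivative_eq_intros)

lemma AC_deriv_mult:
  assumes "AC_deriv a b f f'" "AC_deriv a b g g'"
  shows "AC_deriv a b (\<lambda>x. f x * g x) (\<lambda>x. f' x * g x + f x * g' x)"
  unfolding AC_deriv_def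
proof
  show "AC_loc a b (\<lambda>x. f x * g x)"
    using assms unfolding AC_deriv_def by (auto intro!: AC_locI abs_cont_on_mult intro: AC_locD)
  have "AE x in lebesgue_on (einterval a b). (f has_vector_derivative f' x) (at x)"
     "AE x in lebesgue_on (einterval a b). (g has_vector_derivative g' x) (at x)"
    using assms by (auto simp: AC_deriv_def)
  then show "AE x in lebesgue_on (einterval a b).
     ((\<lambda>x. f x * g x) has_vector_derivative f' x * g x + f x * g' x) (at x)"
  proof eventually_elim
    case (elim x)
    then show ?case by (auto intro!: has_vector_derivative_eq_rhs[OF has_vector_derivative_mult])
  qed
qed

lemma AC_deriv_const: "AC_deriv a b (\<lambda>_. k) (\<lambda>_. 0)"
  by (auto simp: AC_deriv_def AC_loc_def abs_cont_on_def intro: exI[of _ 1])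

lemma AC_deriv_cmult:
  assumes "AC_deriv a b f f'"
  shows "AC_deriv a b (\<lambda>x. k * f x) (\<lambda>x. k * f' x)"
  using AC_deriv_mult[OF AC_deriv_const assms] by simp

lemma AC_deriv_diff:
  assumes "AC_deriv a b f f'" "AC_deriv a b g g'"
  shows "AC_deriv a b (\<lambda>x. f x - g x) (\<lambda>x. f' x - g' x)"
  using AC_deriv_add[OF assms(1) AC_deriv_cmult[OF assms(2), of "-1"]] by simp

lemma AC_deriv_power:
  assumes "AC_deriv a b f f'"
  shows "AC_deriv a b (\<lambda>x. f x ^ n) (\<lambda>x. of_nat n * f x ^ (n - 1) * f' x)"
proof (induction n)
  case 0
  then show ?case using AC_deriv_const[of a b 1] by simp
next
  case (Suc n)
  from AC_deriv_mult[OF assms Suc] show ?case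
    \<comment> \<open>For \<open>n = 0\<close> natural subtraction makes the exponent
      \<open>n - 1\<close> equal to 0, and the factor \<open>of_nat n\<close> removes the term;
      hence the case split.\<close>
    by (rule AC_deriv_cong) (auto simp: algebra_simps intro!: AE_I2, (cases n; simp add: algebra_simps))
qed

lemma AC_deriv_const_if_zero:
  assumes "AC_deriv a b f (\<lambda>_. 0)" "x \<in> einterval a b" "y \<in> einterval a b"
  shows "f x = f y"
proof -
  have "f d = f c" if "c \<le> d" "c \<in> einterval a b" "d \<in> einterval a b" for c d
    using AC_deriv_has_integral[OF assms(1) that(2,3,1)] has_integral_0[of "{c..d}"]
    by (metis eq_iff_diff_eq_0 has_integral_unique)
  then show ?thesis using assms(2,3) by (metis linear)
qed

text \<open>Integrate the majorant: \<open>g\<close> is its primitive. It enters through real parts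
  because \<open>AC_deriv\<close> concerns complex functions.\<close>

lemma AC_deriv_norm_bound:
  assumes "AC_deriv a b f f'" "AC_deriv a b g g'" and cd: "c \<in> einterval a b" "d \<in> einterval a b" "c \<le> d"
    and bd: "\<And>x. x \<in> {c..d} \<Longrightarrow> norm (f' x) \<le> Re (g' x)"
  shows "norm (f d - f c) \<le> Re (g d) - Re (g c)"
proof -
  have f: "(f' has_integral (f d - f c)) {c..d}" and g: "(g' has_integral (g d - g c)) {c..d}"
    using AC_deriv_has_integral assms by blast+
  have g': "((\<lambda>x. Re (g' x)) has_integral (Re (g d) - Re (g c))) {c..d}"
    using has_integral_linear[OF g bounded_linear_Re] by (simp add: o_def)
  have "norm (integral {c..d} f') \<le> integral {c..d} (\<lambda>x. Re (g' x))"
    using f g' bd by (intro integral_norm_bound_integral) (auto simp: integrable_on_def)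
  then show ?thesis using f g' by (simp add: integral_unique)
qed

text \<open>Each compact subinterval comes with its own exceptional null set. Intervals with
  rational endpoints already cover the open interval, so countably many of these null sets
  suffice.\<close>

lemma AC_derivI_integral:
  assumes g: "loc_integrable a b g"
    and G: "\<And>c d. c \<in> einterval a b \<Longrightarrow> d \<in> einterval a b \<Longrightarrow> c \<le> d \<Longrightarrow> G d - G c = integral {c..d} g"
  shows "AC_deriv a b G g"
  unfolding AC_deriv_def
proof
  have G': "G v - G u = integral {u..v} g"
    if "c \<in> einterval a b" "d \<in> einterval a b" "c \<le> u" "u \<le> v" "v \<le> d" for c d u v
    using einterval_subset[OF that(1,2)] that by (intro G) auto
  have gi: "integrable (lebesgue_on {c..d}) g" if "c \<in> einterval a b" "d \<in> einterval a b" for c d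
    using g that by (auto simp: loc_integrable_def)
  show "AC_loc a b G"
    using G' by (intro AC_locI integral_abs_cont_on[where g=g] gi) auto
  have *: "\<exists>N. negligible N \<and> (\<forall>x \<in> {c<..<d} - N. (G has_vector_derivative g x) (at x))"
    if "c \<in> einterval a b" "d \<in> einterval a b" for c d
    using G'[OF that] gi[OF that] by (intro indefinite_integral_AE_derivative integrable_on_lebesgue_on) auto
  have "\<forall>e. \<exists>N. fst e \<in> einterval a b \<longrightarrow> snd e \<in> einterval a b \<longrightarrow> negligible N \<and>
      (\<forall>x \<in> {fst e<..<snd e} - N. (G has_vector_derivative g x) (at x))"
    using * by metis
  then obtain N where N: "\<And>c d. c \<in> einterval a b \<Longrightarrow> d \<in> einterval a b \<Longrightarrow> negligible (N (c,d)) \<and>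
     (\<forall>x \<in> {c<..<d} - N (c,d). (G has_vector_derivative g x) (at x))"
    by (metis fst_conv snd_conv)
  let ?Q = "{e \<in> \<rat> \<times> \<rat>. fst e \<in> einterval a b \<and> snd e \<in> einterval a b}"
  have "countable ?Q" by (rule countable_subset[of _ "\<rat> \<times> \<rat>"]) (auto intro: countable_rat)
  then have "negligible (\<Union>e\<in>?Q. N e)"
    by (intro negligible_countable_Union countable_image) (use N in auto)
  moreover have "{x \<in> einterval a b. \<not> (G has_vector_derivative g x) (at x)} \<subseteq> (\<Union>e\<in>?Q. N e)"
  proof (rule subsetI, rule ccontr)
    fix x assume x: "x \<in> {x \<in> einterval a b. \<not> (G has_vector_derivative g x) (at x)}" and nx: "x \<notin> (\<Union>e\<in>?Q. N e)"
    then obtain c d where cd: "c < x" "x < d" "c \<in> einterval a b" "d \<in> einterval a b" by (auto elim: einterval_box)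
    obtain c' d' where c': "c' \<in> \<rat>" "c < c'" "c' < x" "d' \<in> \<rat>" "x < d'" "d' < d"
      using Rats_dense_in_real cd(1,2) by metis
    have "c' \<in> einterval a b" "d' \<in> einterval a b"
      using einterval_subset[OF cd(3,4)] c' cd by auto
    then have "(G has_vector_derivative g x) (at x)"
      using N[of c' d'] c' nx by auto
    then show False using x by auto
  qed
  ultimately show "AE x in lebesgue_on (einterval a b). (G has_vector_derivative g x) (at x)"
    unfolding AE_einterval_iff_negligible by (rule negligible_subset)
qed

lemma loc_integrable_primitive:
  assumes g: "loc_integrable a b g" and x0: "x0 \<in> einterval a b"
  obtains G where "AC_deriv a b G g" "G x0 = k"
proof -
  define G where "G x = k + (if x0 \<le> x then integral {x0..x} g else - integral {x..x0} g)" for x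
  have gi: "g integrable_on {c..d}" if "c \<in> einterval a b" "d \<in> einterval a b" for c d
    using g that by (auto simp: loc_integrable_def intro: integrable_on_lebesgue_on)
  have "G d - G c = integral {c..d} g" if cd: "c \<in> einterval a b" "d \<in> einterval a b" "c \<le> d" for c d
  proof -
    consider "x0 \<le> c" | "c < x0" "x0 \<le> d" | "d < x0" by linarith
    then show ?thesis
    proof cases
      case 1
      then show ?thesis using Henstock_Kurzweil_Integration.integral_combine[of x0 c d g] cd gi[OF x0 cd(2)]
        by (auto simp: G_def algebra_simps)
    next
      case 2
      then show ?thesis using Henstock_Kurzweil_Integration.integral_combine[of c x0 d g] cd gi[OF cd(1,2)]
        by (auto simp: G_def algebra_simps)
    next
      case 3
      then show ?thesis using Henstock_Kurzweil_Integration.integral_combine[of c d x0 g] cd gi[OF cd(1) x0]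
        by (auto simp: G_def algebra_simps)
    qed
  qed
  then have "AC_deriv a b G g" by (rule AC_derivI_integral[OF g])
  moreover have "G x0 = k" by (simp add: G_def)
  ultimately show ?thesis by (rule that)
qed

text \<open>Estimates from a base point run in both directions; the absolute value absorbs the
  orientation.\<close>

lemma AC_deriv_norm_bound_segment:
  assumes "AC_deriv a b f f'" "AC_deriv a b g g'" "x \<in> einterval a b" "y \<in> einterval a b"
    and "\<And>t. t \<in> closed_segment x y \<Longrightarrow> norm (f' t) \<le> Re (g' t)"
  shows "norm (f y - f x) \<le> \<bar>Re (g y) - Re (g x)\<bar>"
proof (cases "x \<le> y")
  case True
  then show ?thesis
    using AC_deriv_norm_bound[OF assms(1-4)] assms(5) by (force simp: closed_segment_eq_real_ivl)
next
  case False
  then show ?thesis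
    using AC_deriv_norm_bound[OF assms(1,2,4,3)] assms(5)
    by (force simp: closed_segment_eq_real_ivl norm_minus_commute)
qed

text \<open>Lets the primitive of a real coefficient bound be used as a real number in the Picard
  estimates.\<close>

lemma AC_deriv_real:
  assumes "AC_deriv a b f (\<lambda>x. complex_of_real (g x))" "x0 \<in> einterval a b" "f x0 = 0" "x \<in> einterval a b"
  shows "Im (f x) = 0"
proof -
  have "Im (f d) = Im (f c)" if "c \<in> einterval a b" "d \<in> einterval a b" "c \<le> d" for c d
  proof -
    have "((\<lambda>x. Im (complex_of_real (g x))) has_integral Im (f d - f c)) {c..d}"
      using has_integral_linear[OF AC_deriv_has_integral[OF assms(1) that] bounded_linear_Im] by (simp add: o_def)
    then have "Im (f d - f c) = 0" by simp
    then show ?thesis by simp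
  qed
  then show ?thesis using assms(2-4) by (metis linear zero_complex.sel(2))
qed

lemma einterval_segment:
  "x \<in> einterval a b \<Longrightarrow> y \<in> einterval a b \<Longrightarrow> closed_segment x y \<subseteq> einterval a b"
  by (cases "x \<le> y") (simp_all add: closed_segment_eq_real_ivl einterval_subset)

text \<open>Compare with the primitive \<open>G\<close> of \<open>g\<close> that takes the value
  \<open>\<alpha>\<close> at \<open>x0\<close>. Derivatives that differ by at most
  \<open>\<epsilon> * k\<close> have primitives that differ by at most \<open>\<epsilon>\<close>
  times the increment of \<open>K\<close>, so \<open>F n\<close> converges to \<open>G\<close> and
  the limit \<open>f\<close> must be \<open>G\<close>.\<close>

lemma AC_deriv_limit:
  assumes F: "\<And>n. AC_deriv a b (F n) (F' n)" "\<And>n. F n x0 = \<alpha>" and x0: "x0 \<in> einterval a b"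
    and g: "loc_integrable a b g"
    and K: "AC_deriv a b K (\<lambda>x. complex_of_real (k x))"
    and F': "\<And>x \<epsilon>. x \<in> einterval a b \<Longrightarrow> \<epsilon> > 0 \<Longrightarrow>
       \<forall>\<^sub>F n in sequentially. \<forall>t\<in>closed_segment x0 x. norm (g t - F' n t) \<le> \<epsilon> * k t"
    and lim: "\<And>x. x \<in> einterval a b \<Longrightarrow> (\<lambda>n. F n x) \<longlonglongrightarrow> f x"
  shows "AC_deriv a b f g"
proof -
  obtain G where G: "AC_deriv a b G g" "G x0 = \<alpha>"
    by (rule loc_integrable_primitive[OF g x0])
  have "f x = G x" if x: "x \<in> einterval a b" for x
  proof -
    have "(\<lambda>n. F n x) \<longlonglongrightarrow> G x"
    proof (rule LIMSEQ_I)
      fix e :: real assume e: "e > 0"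
      \<comment> \<open>The summand 1 prevents division by zero when \<open>K\<close> takes the same
        value at \<open>x\<close> and \<open>x0\<close>.\<close>
      define \<epsilon> where "\<epsilon> = e / (\<bar>Re (K x) - Re (K x0)\<bar> + 1)"
      have eps: "\<epsilon> > 0" "\<epsilon> * \<bar>Re (K x) - Re (K x0)\<bar> < e" using e
        by (auto simp: \<epsilon>_def field_simps add_pos_nonneg)
      obtain N where N: "\<And>n t. n \<ge> N \<Longrightarrow> t \<in> closed_segment x0 x \<Longrightarrow> norm (g t - F' n t) \<le> \<epsilon> * k t"
        using F'[OF x eps(1)] unfolding eventually_sequentially by blast
      have "norm (F n x - G x) < e" if "n \<ge> N" for n
      proof -
        have "norm ((G x - F n x) - (G x0 - F n x0)) \<le> \<bar>Re (of_real \<epsilon> * K x) - Re (of_real \<epsilon> * K x0)\<bar>"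
          by (rule AC_deriv_norm_bound_segment[OF AC_deriv_diff[OF G(1) F(1)] AC_deriv_cmult[OF K] x0 x])
            (use N that in auto)
        also have "\<dots> = \<epsilon> * \<bar>Re (K x) - Re (K x0)\<bar>"
          using eps by (simp add: abs_mult flip: right_diff_distrib)
        finally show ?thesis using eps F(2) G(2) by (simp add: norm_minus_commute)
      qed
      then show "\<exists>no. \<forall>n\<ge>no. norm (F n x - G x) < e" by blast
    qed
    with lim[OF x] show ?thesis by (rule LIMSEQ_unique)
  qed
  then show ?thesis by (rule AC_deriv_cong[OF G(1)]) auto
qed


section \<open>Closure properties of local integrability\<close>

lemma loc_integrable_add:
  "loc_integrable a b f \<Longrightarrow> loc_integrable a b g \<Longrightarrow> loc_integrable a b (\<lambda>x. f x + g x)"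
  by (auto simp: loc_integrable_def)

lemma loc_integrable_diff:
  "loc_integrable a b f \<Longrightarrow> loc_integrable a b g \<Longrightarrow> loc_integrable a b (\<lambda>x. f x - g x)"
  by (auto simp: loc_integrable_def)

lemma loc_integrable_continuous_mult:
  assumes f: "continuous_on (einterval a b) f" and g: "loc_integrable a b g"
  shows "loc_integrable a b (\<lambda>x. f x * g x)"
  unfolding loc_integrable_def
proof (intro ballI)
  fix c d assume cd: "c \<in> einterval a b" "d \<in> einterval a b"
  have f': "continuous_on {c..d} f" using f einterval_subset[OF cd] by (rule continuous_on_subset)
  then have "bounded (f ` {c..d})" by (intro compact_imp_bounded compact_continuous_image) auto
  then obtain B where B: "B > 0" "\<And>x. x \<in> {c..d} \<Longrightarrow> norm (f x) \<le> B" unfolding bounded_pos by blast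
  have gi: "integrable (lebesgue_on {c..d}) g" using g cd by (auto simp: loc_integrable_def)
  have [measurable]: "f \<in> borel_measurable (lebesgue_on {c..d})" "g \<in> borel_measurable (lebesgue_on {c..d})"
    using f' gi by (auto intro: continuous_imp_measurable_on_sets_lebesgue)
  show "integrable (lebesgue_on {c..d}) (\<lambda>x. f x * g x)"
  proof (rule Bochner_Integration.integrable_bound)
    show "integrable (lebesgue_on {c..d}) (\<lambda>x. of_real B * g x)" using gi by simp
    show "AE x in lebesgue_on {c..d}. norm (f x * g x) \<le> norm (complex_of_real B * g x)"
      using B by (intro AE_I2) (auto simp: norm_mult mult_right_mono)
  qed simp
qed

lemma loc_integrable_abs:
  assumes "loc_integrable a b f"
  shows "loc_integrable a b (\<lambda>x. complex_of_real (norm (f x)))"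
  using assms by (auto simp: loc_integrable_def)

lemma L1_loc_loc_integrable:
  assumes "L1_loc a b f"
  shows "loc_integrable a b (\<lambda>x. complex_of_real (f x))"
  unfolding loc_integrable_def
proof (intro ballI)
  fix c d assume "c \<in> einterval a b" "d \<in> einterval a b"
  then show "integrable (lebesgue_on {c..d}) (\<lambda>x. complex_of_real (f x))"
    using assms by (cases "c \<le> d") (auto simp: L1_loc_def einterval_iff)
qed

section \<open>The first order system\<close>

locale sturm_liouville =
  fixes a b :: ereal and p q r s :: "real \<Rightarrow> real"
  assumes ab: "a < b"
    and r_meas: "r \<in> borel_measurable (lebesgue_on (einterval a b))"
    and loc: "L1_loc a b (\<lambda>x. inverse (p x))" "L1_loc a b q" "L1_loc a b r" "L1_loc a b s"
    and r_pos: "AE x in lebesgue_on (einterval a b). r x > 0"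
    and p_nz: "AE x in lebesgue_on (einterval a b). p x \<noteq> 0"
begin

abbreviation "I \<equiv> einterval a b"

text \<open>Solving for the derivatives of \<open>f\<close> and of its quasi-derivative
  \<open>f1\<close> turns the second order equation with right-hand side \<open>h\<close> into a
  linear system whose coefficients are exactly the locally integrable functions 1/p, q, r and
  s.\<close>

definition system :: "(real \<Rightarrow> complex) \<Rightarrow> (real \<Rightarrow> complex) \<Rightarrow> (real \<Rightarrow> complex) \<Rightarrow> bool" where
  "system f f1 h \<longleftrightarrow>
     AC_deriv a b f (\<lambda>x. of_real (inverse (p x)) * f1 x - of_real (s x) * f x) \<and>
     AC_deriv a b f1 (\<lambda>x. of_real (s x) * f1 x + of_real (q x) * f x - of_real (r x) * h x)"

lemma loc_coeffs:
  "loc_integrable a b (\<lambda>x. of_real (inverse (p x)))" "loc_integrable a b (\<lambda>x. of_real (q x))"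
  "loc_integrable a b (\<lambda>x. of_real (r x))" "loc_integrable a b (\<lambda>x. of_real (s x))"
  by (rule loc[THEN L1_loc_loc_integrable])+

lemma nonempty: obtains x0 where "x0 \<in> I"
  using ab einterval_nonempty by blast

lemma system_continuous: "system f f1 h \<Longrightarrow> continuous_on I f" "system f f1 h \<Longrightarrow> continuous_on I f1"
  by (auto simp: system_def intro: AC_deriv_continuous)

text \<open>The set of disagreement is open and negligible, hence empty. This makes
  quasi-derivatives unique on the interval and determines resolvent values pointwise.\<close>

lemma AE_eq_continuous:
  fixes f g :: "real \<Rightarrow> complex"
  assumes "continuous_on I f" "continuous_on I g" "AE x in lebesgue_on I. f x = g x" "x \<in> I"
  shows "f x = g x"
proof (rule ccontr)
  assume ne: "f x \<noteq> g x"
  let ?U = "{x \<in> I. f x - g x \<in> - {0}}"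
  have "open ?U"
    using continuous_open_preimage[of I "\<lambda>x. f x - g x" "- {0}"] assms(1,2)
    by (auto intro: continuous_intros simp: Int_def vimage_def)
  moreover have "x \<in> ?U" using ne assms(4) by auto
  moreover have "negligible ?U" using assms(3) by (simp add: AE_einterval_iff_negligible)
  ultimately show False using open_not_negligible by blast
qed

lemma system_is_quasi_deriv:
  assumes "system f f1 h"
  shows "is_quasi_deriv a b p s f f1"
  unfolding is_quasi_deriv_def
proof
  show "AC_loc a b f1" using assms by (auto simp: system_def AC_deriv_def)
  have "AE x in lebesgue_on I. (f has_vector_derivative of_real (inverse (p x)) * f1 x - of_real (s x) * f x) (at x)"
    using assms by (auto simp: system_def AC_deriv_def)
  then show "AE x in lebesgue_on I. \<exists>f'. (f has_vector_derivative f') (at x) \<and>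
             f1 x = complex_of_real (p x) * (f' + complex_of_real (s x) * f x)"
    using p_nz
  proof eventually_elim
    case (elim x)
    then show ?case
      by (intro exI[of _ "of_real (inverse (p x)) * f1 x - of_real (s x) * f x"]) (auto simp: of_real_inverse)
  qed
qed

lemma quasi_deriv_unique:
  assumes "is_quasi_deriv a b p s f f1" "is_quasi_deriv a b p s f f2" "x \<in> I"
  shows "f1 x = f2 x"
proof (rule AE_eq_continuous)
  show "continuous_on I f1" "continuous_on I f2"
    using assms by (auto simp: is_quasi_deriv_def intro: AC_loc_continuous)
  have "AE x in lebesgue_on I. \<exists>f'. (f has_vector_derivative f') (at x) \<and>
             f1 x = complex_of_real (p x) * (f' + complex_of_real (s x) * f x)"
    "AE x in lebesgue_on I. \<exists>f'. (f has_vector_derivative f') (at x) \<and>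
             f2 x = complex_of_real (p x) * (f' + complex_of_real (s x) * f x)"
    using assms by (auto simp: is_quasi_deriv_def)
  then show "AE x in lebesgue_on I. f1 x = f2 x"
  proof eventually_elim
    case (elim x)
    then show ?case using vector_derivative_unique_at by metis
  qed
qed (rule assms)

lemma tau_eqD:
  assumes "tau_eq a b p q r s f h"
  shows "system f (quasi_deriv a b p s f) h"
proof -
  let ?f1 = "quasi_deriv a b p s f"
  have f: "AC_loc a b f" and ex: "\<exists>f1. is_quasi_deriv a b p s f f1"
    using assms by (auto simp: tau_eq_def D_tau_def)
  have f1: "is_quasi_deriv a b p s f ?f1"
    using someI_ex[OF ex] by (simp add: quasi_deriv_def)
  have "AE x in lebesgue_on I. \<exists>f'. (f has_vector_derivative f') (at x) \<and>
             ?f1 x = complex_of_real (p x) * (f' + complex_of_real (s x) * f x)"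
    using f1 by (auto simp: is_quasi_deriv_def)
  then have "AE x in lebesgue_on I. (f has_vector_derivative of_real (inverse (p x)) * ?f1 x - of_real (s x) * f x) (at x)"
    using p_nz
  proof eventually_elim
    case (elim x)
    then obtain f' where f': "(f has_vector_derivative f') (at x)"
      "?f1 x = complex_of_real (p x) * (f' + complex_of_real (s x) * f x)" by blast
    have "of_real (inverse (p x)) * ?f1 x - of_real (s x) * f x = f'"
      unfolding f'(2) using elim(2) by (simp add: mult.assoc[symmetric])
    with f'(1) show ?case by simp
  qed
  moreover have "AE x in lebesgue_on I. \<exists>f1'. (?f1 has_vector_derivative f1') (at x) \<and>
              h x = 1 / complex_of_real (r x) *
                (- f1' + complex_of_real (s x) * ?f1 x + complex_of_real (q x) * f x)"
    using assms by (auto simp: tau_eq_def)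
  then have "AE x in lebesgue_on I. (?f1 has_vector_derivative of_real (s x) * ?f1 x + of_real (q x) * f x - of_real (r x) * h x) (at x)"
    using r_pos
  proof eventually_elim
    case (elim x)
    then obtain f1' where f': "(?f1 has_vector_derivative f1') (at x)"
      "h x = 1 / complex_of_real (r x) *
                (- f1' + complex_of_real (s x) * ?f1 x + complex_of_real (q x) * f x)" by blast
    have "of_real (s x) * ?f1 x + of_real (q x) * f x - of_real (r x) * h x = f1'"
      unfolding f'(2) using elim(2) by simp
    with f'(1) show ?case by simp
  qed
  ultimately show ?thesis
    using f f1 by (auto simp: system_def AC_deriv_def is_quasi_deriv_def)
qed

lemma system_quasi_deriv:
  assumes "system f f1 h" "x \<in> I"
  shows "quasi_deriv a b p s f x = f1 x"
proof (rule quasi_deriv_unique[OF _ _ assms(2)])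
  show "is_quasi_deriv a b p s f f1" using assms(1) by (rule system_is_quasi_deriv)
  then show "is_quasi_deriv a b p s f (quasi_deriv a b p s f)"
    unfolding quasi_deriv_def by (rule someI[of "is_quasi_deriv a b p s f"])
qed

text \<open>With \<open>tau_eqD\<close> this makes the system and the differential expression
  interchangeable: \<open>p\<close> and \<open>r\<close> are nonzero almost everywhere, so the
  denominators can be cleared there, and continuity identifies \<open>f1\<close> with the chosen
  \<open>quasi_deriv\<close>.\<close>

lemma tau_eqI:
  assumes "system f f1 h"
  shows "tau_eq a b p q r s f h"
  unfolding tau_eq_def
proof
  show "f \<in> D_tau a b p s"
    using assms system_is_quasi_deriv[OF assms] by (auto simp: D_tau_def system_def AC_deriv_def)
  have "AC_deriv a b (quasi_deriv a b p s f) (\<lambda>x. of_real (s x) * f1 x + of_real (q x) * f x - of_real (r x) * h x)"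
    by (rule AC_deriv_cong[OF assms[unfolded system_def, THEN conjunct2]])
      (simp_all add: system_quasi_deriv[OF assms])
  then have "AE x in lebesgue_on I. (quasi_deriv a b p s f has_vector_derivative
      of_real (s x) * f1 x + of_real (q x) * f x - of_real (r x) * h x) (at x)"
    by (simp add: AC_deriv_def)
  then have "AE x in lebesgue_on I. (quasi_deriv a b p s f has_vector_derivative
      of_real (s x) * f1 x + of_real (q x) * f x - of_real (r x) * h x) (at x) \<and> r x > 0"
    using r_pos by auto
  then show "AE x in lebesgue_on I.
        \<exists>f1'. (quasi_deriv a b p s f has_vector_derivative f1') (at x) \<and>
              h x = 1 / complex_of_real (r x) *
                (- f1' + complex_of_real (s x) * quasi_deriv a b p s f x
                 + complex_of_real (q x) * f x)"
  proof (rule lebesgue_on_mono)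
    fix x assume *: "(quasi_deriv a b p s f has_vector_derivative
      of_real (s x) * f1 x + of_real (q x) * f x - of_real (r x) * h x) (at x) \<and> r x > 0" "x \<in> I"
    then show "\<exists>f1'. (quasi_deriv a b p s f has_vector_derivative f1') (at x) \<and>
              h x = 1 / complex_of_real (r x) *
                (- f1' + complex_of_real (s x) * quasi_deriv a b p s f x
                 + complex_of_real (q x) * f x)"
      using system_quasi_deriv[OF assms *(2)] by (intro exI conjI, fastforce) (auto simp: field_simps)
  qed
qed

lemma is_solution_iff: "is_solution a b p q r s z f \<longleftrightarrow> (\<exists>f1. system f f1 (\<lambda>x. z * f x))"
  unfolding is_solution_def using tau_eqD tau_eqI by blast

lemma system_cong:
  assumes "system f f1 h" "\<And>x. x \<in> I \<Longrightarrow> g x = f x" "\<And>x. x \<in> I \<Longrightarrow> g1 x = f1 x"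
    "AE x in lebesgue_on I. k x = h x"
  shows "system g g1 k"
  unfolding system_def
proof
  have I: "AE x in lebesgue_on I. x \<in> I" using AE_space[of "lebesgue_on I"] by simp
  have "AE x in lebesgue_on I. of_real (inverse (p x)) * g1 x - of_real (s x) * g x =
      of_real (inverse (p x)) * f1 x - of_real (s x) * f x"
    using I by eventually_elim (use assms in auto)
  then show "AC_deriv a b g (\<lambda>x. of_real (inverse (p x)) * g1 x - of_real (s x) * g x)"
    using assms by (intro AC_deriv_cong[OF assms(1)[unfolded system_def, THEN conjunct1]])
  have "AE x in lebesgue_on I. of_real (s x) * g1 x + of_real (q x) * g x - of_real (r x) * k x =
      of_real (s x) * f1 x + of_real (q x) * f x - of_real (r x) * h x"
    using I assms(4) by eventually_elim (use assms in auto)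
  then show "AC_deriv a b g1 (\<lambda>x. of_real (s x) * g1 x + of_real (q x) * g x - of_real (r x) * k x)"
    using assms by (intro AC_deriv_cong[OF assms(1)[unfolded system_def, THEN conjunct2]])
qed

lemma system_add:
  assumes "system f f1 h" "system g g1 k"
  shows "system (\<lambda>x. f x + g x) (\<lambda>x. f1 x + g1 x) (\<lambda>x. h x + k x)"
proof -
  have *: "(\<lambda>x. of_real (inverse (p x)) * (f1 x + g1 x) - of_real (s x) * (f x + g x)) =
    (\<lambda>x. (of_real (inverse (p x)) * f1 x - of_real (s x) * f x) + (of_real (inverse (p x)) * g1 x - of_real (s x) * g x))"
    "(\<lambda>x. of_real (s x) * (f1 x + g1 x) + of_real (q x) * (f x + g x) - of_real (r x) * (h x + k x)) =
     (\<lambda>x. (of_real (s x) * f1 x + of_real (q x) * f x - of_real (r x) * h x) +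
       (of_real (s x) * g1 x + of_real (q x) * g x - of_real (r x) * k x))"
    by (auto simp: algebra_simps)
  show ?thesis using assms unfolding system_def * by (auto intro: AC_deriv_add)
qed

lemma system_cmult:
  assumes "system f f1 h"
  shows "system (\<lambda>x. c * f x) (\<lambda>x. c * f1 x) (\<lambda>x. c * h x)"
proof -
  have *: "(\<lambda>x. of_real (inverse (p x)) * (c * f1 x) - of_real (s x) * (c * f x)) =
    (\<lambda>x. c * (of_real (inverse (p x)) * f1 x - of_real (s x) * f x))"
    "(\<lambda>x. of_real (s x) * (c * f1 x) + of_real (q x) * (c * f x) - of_real (r x) * (c * h x)) =
     (\<lambda>x. c * (of_real (s x) * f1 x + of_real (q x) * f x - of_real (r x) * h x))"
    by (auto simp: algebra_simps)
  show ?thesis using assms unfolding system_def * by (auto intro: AC_deriv_cmult)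
qed

lemma system_diff:
  assumes "system f f1 h" "system g g1 k"
  shows "system (\<lambda>x. f x - g x) (\<lambda>x. f1 x - g1 x) (\<lambda>x. h x - k x)"
  using system_add[OF assms(1) system_cmult[OF assms(2), of "-1"]] by simp

text \<open>In the product rule the terms with 1/p, s and q cancel, and only the right-hand sides
  survive. For equal spectral parameters the derivative is zero; for different ones it is
  proportional to their difference, which drives the proof of Weyl's alternative.\<close>

lemma lagrange_identity:
  assumes "system f f1 h" "system g g1 k"
  shows "AC_deriv a b (\<lambda>x. f x * g1 x - f1 x * g x) (\<lambda>x. of_real (r x) * (h x * g x - f x * k x))"
  by (rule AC_deriv_cong[OF AC_deriv_diff[OF AC_deriv_mult[of a b f _ g1] AC_deriv_mult[of a b f1 _ g]]])
    (use assms[unfolded system_def] in \<open>auto intro!: AE_I2 simp: algebra_simps\<close>)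

lemma wronskian_const:
  assumes "system f f1 (\<lambda>x. z * f x)" "system g g1 (\<lambda>x. z * g x)" "x \<in> I" "y \<in> I"
  shows "f x * g1 x - f1 x * g x = f y * g1 y - f1 y * g y"
  by (rule AC_deriv_const_if_zero[OF _ assms(3,4)], rule AC_deriv_cong[OF lagrange_identity[OF assms(1,2)]])
     (auto intro!: AE_I2)

text \<open>Picard iteration started at \<open>x0\<close>: the \<open>n\<close>-th correction is bounded by
  \<open>C |K x|^n / n!\<close>, where \<open>K\<close> is the primitive of a common bound of the coefficients.\<close>

lemma system_exists:
  assumes x0: "x0 \<in> I"
  obtains f f1 where "system f f1 (\<lambda>x. z * f x)" "f x0 = \<alpha>" "f1 x0 = \<beta>"
proof -
  \<comment> \<open>One weight dominates both rows of the system: if both components are at most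
    \<open>m\<close> in norm, each right-hand side is at most \<open>k x * m\<close>.\<close>
  define k where "k x = \<bar>inverse (p x)\<bar> + \<bar>s x\<bar> + \<bar>q x\<bar> + norm z * \<bar>r x\<bar>" for x
  have kloc: "loc_integrable a b (\<lambda>x. complex_of_real (k x))"
  proof -
    have "loc_integrable a b (\<lambda>x. complex_of_real (norm (complex_of_real (inverse (p x)))) +
       complex_of_real (norm (complex_of_real (s x))) + complex_of_real (norm (complex_of_real (q x))) +
       of_real (norm z) * complex_of_real (norm (complex_of_real (r x))))"
      by (intro loc_integrable_add loc_integrable_continuous_mult[of a b "\<lambda>_. of_real (norm z)"] loc_integrable_abs loc_coeffs)
        auto
    then show ?thesis by (simp only: k_def norm_of_real of_real_add of_real_mult)
  qed
  have k0: "k x \<ge> 0" for x by (auto simp: k_def)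
  obtain K where K: "AC_deriv a b K (\<lambda>x. complex_of_real (k x))" "K x0 = 0"
    by (rule loc_integrable_primitive[OF kloc x0])
  define \<kappa> where "\<kappa> x = Re (K x)" for x
  have K\<kappa>: "K x = of_real (\<kappa> x)" if "x \<in> I" for x
    using AC_deriv_real[OF K(1) x0 K(2) that] by (simp add: \<kappa>_def complex_eq_iff)
  have \<kappa>mono: "\<kappa> x \<le> \<kappa> y" if "x \<in> I" "y \<in> I" "x \<le> y" for x y
    using AC_deriv_norm_bound[OF AC_deriv_const[of a b 0] K(1) that] k0 by (simp add: \<kappa>_def)
  have \<kappa>0: "\<kappa> x0 = 0" by (simp add: \<kappa>_def K)
  define C where "C = max (norm \<alpha>) (norm \<beta>)"
  have C: "C \<ge> 0" "norm \<alpha> \<le> C" "norm \<beta> \<le> C" by (auto simp: C_def intro: max.coboundedI1)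
  let ?A = "\<lambda>d e x. of_real (inverse (p x)) * e x - of_real (s x) * d x"
  let ?B = "\<lambda>d e x. of_real (s x) * e x + of_real (q x) * d x - of_real (r x) * (z * d x)"
  \<comment> \<open>The invariant of the dependent choice: continuity is what makes the next
    integrands locally integrable, and index 0 is pinned to the constant initial data.\<close>
  define P where "P n de \<longleftrightarrow> continuous_on I (fst de) \<and> continuous_on I (snd de) \<and>
     (n = 0 \<longrightarrow> de = (\<lambda>_. \<alpha>, \<lambda>_. \<beta>))" for n :: nat and de :: "(real \<Rightarrow> complex) \<times> (real \<Rightarrow> complex)"
  define Q where "Q (n::nat) de de' \<longleftrightarrow> AC_deriv a b (fst de') (?A (fst de) (snd de)) \<and> fst de' x0 = 0 \<and>
     AC_deriv a b (snd de') (?B (fst de) (snd de)) \<and> snd de' x0 = 0" for n and de de'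
  have locA: "loc_integrable a b (?A d e)" and locB: "loc_integrable a b (?B d e)"
    if "continuous_on I d" "continuous_on I e" for d e
  proof -
    have "continuous_on I (\<lambda>x. z * d x)" using that by (intro continuous_intros)
    then have "loc_integrable a b (\<lambda>x. e x * of_real (s x) + d x * of_real (q x) - (z * d x) * of_real (r x))"
      using that by (intro loc_integrable_add loc_integrable_diff loc_integrable_continuous_mult[OF _ loc_coeffs(2)]
         loc_integrable_continuous_mult[OF _ loc_coeffs(3)] loc_integrable_continuous_mult[OF _ loc_coeffs(4)])
    moreover have "loc_integrable a b (\<lambda>x. e x * of_real (inverse (p x)) - d x * of_real (s x))"
      using that by (intro loc_integrable_diff loc_integrable_continuous_mult[OF _ loc_coeffs(1)]
         loc_integrable_continuous_mult[OF _ loc_coeffs(4)])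
    ultimately show "loc_integrable a b (?A d e)" "loc_integrable a b (?B d e)"
      by (simp_all add: mult.commute)
  qed
  have "\<exists>F. \<forall>n. P n (F n) \<and> Q n (F n) (F (Suc n))"
  proof (rule dependent_nat_choice)
    show "\<exists>x. P 0 x" by (auto simp: P_def)
    fix de n assume "P n de"
    then have c: "continuous_on I (fst de)" "continuous_on I (snd de)" by (auto simp: P_def)
    obtain d' where d': "AC_deriv a b d' (?A (fst de) (snd de))" "d' x0 = 0"
      by (rule loc_integrable_primitive[OF locA[OF c] x0])
    obtain e' where e': "AC_deriv a b e' (?B (fst de) (snd de))" "e' x0 = 0"
      by (rule loc_integrable_primitive[OF locB[OF c] x0])
    show "\<exists>y. P (Suc n) y \<and> Q n de y"
      using d' e' by (intro exI[of _ "(d',e')"]) (auto simp: P_def Q_def intro: AC_deriv_continuous)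
  qed
  then obtain F where F: "\<And>n. P n (F n)" "\<And>n. Q n (F n) (F (Suc n))" by blast
  define d where "d n = fst (F n)" for n
  define e where "e n = snd (F n)" for n
  have d0: "d 0 = (\<lambda>_. \<alpha>)" "e 0 = (\<lambda>_. \<beta>)" using F(1)[of 0] by (auto simp: P_def d_def e_def)
  have cont: "continuous_on I (d n)" "continuous_on I (e n)" for n using F(1)[of n] by (auto simp: P_def d_def e_def)
  have dd: "AC_deriv a b (d (Suc n)) (?A (d n) (e n))" "d (Suc n) x0 = 0"
    and ee: "AC_deriv a b (e (Suc n)) (?B (d n) (e n))" "e (Suc n) x0 = 0" for n
    using F(2)[of n] by (auto simp: Q_def d_def e_def)
  have k_bd: "norm (?A u v x) \<le> k x * m" "norm (?B u v x) \<le> k x * m" if "norm (u x) \<le> m" "norm (v x) \<le> m" for u v x m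
  proof -
    have m: "m \<ge> 0" using that norm_ge_zero order_trans by blast
    have "norm (?A u v x) \<le> \<bar>inverse (p x)\<bar> * m + \<bar>s x\<bar> * m"
      by (rule order_trans[OF norm_triangle_ineq4])
        (use that in \<open>auto simp: norm_mult norm_inverse intro!: add_mono mult_left_mono\<close>)
    also have "\<dots> \<le> k x * m" using m by (auto simp: k_def distrib_right[symmetric] intro!: mult_right_mono)
    finally show "norm (?A u v x) \<le> k x * m" .
    have "norm (?B u v x) \<le> (\<bar>s x\<bar> * m + \<bar>q x\<bar> * m) + \<bar>r x\<bar> * (norm z * m)"
      by (intro order_trans[OF norm_triangle_ineq4] add_mono order_trans[OF norm_triangle_ineq])
        (use that in \<open>auto simp: norm_mult intro!: mult_left_mono\<close>)
    also have "\<dots> = (\<bar>s x\<bar> + \<bar>q x\<bar> + norm z * \<bar>r x\<bar>) * m" by (simp add: algebra_simps)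
    also have "\<dots> \<le> k x * m" using m by (intro mult_right_mono) (auto simp: k_def)
    finally show "norm (?B u v x) \<le> k x * m" .
  qed
  have bd: "norm (d n x) \<le> C * \<bar>\<kappa> x\<bar> ^ n / fact n \<and> norm (e n x) \<le> C * \<bar>\<kappa> x\<bar> ^ n / fact n" if "x \<in> I" for n x
    using that
  proof (induction n arbitrary: x)
    case 0
    then show ?case using C by (simp add: d0)
  next
    case (Suc n)
    \<comment> \<open>The sign for which \<open>\<sigma> * \<kappa> t\<close> is the absolute value
      of \<open>\<kappa> t\<close> on the whole segment from \<open>x0\<close> to \<open>x\<close>;
      \<open>\<kappa>\<close> is monotone and vanishes at \<open>x0\<close>.\<close>
    define \<sigma> where "\<sigma> = (if x0 \<le> x then 1 else (-1)::real)"
    have \<sigma>: "\<sigma> * \<sigma> = 1" by (simp add: \<sigma>_def)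
    define c where "c = complex_of_real (C * \<sigma> ^ n / fact (Suc n))"
    \<comment> \<open>A primitive of \<open>k\<close> times the induction bound. The sign occurs to
      the power \<open>n\<close>, as the derivative requires; the extra power of \<open>K\<close>
      leaves one sign over, which the absolute value in \<open>end_bound\<close> removes.\<close>
    define H where "H t = c * K t ^ Suc n" for t
    have H: "AC_deriv a b H (\<lambda>t. c * (of_nat (Suc n) * K t ^ n * of_real (k t)))"
      unfolding H_def using AC_deriv_cmult[OF AC_deriv_power[OF K(1), of "Suc n"]] by simp
    have abs: "\<bar>\<kappa> t\<bar> = \<sigma> * \<kappa> t" "t \<in> I" if "t \<in> closed_segment x0 x" for t
    proof -
      show t: "t \<in> I" using that einterval_segment[OF x0 Suc.prems] by auto
      then show "\<bar>\<kappa> t\<bar> = \<sigma> * \<kappa> t"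
        using \<kappa>mono[OF x0 t] \<kappa>mono[OF t x0] \<kappa>0 that
        by (cases "x0 \<le> x") (auto simp: \<sigma>_def closed_segment_eq_real_ivl split: if_splits)
    qed
    have H': "Re (c * (of_nat (Suc n) * K t ^ n * of_real (k t))) = k t * (C * \<bar>\<kappa> t\<bar> ^ n / fact n)"
      if t: "t \<in> closed_segment x0 x" for t
    proof -
      have "c * (of_nat (Suc n) * K t ^ n * of_real (k t)) =
         complex_of_real (C * \<sigma> ^ n / fact (Suc n) * (real (Suc n) * \<kappa> t ^ n * k t))"
        unfolding c_def K\<kappa>[OF abs(2)[OF t]] by (simp only: of_real_mult of_real_power of_real_of_nat_eq)
      then have "Re (c * (of_nat (Suc n) * K t ^ n * of_real (k t))) = C * \<sigma> ^ n / fact (Suc n) * (real (Suc n) * \<kappa> t ^ n * k t)"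
        by (simp only: Re_complex_of_real)
      also have "\<dots> = k t * (C * (\<sigma> * \<kappa> t) ^ n / fact n)"
        unfolding fact_Suc by (simp add: power_mult_distrib del: of_nat_Suc)
      finally show ?thesis using abs(1)[OF t] by simp
    qed
    have end_bound: "\<bar>Re (H x) - Re (H x0)\<bar> = C * \<bar>\<kappa> x\<bar> ^ Suc n / fact (Suc n)"
    proof -
      have "H x = complex_of_real (C * \<sigma> ^ n / fact (Suc n) * \<kappa> x ^ Suc n)"
        unfolding H_def c_def K\<kappa>[OF Suc.prems] by (simp only: of_real_mult of_real_power)
      then have "Re (H x) = C * \<sigma> ^ n / fact (Suc n) * \<kappa> x ^ Suc n"
        by (simp only: Re_complex_of_real)
      moreover have "H x0 = 0" by (simp add: H_def K)
      moreover have "\<bar>\<sigma>\<bar> ^ n = 1" by (simp add: \<sigma>_def)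
      ultimately show ?thesis using C by (simp add: abs_mult power_abs)
    qed
    have kb: "norm (?A (d n) (e n) t) \<le> k t * (C * \<bar>\<kappa> t\<bar> ^ n / fact n)"
      "norm (?B (d n) (e n) t) \<le> k t * (C * \<bar>\<kappa> t\<bar> ^ n / fact n)" if "t \<in> closed_segment x0 x" for t
      by (rule k_bd; use Suc.IH[OF abs(2)[OF that]] in blast)+
    have "norm (d (Suc n) x - d (Suc n) x0) \<le> \<bar>Re (H x) - Re (H x0)\<bar>"
      by (rule AC_deriv_norm_bound_segment[OF dd(1) H x0 Suc.prems], subst H', assumption, rule kb)
    moreover have "norm (e (Suc n) x - e (Suc n) x0) \<le> \<bar>Re (H x) - Re (H x0)\<bar>"
      by (rule AC_deriv_norm_bound_segment[OF ee(1) H x0 Suc.prems], subst H', assumption, rule kb)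
    ultimately show ?case using end_bound dd(2) ee(2) by simp
  qed
  define f where "f x = (\<Sum>n. d n x)" for x
  define f1 where "f1 x = (\<Sum>n. e n x)" for x
  have unif: "uniform_limit {u..v} (\<lambda>n x. \<Sum>i<n. d i x) f sequentially"
    "uniform_limit {u..v} (\<lambda>n x. \<Sum>i<n. e i x) f1 sequentially" if uv: "u \<in> I" "v \<in> I" for u v
  proof -
    \<comment> \<open>By monotonicity \<open>\<kappa>\<close> lies between its values at
      \<open>u\<close> and \<open>v\<close>, so this constant dominates it on the interval and the
      exponential series serves as majorant.\<close>
    define m where "m = \<bar>\<kappa> u\<bar> + \<bar>\<kappa> v\<bar>"
    have "summable (\<lambda>n. C * m ^ n / fact n)"
      using summable_mult[OF summable_exp[of m], of C] by (simp add: field_simps)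
    moreover have "norm (d n x) \<le> C * m ^ n / fact n" "norm (e n x) \<le> C * m ^ n / fact n" if x: "x \<in> {u..v}" for n x
    proof -
      have xI: "x \<in> I" using einterval_subset[OF uv] x by auto
      have "\<bar>\<kappa> x\<bar> \<le> m" using \<kappa>mono[OF uv(1) xI] \<kappa>mono[OF xI uv(2)] x by (auto simp: m_def)
      then have "C * \<bar>\<kappa> x\<bar> ^ n / fact n \<le> C * m ^ n / fact n"
        using C by (intro divide_right_mono mult_left_mono power_mono) auto
      then show "norm (d n x) \<le> C * m ^ n / fact n" "norm (e n x) \<le> C * m ^ n / fact n"
        using bd[OF xI, of n] by auto
    qed
    ultimately show "uniform_limit {u..v} (\<lambda>n x. \<Sum>i<n. d i x) f sequentially"
      "uniform_limit {u..v} (\<lambda>n x. \<Sum>i<n. e i x) f1 sequentially"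
      unfolding f_def f1_def by (intro Weierstrass_m_test[where M="\<lambda>n. C * m ^ n / fact n"]; simp)+
  qed
  have contf: "continuous_on I f" "continuous_on I f1"
  proof -
    have "isCont f x \<and> isCont f1 x" if xI: "x \<in> I" for x
    proof -
      obtain u v where uv: "u < x" "x < v" "u \<in> I" "v \<in> I" by (rule einterval_box[OF xI])
      have sub: "{u..v} \<subseteq> I" using uv by (intro einterval_subset)
      have "continuous_on {u..v} f" "continuous_on {u..v} f1"
        by (intro uniform_limit_theorem[OF _ unif(1)[OF uv(3,4)]] uniform_limit_theorem[OF _ unif(2)[OF uv(3,4)]]
             always_eventually allI continuous_on_sum continuous_on_subset[OF cont(1) sub]
             continuous_on_subset[OF cont(2) sub]; simp)+
      then show ?thesis using uv by (auto intro: continuous_on_interior[of "{u..v}"])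
    qed
    then show "continuous_on I f" "continuous_on I f1" by (auto intro: continuous_at_imp_continuous_on)
  qed
  define D where "D n x = (\<Sum>i<n. d i x)" for n x
  define E where "E n x = (\<Sum>i<n. e i x)" for n x
  \<comment> \<open>Index shift: the partial sum with \<open>n + 1\<close> terms is the Picard
    iterate of the one with \<open>n\<close> terms. The constant zeroth term supplies the initial
    value and has derivative zero.\<close>
  have DE: "AC_deriv a b (D (Suc n)) (?A (D n) (E n)) \<and> D (Suc n) x0 = \<alpha> \<and>
     AC_deriv a b (E (Suc n)) (?B (D n) (E n)) \<and> E (Suc n) x0 = \<beta>" for n
  proof (induction n)
    case 0
    then show ?case using AC_deriv_const by (simp add: D_def E_def d0)
  next
    case (Suc n)
    have 1: "D (Suc (Suc n)) = (\<lambda>x. D (Suc n) x + d (Suc n) x)" "E (Suc (Suc n)) = (\<lambda>x. E (Suc n) x + e (Suc n) x)"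
      by (auto simp: D_def E_def)
    have 2: "?A (D (Suc n)) (E (Suc n)) = (\<lambda>x. ?A (D n) (E n) x + ?A (d n) (e n) x)"
       "?B (D (Suc n)) (E (Suc n)) = (\<lambda>x. ?B (D n) (E n) x + ?B (d n) (e n) x)"
      by (auto simp: D_def E_def algebra_simps)
    show ?case unfolding 1 2 using Suc dd[of n] ee[of n] by (auto intro: AC_deriv_add)
  qed
  have unifseg: "\<forall>\<^sub>F n in sequentially. \<forall>t\<in>closed_segment x0 x. norm (f t - D n t) \<le> \<epsilon> \<and> norm (f1 t - E n t) \<le> \<epsilon>"
    if x: "x \<in> I" and eps: "\<epsilon> > 0" for x \<epsilon>
  proof -
    have "min x0 x \<in> I" "max x0 x \<in> I" using x x0 by (auto simp: min_def max_def)
    note u = unif[OF this]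
    have "\<forall>\<^sub>F n in sequentially. \<forall>t\<in>{min x0 x..max x0 x}. dist (D n t) (f t) < \<epsilon>"
      "\<forall>\<^sub>F n in sequentially. \<forall>t\<in>{min x0 x..max x0 x}. dist (E n t) (f1 t) < \<epsilon>"
      using u eps unfolding D_def E_def by (auto dest: uniform_limitD)
    then show ?thesis
    proof eventually_elim
      case (elim n)
      have seg: "closed_segment x0 x = {min x0 x..max x0 x}"
        by (cases "x0 \<le> x") (auto simp: closed_segment_eq_real_ivl)
      show ?case
      proof (intro ballI conjI)
        fix t assume "t \<in> closed_segment x0 x"
        then have "dist (D n t) (f t) < \<epsilon>" "dist (E n t) (f1 t) < \<epsilon>" using elim unfolding seg by blast+
        then show "norm (f t - D n t) \<le> \<epsilon>" "norm (f1 t - E n t) \<le> \<epsilon>"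
          by (simp_all add: dist_norm norm_minus_commute)
      qed
    qed
  qed
  have lim: "(\<lambda>n. D (Suc n) x) \<longlonglongrightarrow> f x" "(\<lambda>n. E (Suc n) x) \<longlonglongrightarrow> f1 x" if "x \<in> I" for x
    using tendsto_uniform_limitI[OF unif(1)[OF that that], of x] tendsto_uniform_limitI[OF unif(2)[OF that that], of x]
    unfolding D_def[symmetric] E_def[symmetric] by (auto intro: LIMSEQ_Suc)
  \<comment> \<open>Linearity lets \<open>k_bd\<close> be applied to the errors, so uniform
    convergence of the sums bounds the derivative errors by \<open>\<epsilon> * k\<close>.\<close>
  have diffAB: "?A f f1 t - ?A (D n) (E n) t = ?A (\<lambda>t. f t - D n t) (\<lambda>t. f1 t - E n t) t"
    "?B f f1 t - ?B (D n) (E n) t = ?B (\<lambda>t. f t - D n t) (\<lambda>t. f1 t - E n t) t" for n t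
    by (auto simp: algebra_simps)
  have "AC_deriv a b f (?A f f1)"
  proof (rule AC_deriv_limit[where F="\<lambda>n. D (Suc n)" and F'="\<lambda>n. ?A (D n) (E n)" and \<alpha>=\<alpha> and k=k and K=K])
    show "\<forall>\<^sub>F n in sequentially. \<forall>t\<in>closed_segment x0 x. norm (?A f f1 t - ?A (D n) (E n) t) \<le> \<epsilon> * k t"
      if "x \<in> I" "\<epsilon> > 0" for x \<epsilon>
      using unifseg[OF that]
    proof eventually_elim
      case (elim n)
      then show ?case unfolding diffAB mult.commute[of \<epsilon>] by (intro ballI k_bd) auto
    qed
  qed (use DE x0 K lim locA[OF contf] in auto)
  moreover have "AC_deriv a b f1 (?B f f1)"
  proof (rule AC_deriv_limit[where F="\<lambda>n. E (Suc n)" and F'="\<lambda>n. ?B (D n) (E n)" and \<alpha>=\<beta> and k=k and K=K])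
    show "\<forall>\<^sub>F n in sequentially. \<forall>t\<in>closed_segment x0 x. norm (?B f f1 t - ?B (D n) (E n) t) \<le> \<epsilon> * k t"
      if "x \<in> I" "\<epsilon> > 0" for x \<epsilon>
      using unifseg[OF that]
    proof eventually_elim
      case (elim n)
      then show ?case unfolding diffAB mult.commute[of \<epsilon>] by (intro ballI k_bd) auto
    qed
  qed (use DE x0 K lim locB[OF contf] in auto)
  moreover have "f x0 = \<alpha>" "f1 x0 = \<beta>"
    using LIMSEQ_unique[OF lim(1)[OF x0]] LIMSEQ_unique[OF lim(2)[OF x0]] DE by auto
  ultimately show ?thesis by (intro that[of f f1]) (auto simp: system_def)
qed

section \<open>Fundamental systems, uniqueness and linear dependence of solutions\<close>

lemma fundamental_system:
  obtains f f1 g g1 where "system f f1 (\<lambda>x. z * f x)" "system g g1 (\<lambda>x. z * g x)"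
    "\<And>x. x \<in> I \<Longrightarrow> f x * g1 x - f1 x * g x = 1"
proof -
  obtain x0 where x0: "x0 \<in> I" by (rule nonempty)
  obtain f f1 where f: "system f f1 (\<lambda>x. z * f x)" "f x0 = 1" "f1 x0 = 0" by (rule system_exists[OF x0])
  obtain g g1 where g: "system g g1 (\<lambda>x. z * g x)" "g x0 = 0" "g1 x0 = 1" by (rule system_exists[OF x0])
  show ?thesis
  proof (rule that[OF f(1) g(1)])
    fix x assume "x \<in> I"
    then show "f x * g1 x - f1 x * g x = 1"
      using wronskian_const[OF f(1) g(1) _ x0, of x] f g by simp
  qed
qed

text \<open>Vanishing Cauchy data kill both Wronskians with a fundamental system, so uniqueness
  is a consequence of existence.\<close>

lemma system_zero:
  assumes f: "system f f1 (\<lambda>x. z * f x)" and x0: "x0 \<in> I" "f x0 = 0" "f1 x0 = 0" and x: "x \<in> I"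
  shows "f x = 0"
proof -
  obtain g g1 h h1 where g: "system g g1 (\<lambda>x. z * g x)" and h: "system h h1 (\<lambda>x. z * h x)"
    and W: "\<And>x. x \<in> I \<Longrightarrow> g x * h1 x - g1 x * h x = 1" by (rule fundamental_system) blast
  have 1: "f x * g1 x - f1 x * g x = 0" using wronskian_const[OF f g x x0(1)] x0 by simp
  have 2: "f x * h1 x - f1 x * h x = 0" using wronskian_const[OF f h x x0(1)] x0 by simp
  have "f x = f x * (g x * h1 x - g1 x * h x)" using W[OF x] by simp
  also have "\<dots> = g x * (f x * h1 x - f1 x * h x) - h x * (f x * g1 x - f1 x * g x)" by (simp add: algebra_simps)
  also have "\<dots> = 0" using 1 2 by simp
  finally show ?thesis .
qed

text \<open>A vanishing Wronskian makes the Cauchy data at \<open>x0\<close> proportional, where the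
  data of \<open>g\<close> are not both zero by uniqueness. The difference \<open>f - c * g\<close>
  then has zero data.\<close>

lemma wronskian_zero_dependent:
  assumes f: "system f f1 (\<lambda>x. z * f x)" and g: "system g g1 (\<lambda>x. z * g x)"
    and nz: "\<exists>x\<in>I. f x \<noteq> 0" "\<exists>x\<in>I. g x \<noteq> 0"
    and W: "x0 \<in> I" "f x0 * g1 x0 - f1 x0 * g x0 = 0"
  obtains c where "c \<noteq> 0" "\<And>x. x \<in> I \<Longrightarrow> f x = c * g x"
proof -
  have gx0: "g x0 \<noteq> 0 \<or> g1 x0 \<noteq> 0" using system_zero[OF g W(1)] nz(2) by blast
  obtain c where c: "f x0 = c * g x0" "f1 x0 = c * g1 x0"
  proof (cases "g x0 = 0")
    case True
    \<comment> \<open>Here \<open>g1 x0\<close> is nonzero, so the Wronskian condition reduces to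
      \<open>f x0 = 0\<close> and the factor is read off from the quasi-derivatives.\<close>
    then show ?thesis using W gx0 by (intro that[of "f1 x0 / g1 x0"]) auto
  next
    case False
    then show ?thesis using W by (intro that[of "f x0 / g x0"]) (auto simp: field_simps)
  qed
  have "system (\<lambda>x. f x - c * g x) (\<lambda>x. f1 x - c * g1 x) (\<lambda>x. z * (f x - c * g x))"
    by (rule system_cong[OF system_diff[OF f system_cmult[OF g, of c]]]) (auto simp: algebra_simps)
  then have fc: "f x = c * g x" if "x \<in> I" for x
    using system_zero[OF _ W(1) _ _ that] c by force
  moreover have "c \<noteq> 0" using nz(1) fc by auto
  ultimately show ?thesis using that by blast
qed

section \<open>Square integrability near the endpoints and the Weyl alternative\<close>

text \<open>The weight is \<open>\<bar>r\<bar>\<close> because \<open>r\<close> is positive only almost everywhere.\<close>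

definition sq_integrable :: "real set \<Rightarrow> (real \<Rightarrow> complex) \<Rightarrow> bool" where
  "sq_integrable A f \<longleftrightarrow> set_integrable lebesgue A (\<lambda>x. \<bar>r x\<bar> * (norm (f x))\<^sup>2)"

text \<open>Mirrors the case distinction in \<open>L2_near\<close>: every \<open>c\<close> other
  than \<open>a\<close> stands for the right endpoint, so one argument serves both ends.\<close>

abbreviation tail :: "ereal \<Rightarrow> real \<Rightarrow> real set" where
  "tail c d \<equiv> (if c = a then einterval a (ereal d) else einterval (ereal d) b)"

lemma tail_subset: "d \<in> I \<Longrightarrow> tail c d \<subseteq> I"
  by (auto simp: einterval_iff) (metis less_trans less_ereal.simps(1))+

lemma tail_sets [simp]: "tail c d \<in> sets lebesgue"
  by simp

lemma measurable_indicator: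
  fixes f :: "real \<Rightarrow> 'b::{real_normed_vector, second_countable_topology}"
  assumes "f \<in> borel_measurable (lebesgue_on I)" "A \<subseteq> I" "A \<in> sets lebesgue"
  shows "set_borel_measurable lebesgue A f"
proof -
  have "(\<lambda>x. indicator I x *\<^sub>R f x) \<in> borel_measurable lebesgue"
    using assms(1) by (subst (asm) borel_measurable_restrict_space_iff) auto
  then have "(\<lambda>x. indicator A x *\<^sub>R (indicator I x *\<^sub>R f x)) \<in> borel_measurable lebesgue"
    by (rule borel_measurable_scaleR[OF borel_measurable_indicator[OF assms(3)]])
  also have "(\<lambda>x. indicator A x *\<^sub>R (indicator I x *\<^sub>R f x)) = (\<lambda>x. indicator A x *\<^sub>R f x)"
    using assms(2) by (intro ext) (auto simp: indicator_def)
  finally show ?thesis by (simp add: set_borel_measurable_def)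
qed

lemma continuous_measurable:
  fixes f :: "real \<Rightarrow> complex"
  shows "continuous_on I f \<Longrightarrow> f \<in> borel_measurable (lebesgue_on I)"
  by (intro continuous_imp_measurable_on_sets_lebesgue) auto

text \<open>From (x + y)^2 <= 2 x^2 + 2 y^2. Taking \<open>g\<close> equal to \<open>f\<close> gives
  domination by a single function.\<close>

lemma sq_integrable_bound:
  assumes "sq_integrable A f" "sq_integrable A g" and A: "A \<subseteq> I" "A \<in> sets lebesgue"
    and h: "h \<in> borel_measurable (lebesgue_on I)"
    and bd: "\<And>x. x \<in> A \<Longrightarrow> norm (h x) \<le> K * (norm (f x) + norm (g x))"
  shows "sq_integrable A h"
  unfolding sq_integrable_def
proof (rule set_integrable_bound)
  show "set_integrable lebesgue A (\<lambda>x. 2 * K\<^sup>2 * (\<bar>r x\<bar> * (norm (f x))\<^sup>2) + 2 * K\<^sup>2 * (\<bar>r x\<bar> * (norm (g x))\<^sup>2))"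
    using assms(1,2) unfolding sq_integrable_def by (intro set_integral_add set_integrable_mult_right)
  show "set_borel_measurable lebesgue A (\<lambda>x. \<bar>r x\<bar> * (norm (h x))\<^sup>2)"
    using r_meas h by (intro measurable_indicator[OF _ A] borel_measurable_times borel_measurable_power) auto
  have "norm (\<bar>r x\<bar> * (norm (h x))\<^sup>2) \<le> norm (2 * K\<^sup>2 * (\<bar>r x\<bar> * (norm (f x))\<^sup>2) + 2 * K\<^sup>2 * (\<bar>r x\<bar> * (norm (g x))\<^sup>2))"
    if x: "x \<in> A" for x
  proof -
    have "(norm (h x))\<^sup>2 \<le> (K * (norm (f x) + norm (g x)))\<^sup>2"
      using bd[OF x] by (intro power_mono) auto
    also have "\<dots> = K\<^sup>2 * (norm (f x) + norm (g x))\<^sup>2" by (simp add: power_mult_distrib)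
    also have "\<dots> \<le> K\<^sup>2 * (2 * (norm (f x))\<^sup>2 + 2 * (norm (g x))\<^sup>2)"
      using sum_squares_bound[of "norm (f x)" "norm (g x)"]
      by (intro mult_left_mono) (auto simp: power2_sum)
    finally have "\<bar>r x\<bar> * (norm (h x))\<^sup>2 \<le> \<bar>r x\<bar> * (K\<^sup>2 * (2 * (norm (f x))\<^sup>2 + 2 * (norm (g x))\<^sup>2))"
      by (rule mult_left_mono) auto
    also have "\<dots> = 2 * K\<^sup>2 * (\<bar>r x\<bar> * (norm (f x))\<^sup>2) + 2 * K\<^sup>2 * (\<bar>r x\<bar> * (norm (g x))\<^sup>2)"
      by (simp add: algebra_simps)
    finally show ?thesis by (auto intro: order_trans)
  qed
  then show "AE x in lebesgue. x \<in> A \<longrightarrow>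
      norm (\<bar>r x\<bar> * (norm (h x))\<^sup>2) \<le> norm (2 * K\<^sup>2 * (\<bar>r x\<bar> * (norm (f x))\<^sup>2) + 2 * K\<^sup>2 * (\<bar>r x\<bar> * (norm (g x))\<^sup>2))"
    by blast
qed

lemma sq_integrable_Un:
  "sq_integrable A f \<Longrightarrow> sq_integrable B f \<Longrightarrow> A \<in> sets lebesgue \<Longrightarrow> B \<in> sets lebesgue \<Longrightarrow> sq_integrable (A \<union> B) f"
  unfolding sq_integrable_def by (rule set_integrable_Un)

lemma sq_integrable_subset:
  "sq_integrable A f \<Longrightarrow> B \<in> sets lebesgue \<Longrightarrow> B \<subseteq> A \<Longrightarrow> sq_integrable B f"
  unfolding sq_integrable_def by (rule set_integrable_subset)

lemma set_integrable_Icc_real: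
  assumes "loc_integrable a b (\<lambda>x. complex_of_real (g x))" "c \<in> I" "d \<in> I"
  shows "set_integrable lebesgue {c..d} g"
proof -
  have "integrable (lebesgue_on {c..d}) (\<lambda>x. complex_of_real (g x))"
    using assms by (auto simp: loc_integrable_def)
  then have "integrable (lebesgue_on {c..d}) g"
    using integrable_Re by fastforce
  then show ?thesis by (simp add: set_integrable_eq)
qed

lemma loc_integrable_sq:
  assumes "continuous_on I f"
  shows "loc_integrable a b (\<lambda>x. complex_of_real (\<bar>r x\<bar> * (norm (f x))\<^sup>2))"
proof -
  have "loc_integrable a b (\<lambda>x. of_real ((norm (f x))\<^sup>2) * complex_of_real (norm (complex_of_real (r x))))"
    using assms by (intro loc_integrable_continuous_mult loc_integrable_abs loc_coeffs) (auto intro!: continuous_intros)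
  then show ?thesis by (simp only: norm_of_real mult.commute of_real_mult)
qed

lemma sq_integrable_Icc:
  assumes "continuous_on I f" "c \<in> I" "d \<in> I"
  shows "sq_integrable {c..d} f"
  unfolding sq_integrable_def using assms by (intro set_integrable_Icc_real loc_integrable_sq)

lemma tail_cover:
  assumes "d \<in> I" "e \<in> I"
  shows "tail c e \<subseteq> tail c d \<union> {min d e..max d e}"
  using assms by (auto simp: einterval_iff not_less min_def max_def split: if_splits)

text \<open>Two tails differ by part of a compact subinterval, where continuous functions are square
  integrable; one cut point therefore decides \<open>L2_near\<close>, which quantifies over all of
  them.\<close>

lemma sq_integrable_tail:
  assumes "continuous_on I f" "sq_integrable (tail c d) f" "d \<in> I" "e \<in> I"
  shows "sq_integrable (tail c e) f"
proof (rule sq_integrable_subset[OF _ tail_sets tail_cover[OF assms(3,4)]])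
  show "sq_integrable (tail c d \<union> {min d e..max d e}) f"
    using assms by (intro sq_integrable_Un sq_integrable_Icc) (auto simp: min_def max_def)
qed

lemma sq_integrable_tails:
  assumes "continuous_on I f" "sq_integrable (tail a d) f" "sq_integrable (tail b e) f" "d \<in> I" "e \<in> I"
  shows "sq_integrable I f"
proof (rule sq_integrable_subset)
  show "sq_integrable (tail a d \<union> {min d e..max d e} \<union> tail b e) f"
    using assms by (intro sq_integrable_Un sq_integrable_Icc) (auto simp: min_def max_def)
  show "I \<subseteq> tail a d \<union> {min d e..max d e} \<union> tail b e"
    using ab assms(4,5) by (auto simp: einterval_iff not_less min_def max_def)
qed simp

lemma AE_r_pos_subset:
  assumes "A \<subseteq> I" "A \<in> sets lebesgue"
  shows "AE x in lebesgue_on A. r x > 0"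
  using r_pos assms by (auto simp: AE_restrict_space_iff elim!: eventually_mono)

text \<open>The density \<open>ennreal (r x)\<close> cuts off negative values of \<open>r\<close>,
  while \<open>sq_integrable\<close> takes absolute values; both weights equal \<open>r\<close>
  almost everywhere.\<close>

lemma L2_weighted_iff:
  assumes A: "A \<subseteq> I" "A \<in> sets lebesgue"
  shows "f \<in> L2 (weighted A r) \<longleftrightarrow> f \<in> borel_measurable (lebesgue_on A) \<and> sq_integrable A f"
proof -
  have r: "r \<in> borel_measurable (lebesgue_on A)"
    using r_meas A by (metis inf.absorb_iff2 measurable_restrict_mono)
  have "integrable (weighted A r) (\<lambda>x. (norm (f x))\<^sup>2) \<longleftrightarrow> sq_integrable A f"
    if f: "f \<in> borel_measurable (lebesgue_on A)"
  proof -
    have fm: "(\<lambda>x. (norm (f x))\<^sup>2) \<in> borel_measurable (lebesgue_on A)" using f by simp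
    have "integrable (weighted A r) (\<lambda>x. (norm (f x))\<^sup>2) \<longleftrightarrow>
       integrable (lebesgue_on A) (\<lambda>x. r x *\<^sub>R (norm (f x))\<^sup>2)"
      unfolding weighted_def
      by (intro integrable_density fm r) (use AE_r_pos_subset[OF A] in \<open>auto elim: eventually_mono\<close>)
    also have "\<dots> \<longleftrightarrow> integrable (lebesgue_on A) (\<lambda>x. \<bar>r x\<bar> * (norm (f x))\<^sup>2)"
    proof (rule integrable_cong_AE)
      show "AE x in lebesgue_on A. r x *\<^sub>R (norm (f x))\<^sup>2 = \<bar>r x\<bar> * (norm (f x))\<^sup>2"
        using AE_r_pos_subset[OF A] by eventually_elim simp
    qed (use r f in auto)
    finally show ?thesis using A by (simp add: sq_integrable_def set_integrable_eq)
  qed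
  moreover have "f \<in> borel_measurable (weighted A r) \<longleftrightarrow> f \<in> borel_measurable (lebesgue_on A)"
    by (simp add: weighted_def)
  ultimately show ?thesis by (auto simp: L2_def)
qed

lemma L2_near_iff:
  assumes "continuous_on I f" "d \<in> I"
  shows "L2_near a b r c f \<longleftrightarrow> sq_integrable (tail c d) f"
proof -
  have f: "f \<in> borel_measurable (lebesgue_on (tail c e))" if "e \<in> I" for e
    using continuous_measurable[OF assms(1)] tail_subset[OF that] by (metis inf.absorb_iff2 measurable_restrict_mono)
  have "f \<in> L2 (weighted (tail c e) r) \<longleftrightarrow> sq_integrable (tail c e) f" if "e \<in> I" for e
    using L2_weighted_iff[OF tail_subset[OF that] tail_sets] f[OF that] by blast
  then show ?thesis
    unfolding L2_near_def using assms sq_integrable_tail[OF assms(1) _ assms(2)] by blast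
qed

text \<open>The primitive of a nonnegative function integrable up to the endpoint is monotone and
  bounded there. A point \<open>t\<close> whose value is within \<open>\<delta>\<close> of the
  infimum (left end) or supremum (right end) does it, without taking limits at a possibly infinite
  endpoint.\<close>

lemma AC_deriv_small_tail:
  assumes P: "AC_deriv a b P (\<lambda>x. complex_of_real (h x))" and h: "\<And>x. h x \<ge> 0" "set_integrable lebesgue (tail c d) h"
    and d: "d \<in> I" and e: "\<delta> > 0" and c: "c \<in> {a, b}"
  obtains t where "t \<in> I" "tail c t \<subseteq> tail c d"
    "\<And>\<xi>. \<xi> \<in> tail c t \<Longrightarrow> \<bar>Re (P \<xi>) - Re (P t)\<bar> \<le> \<delta>"
proof -
  define R where "R x = Re (P x)" for x
  have int: "(h has_integral (R y - R x)) {x..y}" if "x \<in> I" "y \<in> I" "x \<le> y" for x y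
    using has_integral_linear[OF AC_deriv_has_integral[OF P that] bounded_linear_Re] by (simp add: o_def R_def)
  have mono: "R x \<le> R y" if "x \<in> I" "y \<in> I" "x \<le> y" for x y
    using has_integral_nonneg[OF int[OF that]] h(1) by auto
  define L where "L = integral (tail c d) h"
  have bd: "R y - R x \<le> L" if "x \<le> y" "x \<in> tail c d" "y \<in> tail c d" for x y
  proof -
    have I: "x \<in> I" "y \<in> I" using that tail_subset[OF d] by auto
    have "{x..y} \<subseteq> tail c d" using that einterval_subset by (auto split: if_splits)
    then have "integral {x..y} h \<le> L"
      unfolding L_def using int[OF I that(1)] set_lebesgue_integral_eq_integral(1)[OF h(2)] h(1)
      by (intro integral_subset_le) (auto simp: integrable_on_def)
    then show ?thesis using int[OF I that(1)] by (simp add: integral_unique)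
  qed
  obtain e where e': "e \<in> tail c d"
  proof -
    obtain u v where "u < d" "d < v" "u \<in> I" "v \<in> I" by (rule einterval_box[OF d])
    then show ?thesis using that[of u] that[of v] by (cases "c = a") (auto simp: einterval_iff)
  qed
  have bdd: "\<bar>R x - R e\<bar> \<le> L" if "x \<in> tail c d" for x
    using bd[of x e] bd[of e x] mono[of x e] mono[of e x] that e' tail_subset[OF d, of c]
    by (cases "x \<le> e") (fastforce simp: abs_if)+
  show ?thesis
  proof (cases "c = a")
    case True
    define m where "m = Inf (R ` tail c d)"
    have below: "bdd_below (R ` tail c d)"
      using bdd by (intro bdd_belowI2[of _ "R e - L"]) (simp add: abs_le_iff algebra_simps)
    have "R ` tail c d \<noteq> {}" using e' by blast
    then obtain t where t: "t \<in> tail c d" "R t < m + \<delta>"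
      using cInf_lessD[of "R ` tail c d" "m + \<delta>"] e by (auto simp: m_def)
    have tI: "t \<in> I" using t tail_subset[OF d] by auto
    have sub: "tail c t \<subseteq> tail c d" using t True by (auto simp: einterval_iff intro: less_trans)
    have "\<bar>R x - R t\<bar> \<le> \<delta>" if x: "x \<in> tail c t" for x
    proof -
      have "x \<in> I" using x tail_subset[OF tI] by blast
      moreover have "x \<le> t" using x True by (auto simp: einterval_iff)
      ultimately have "R x \<le> R t" using mono tI by blast
      moreover have "m \<le> R x" unfolding m_def using x sub below by (intro cInf_lower) auto
      ultimately show ?thesis using t by auto
    qed
    then show ?thesis using that[OF tI sub] by (simp add: R_def)
  next
    case False
    define m where "m = Sup (R ` tail c d)"
    have above: "bdd_above (R ` tail c d)"
      using bdd by (intro bdd_aboveI2[of _ _ "R e + L"]) (simp add: abs_le_iff algebra_simps)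
    have "R ` tail c d \<noteq> {}" using e' by blast
    then obtain t where t: "t \<in> tail c d" "m - \<delta> < R t"
      using less_cSupD[of "R ` tail c d" "m - \<delta>"] e by (auto simp: m_def)
    have tI: "t \<in> I" using t tail_subset[OF d] by auto
    have sub: "tail c t \<subseteq> tail c d" using t False by (auto simp: einterval_iff intro: less_trans)
    have "\<bar>R x - R t\<bar> \<le> \<delta>" if x: "x \<in> tail c t" for x
    proof -
      have "x \<in> I" using x tail_subset[OF tI] by blast
      moreover have "t \<le> x" using x False by (auto simp: einterval_iff)
      ultimately have "R t \<le> R x" using mono tI by blast
      moreover have "R x \<le> m" unfolding m_def using x sub above by (intro cSup_upper) auto
      ultimately show ?thesis using t by auto
    qed
    then show ?thesis using that[OF tI sub] by (simp add: R_def)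
  qed
qed

text \<open>Weyl's alternative by variation of constants: near the endpoint, the coefficients of \<open>u\<close>
  with respect to a square integrable fundamental system for \<open>z1\<close> stay bounded.\<close>

lemma all_solutions_sq_integrable:
  assumes c: "c \<in> {a, b}" and d: "d \<in> I"
    and all: "\<And>f f1. system f f1 (\<lambda>x. z1 * f x) \<Longrightarrow> sq_integrable (tail c d) f"
    and u: "system u u1 (\<lambda>x. z0 * u x)"
  shows "sq_integrable (tail c d) u"
proof -
  obtain f f1 g g1 where f: "system f f1 (\<lambda>x. z1 * f x)" and g: "system g g1 (\<lambda>x. z1 * g x)"
    and W: "\<And>x. x \<in> I \<Longrightarrow> f x * g1 x - f1 x * g x = 1" by (rule fundamental_system) blast
  note cont = system_continuous(1)[OF f] system_continuous(1)[OF g] system_continuous(1)[OF u]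
    system_continuous(2)[OF f] system_continuous(2)[OF g] system_continuous(2)[OF u]
  \<comment> \<open>A common majorant of both fundamental solutions, made complex valued so that it
    can itself be tested with \<open>sq_integrable\<close>.\<close>
  define v where "v x = complex_of_real (norm (f x) + norm (g x))" for x
  have v: "continuous_on I v" unfolding v_def by (intro continuous_intros cont)
  have vsq: "sq_integrable (tail c d) v"
    by (rule sq_integrable_bound[OF all[OF f] all[OF g] tail_subset[OF d] tail_sets continuous_measurable[OF v], of 1])
      (simp add: v_def flip: of_real_add)
  define h where "h = (\<lambda>x. \<bar>r x\<bar> * (norm (v x))\<^sup>2)"
  have h: "\<And>x. h x \<ge> 0" "set_integrable lebesgue (tail c d) h" "loc_integrable a b (\<lambda>x. complex_of_real (h x))"
    using vsq loc_integrable_sq[OF v] by (auto simp: h_def sq_integrable_def)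
  obtain P where P: "AC_deriv a b P (\<lambda>x. complex_of_real (h x))"
    using loc_integrable_primitive[OF h(3) d] by blast
  define \<zeta> where "\<zeta> = norm (z0 - z1)"
  have \<zeta>: "\<zeta> \<ge> 0" by (simp add: \<zeta>_def)
  \<comment> \<open>Chosen so that the feedback factor \<open>2 * \<zeta> * \<delta>\<close> of the
    two coefficient estimates is at most 1/2.\<close>
  define \<delta> where "\<delta> = 1 / (4 * (\<zeta> + 1))"
  have \<delta>: "\<delta> > 0" "2 * \<zeta> * \<delta> \<le> 1/2" using \<zeta> by (auto simp: \<delta>_def field_simps)
  obtain t where t: "t \<in> I" "tail c t \<subseteq> tail c d" "\<And>\<xi>. \<xi> \<in> tail c t \<Longrightarrow> \<bar>Re (P \<xi>) - Re (P t)\<bar> \<le> \<delta>"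
    using AC_deriv_small_tail[OF P h(1,2) d \<delta>(1) c] by blast
  \<comment> \<open>By Cramer's rule with Wronskian 1, \<open>u = f * A - g * B\<close>; these
    Wronskians are the varying coefficients, and their derivatives carry the factor
    \<open>z0 - z1\<close>.\<close>
  define A where "A x = u x * g1 x - u1 x * g x" for x
  define B where "B x = u x * f1 x - u1 x * f x" for x
  have A: "AC_deriv a b A (\<lambda>x. of_real (r x) * (z0 * u x * g x - u x * (z1 * g x)))"
    and B: "AC_deriv a b B (\<lambda>x. of_real (r x) * (z0 * u x * f x - u x * (z1 * f x)))"
    unfolding A_def B_def by (rule lagrange_identity[OF u g], rule lagrange_identity[OF u f])
  define \<phi> where "\<phi> x = norm (A x) + norm (B x)" for x
  have \<phi>c: "continuous_on I \<phi>" unfolding \<phi>_def A_def B_def by (intro continuous_intros cont)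
  have u_eq: "norm (u x) \<le> norm (v x) * \<phi> x" if "x \<in> I" for x
  proof -
    have "u x = f x * A x - g x * B x"
    proof -
      have "f x * A x - g x * B x = u x * (f x * g1 x - f1 x * g x)"
        by (simp add: A_def B_def algebra_simps)
      then show ?thesis using W[OF that] by simp
    qed
    also have "norm \<dots> \<le> norm (f x) * norm (A x) + norm (g x) * norm (B x)"
      by (metis norm_mult norm_triangle_ineq4)
    also have "\<dots> \<le> (norm (f x) + norm (g x)) * (norm (A x) + norm (B x))"
      by (simp add: algebra_simps)
    finally show ?thesis by (simp add: v_def \<phi>_def flip: of_real_add)
  qed
  have \<phi>_bd: "\<phi> \<xi> \<le> 2 * \<phi> t" if xi: "\<xi> \<in> tail c t" for \<xi>
  proof -
    have xiI: "\<xi> \<in> I" using xi tail_subset[OF t(1)] by auto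
    have segI: "closed_segment t \<xi> \<subseteq> I" by (rule einterval_segment[OF t(1) xiI])
    \<comment> \<open>Absorption in place of a Gronwall inequality: at a maximum point
      \<open>m\<close> of \<open>\<phi>\<close>, both increments from \<open>t\<close> are at most
      \<open>\<zeta> * \<phi> m * \<delta>\<close>, so half of \<open>\<phi> m\<close> moves to the
      left-hand side.\<close>
    obtain m where m: "m \<in> closed_segment t \<xi>" "\<And>y. y \<in> closed_segment t \<xi> \<Longrightarrow> \<phi> y \<le> \<phi> m"
      using continuous_attains_sup[OF compact_segment, of t \<xi> \<phi>] continuous_on_subset[OF \<phi>c segI] by auto
    have mI: "m \<in> I" using m segI by auto
    \<comment> \<open>The point \<open>t\<close> is not in its own open tail, so
      \<open>m = t\<close> is a separate case.\<close>
    have mP: "\<bar>Re (P m) - Re (P t)\<bar> \<le> \<delta>"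
    proof (cases "m = t")
      case False
      then have "m \<in> tail c t" using m(1) xi mI
        by (cases "c = a") (auto simp: closed_segment_eq_real_ivl einterval_iff not_less split: if_splits intro: le_less_trans less_le_trans)
      then show ?thesis by (rule t)
    qed (use \<delta> in auto)
    have sub: "closed_segment t m \<subseteq> closed_segment t \<xi>" using m(1) by (simp add: subset_closed_segment)
    have bound: "norm (of_real (r x) * (z0 * u x * w x - u x * (z1 * w x))) \<le>
        Re (of_real (\<zeta> * \<phi> m) * complex_of_real (h x))"
      if x: "x \<in> closed_segment t m" and w: "norm (w x) \<le> norm (v x)" for x w
    proof -
      have xI: "x \<in> I" and xm: "\<phi> x \<le> \<phi> m" using x sub segI m(2) by auto
      have eq: "of_real (r x) * (z0 * u x * w x - u x * (z1 * w x)) = of_real (r x) * ((z0 - z1) * (u x * w x))"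
        by (simp add: algebra_simps)
      have "norm (of_real (r x) * (z0 * u x * w x - u x * (z1 * w x))) = \<bar>r x\<bar> * (\<zeta> * (norm (u x) * norm (w x)))"
        unfolding eq by (simp add: norm_mult \<zeta>_def)
      also have "\<dots> \<le> \<bar>r x\<bar> * (\<zeta> * ((norm (v x) * \<phi> m) * norm (v x)))"
        using u_eq[OF xI] xm w \<zeta> by (intro mult_left_mono mult_mono order_trans[OF u_eq[OF xI]] mult_nonneg_nonneg) (auto simp: \<phi>_def)
      also have "\<dots> = \<zeta> * \<phi> m * h x" by (simp add: h_def power2_eq_square)
      finally show ?thesis by simp
    qed
    have H: "\<bar>Re (of_real (\<zeta> * \<phi> m) * P m) - Re (of_real (\<zeta> * \<phi> m) * P t)\<bar> \<le> \<zeta> * \<phi> m * \<delta>"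
    proof -
      have "\<bar>Re (of_real (\<zeta> * \<phi> m) * P m) - Re (of_real (\<zeta> * \<phi> m) * P t)\<bar> = (\<zeta> * \<phi> m) * \<bar>Re (P m) - Re (P t)\<bar>"
        using \<zeta> by (simp add: abs_mult \<phi>_def flip: right_diff_distrib)
      then show ?thesis using mP \<zeta> by (simp add: mult_left_mono \<phi>_def)
    qed
    have "norm (A m - A t) \<le> \<zeta> * \<phi> m * \<delta>"
      by (rule order_trans[OF AC_deriv_norm_bound_segment[OF A AC_deriv_cmult[OF P] t(1) mI] H], rule bound)
        (auto simp: v_def simp flip: of_real_add)
    moreover have "norm (B m - B t) \<le> \<zeta> * \<phi> m * \<delta>"
      by (rule order_trans[OF AC_deriv_norm_bound_segment[OF B AC_deriv_cmult[OF P] t(1) mI] H], rule bound)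
        (auto simp: v_def simp flip: of_real_add)
    ultimately have "\<phi> m \<le> \<phi> t + (2 * \<zeta> * \<delta>) * \<phi> m"
      using norm_triangle_sub[of "A m" "A t"] norm_triangle_sub[of "B m" "B t"] by (simp add: \<phi>_def algebra_simps)
    also have "\<dots> \<le> \<phi> t + 1/2 * \<phi> m" using \<delta>(2) by (intro add_left_mono mult_right_mono) (auto simp: \<phi>_def)
    finally have "\<phi> m \<le> 2 * \<phi> t" by simp
    then show ?thesis using m(2)[of \<xi>] by force
  qed
  have vt: "sq_integrable (tail c t) v" using sq_integrable_subset[OF vsq tail_sets t(2)] .
  have "sq_integrable (tail c t) u"
  proof (rule sq_integrable_bound[OF vt vt tail_subset[OF t(1)] tail_sets continuous_measurable[OF cont(3)]])
    fix x assume x: "x \<in> tail c t"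
    then have "norm (u x) \<le> norm (v x) * \<phi> x" using u_eq tail_subset[OF t(1)] by blast
    also have "\<dots> \<le> norm (v x) * (2 * \<phi> t)" using \<phi>_bd[OF x] by (intro mult_left_mono) auto
    finally show "norm (u x) \<le> \<phi> t * (norm (v x) + norm (v x))" by (simp add: algebra_simps)
  qed
  then show ?thesis by (rule sq_integrable_tail[OF cont(3) _ t(1) d])
qed

text \<open>Both notions quantify universally over the spectral parameter, so this is not a formal
  negation: square integrability of all solutions for one parameter has to be carried over to every
  other one.\<close>

lemma not_limit_circle_imp_limit_point:
  assumes c: "c \<in> {a, b}" and "\<not> limit_circle a b p q r s c"
  shows "limit_point a b p q r s c"
  unfolding limit_point_def
proof (rule allI, rule ccontr)
  fix z1 assume *: "\<nexists>u. is_solution a b p q r s z1 u \<and> \<not> L2_near a b r c u"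
  obtain d where d: "d \<in> I" by (rule nonempty)
  have "limit_circle a b p q r s c"
    unfolding limit_circle_def
  proof (intro allI impI)
    fix z u assume "is_solution a b p q r s z u"
    then obtain u1 where u: "system u u1 (\<lambda>x. z * u x)" by (auto simp: is_solution_iff)
    have "sq_integrable (tail c d) u"
    proof (rule all_solutions_sq_integrable[OF c d _ u])
      fix f f1 assume f: "system f f1 (\<lambda>x. z1 * f x)"
      then have "L2_near a b r c f" using * by (auto simp: is_solution_iff)
      then show "sq_integrable (tail c d) f" using L2_near_iff[OF system_continuous(1)[OF f] d] by blast
    qed
    then show "L2_near a b r c u" using L2_near_iff[OF system_continuous(1)[OF u] d] by blast
  qed
  with assms(2) show False by blast
qed

section \<open>The Green operator\<close>

lemma L2_iff: "f \<in> L2 (weighted I r) \<longleftrightarrow> f \<in> borel_measurable (lebesgue_on I) \<and> sq_integrable I f"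
  by (rule L2_weighted_iff) auto

lemma L2_diff:
  assumes "f \<in> L2 (weighted I r)" "g \<in> L2 (weighted I r)"
  shows "(\<lambda>x. f x - g x) \<in> L2 (weighted I r)"
proof -
  have m: "(\<lambda>x. f x - g x) \<in> borel_measurable (lebesgue_on I)"
    using assms unfolding L2_iff by (auto intro!: borel_measurable_diff borel_measurable_times)
  show ?thesis
    using assms sq_integrable_bound[of I f g "\<lambda>x. f x - g x" 1] m by (simp add: L2_iff norm_triangle_ineq4)
qed

lemma L2_cmult:
  assumes "f \<in> L2 (weighted I r)"
  shows "(\<lambda>x. k * f x) \<in> L2 (weighted I r)"
proof -
  have m: "(\<lambda>x. k * f x) \<in> borel_measurable (lebesgue_on I)"
    using assms unfolding L2_iff by (auto intro!: borel_measurable_diff borel_measurable_times)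
  show ?thesis
    using assms sq_integrable_bound[of I f f "\<lambda>x. k * f x" "norm k"] m
    by (simp add: L2_iff norm_mult distrib_left)
qed

lemma AE_weighted: "(AE x in weighted I r. P x) \<longleftrightarrow> (AE x in lebesgue_on I. P x)"
proof -
  have "(AE x in weighted I r. P x) \<longleftrightarrow> (AE x in lebesgue_on I. 0 < ennreal (r x) \<longrightarrow> P x)"
    unfolding weighted_def using r_meas by (intro AE_density) auto
  also have "\<dots> \<longleftrightarrow> (AE x in lebesgue_on I. P x)"
    using r_pos by (intro eventually_subst) (auto elim: eventually_mono)
  finally show ?thesis .
qed

lemma L2_norm_weighted:
  assumes f: "f \<in> borel_measurable (lebesgue_on I)"
  shows "L2_norm (weighted I r) f = sqrt (LINT x|lebesgue_on I. \<bar>r x\<bar> * (norm (f x))\<^sup>2)"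
proof -
  have "(LINT x|weighted I r. (norm (f x))\<^sup>2) = (LINT x|lebesgue_on I. r x *\<^sub>R (norm (f x))\<^sup>2)"
    unfolding weighted_def using f r_meas r_pos by (intro integral_density) (auto elim: eventually_mono)
  also have "\<dots> = (LINT x|lebesgue_on I. \<bar>r x\<bar> * (norm (f x))\<^sup>2)"
    using f r_meas r_pos by (intro integral_cong_AE) (auto elim: eventually_mono)
  finally show ?thesis by (simp add: L2_norm_def)
qed

lemma L2_norm_cong_AE:
  assumes "f \<in> borel_measurable (lebesgue_on I)" "g \<in> borel_measurable (lebesgue_on I)"
    "AE x in lebesgue_on I. f x = g x"
  shows "L2_norm (weighted I r) f = L2_norm (weighted I r) g"
  unfolding L2_norm_weighted[OF assms(1)] L2_norm_weighted[OF assms(2)]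
  using assms r_meas by (intro arg_cong[where f=sqrt] integral_cong_AE) (auto elim: eventually_mono)

text \<open>The pointwise bound of \<open>norm (f x) * norm (g x)\<close> by the sum of the two
  squares plays the role of the Cauchy-Schwarz inequality.\<close>

lemma set_integrable_product:
  assumes A: "A \<subseteq> I" "A \<in> sets lebesgue" and "sq_integrable A f" "sq_integrable A g"
    and m: "f \<in> borel_measurable (lebesgue_on I)" "g \<in> borel_measurable (lebesgue_on I)"
  shows "set_integrable lebesgue A (\<lambda>x. f x * g x * complex_of_real (r x))"
proof (rule set_integrable_bound)
  show "set_integrable lebesgue A (\<lambda>x. \<bar>r x\<bar> * (norm (f x))\<^sup>2 + \<bar>r x\<bar> * (norm (g x))\<^sup>2)"
    using assms(3,4) unfolding sq_integrable_def by (rule set_integral_add)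
  show "set_borel_measurable lebesgue A (\<lambda>x. f x * g x * complex_of_real (r x))"
    using m r_meas by (intro measurable_indicator[OF _ A]) auto
  have "norm (f x * g x * complex_of_real (r x)) \<le> norm (\<bar>r x\<bar> * (norm (f x))\<^sup>2 + \<bar>r x\<bar> * (norm (g x))\<^sup>2)" for x
  proof -
    have "norm (f x) * norm (g x) \<le> (norm (f x))\<^sup>2 + (norm (g x))\<^sup>2"
      using sum_squares_bound[of "norm (f x)" "norm (g x)"] mult_nonneg_nonneg[OF norm_ge_zero[of "f x"] norm_ge_zero[of "g x"]]
      by linarith
    then have "\<bar>r x\<bar> * (norm (f x) * norm (g x)) \<le> \<bar>r x\<bar> * ((norm (f x))\<^sup>2 + (norm (g x))\<^sup>2)"
      by (rule mult_left_mono) simp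
    then show ?thesis by (simp add: norm_mult algebra_simps)
  qed
  then show "AE x in lebesgue. x \<in> A \<longrightarrow>
      norm (f x * g x * complex_of_real (r x)) \<le> norm (\<bar>r x\<bar> * (norm (f x))\<^sup>2 + \<bar>r x\<bar> * (norm (g x))\<^sup>2)"
    by blast
qed

lemma integrable_indicator_iff:
  fixes h :: "real \<Rightarrow> complex"
  assumes "A \<subseteq> I" "A \<in> sets lebesgue"
  shows "integrable (lebesgue_on I) (\<lambda>y. indicator A y *\<^sub>R h y) \<longleftrightarrow> set_integrable lebesgue A h"
    and "(LINT y|lebesgue_on I. indicator A y *\<^sub>R h y) = (LINT y:A|lebesgue. h y)"
proof -
  have *: "(\<lambda>y. indicat_real I y *\<^sub>R (indicat_real A y *\<^sub>R h y)) = (\<lambda>y. indicat_real A y *\<^sub>R h y)"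
    using assms(1) by (intro ext) (auto simp: indicator_def)
  show "integrable (lebesgue_on I) (\<lambda>y. indicator A y *\<^sub>R h y) \<longleftrightarrow> set_integrable lebesgue A h"
    using integrable_restrict_space[of I lebesgue "\<lambda>y. indicator A y *\<^sub>R h y"]
    unfolding * by (simp add: set_integrable_def)
  show "(LINT y|lebesgue_on I. indicator A y *\<^sub>R h y) = (LINT y:A|lebesgue. h y)"
    using integral_restrict_space[of I lebesgue "\<lambda>y. indicator A y *\<^sub>R h y"]
    unfolding * by (simp add: set_lebesgue_integral_def)
qed

lemma LINT_indicator_interval:
  fixes h :: "real \<Rightarrow> complex"
  assumes "c \<in> I" "d \<in> I" "set_integrable lebesgue {c..d} h"
  shows "(LINT y|lebesgue_on I. indicator {c<..d} y *\<^sub>R h y) = integral {c..d} h"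
proof -
  have sub: "{c<..d} \<subseteq> I" using einterval_subset[OF assms(1,2)] by auto
  have "set_integrable lebesgue {c<..d} h" by (rule set_integrable_subset[OF assms(3)]) auto
  then have "(LINT y|lebesgue_on I. indicator {c<..d} y *\<^sub>R h y) = integral {c<..d} h"
    using integrable_indicator_iff(2)[OF sub, of h] set_lebesgue_integral_eq_integral(2) by simp
  also have "\<dots> = integral {c..d} h"
    by (rule integral_spike_set; rule negligible_subset[of "{c}"]) auto
  finally show ?thesis .
qed

abbreviation truncate :: "real \<Rightarrow> real \<Rightarrow> (real \<Rightarrow> complex) \<Rightarrow> real \<Rightarrow> complex" where
  "truncate c d g \<equiv> \<lambda>x. indicator {c..d} x *\<^sub>R g x"

lemma truncate_measurable:
  "g \<in> borel_measurable (lebesgue_on I) \<Longrightarrow> truncate c d g \<in> borel_measurable (lebesgue_on I)"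
  by (intro borel_measurable_scaleR measurable_restrict_space1[OF borel_measurable_indicator]) auto

lemma truncate_L2:
  assumes "g \<in> L2 (weighted I r)"
  shows "truncate c d g \<in> L2 (weighted I r)"
  using assms truncate_measurable[of g c d] sq_integrable_bound[of I g g "truncate c d g" 1]
  by (auto simp: L2_iff indicator_def)

text \<open>The Wronskian is linear in its first argument and the limit sees only a tail, so the
  quasi-derivative of \<open>cnj (v x)\<close> can stay opaque. Coefficients \<open>k\<close> and 0
  serve for multiples of a solution near the endpoint, 1 and -1 for differences.\<close>

lemma satisfies_bc_lincomb:
  assumes c: "c \<in> {a, b}" and d: "d \<in> I"
    and f: "system f f1 h" and u: "system u u1 k" and w: "system w w1 l"
    and eq: "\<And>x. x \<in> tail c d \<Longrightarrow> f x = \<kappa> * u x + \<mu> * w x \<and> f1 x = \<kappa> * u1 x + \<mu> * w1 x"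
    and bc: "satisfies_bc a b p s c v u" "satisfies_bc a b p s c v w"
  shows "satisfies_bc a b p s c v f"
proof -
  let ?F = "if c = a then at_right a else at_left b"
  let ?w = "\<lambda>f x. wronskian a b p s f (\<lambda>x. cnj (v x)) (real_of_ereal x)"
  have eqw: "?w f x = \<kappa> * ?w u x + \<mu> * ?w w x" if x: "real_of_ereal x \<in> tail c d" for x
  proof -
    have "real_of_ereal x \<in> I" using x tail_subset[OF d] by blast
    then show ?thesis
      using eq[OF x] system_quasi_deriv[OF f] system_quasi_deriv[OF u] system_quasi_deriv[OF w]
      by (simp add: wronskian_def algebra_simps)
  qed
  have "\<forall>\<^sub>F x in ?F. real_of_ereal x \<in> tail c d"
  proof (cases "c = a")
    case True
    have "a < ereal d" using d by (simp add: einterval_iff)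
    then have "\<forall>\<^sub>F x in at_right a. a < x \<and> x < ereal d"
      unfolding eventually_at_right[OF \<open>a < ereal d\<close>] by blast
    then have "\<forall>\<^sub>F x in at_right a. real_of_ereal x \<in> einterval a (ereal d)"
      by (rule eventually_mono) (auto simp: einterval_iff ereal_real)
    then show ?thesis using True by simp
  next
    case False
    have "ereal d < b" using d by (simp add: einterval_iff)
    then have "\<forall>\<^sub>F x in at_left b. ereal d < x \<and> x < b"
      unfolding eventually_at_left[OF \<open>ereal d < b\<close>] by blast
    then have "\<forall>\<^sub>F x in at_left b. real_of_ereal x \<in> einterval (ereal d) b"
      by (rule eventually_mono) (auto simp: einterval_iff ereal_real)
    then show ?thesis using False by simp
  qed
  then have ev: "\<forall>\<^sub>F x in ?F. \<kappa> * ?w u x + \<mu> * ?w w x = ?w f x"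
    by (rule eventually_mono) (simp add: eqw)
  have "((\<lambda>x. \<kappa> * ?w u x + \<mu> * ?w w x) \<longlongrightarrow> \<kappa> * 0 + \<mu> * 0) ?F"
    using bc unfolding satisfies_bc_def wronskian_at_def by (intro tendsto_intros)
  then have "(?w f \<longlongrightarrow> 0) ?F" using ev by (auto intro: Lim_transform_eventually)
  then show ?thesis by (simp add: satisfies_bc_def wronskian_at_def)
qed

end

section \<open>Variation of constants with the two boundary solutions\<close>

locale green_kernel = sturm_liouville +
  fixes z W :: complex and ua ua1 ub ub1 :: "real \<Rightarrow> complex"
  assumes ua: "system ua ua1 (\<lambda>x. z * ua x)" and ub: "system ub ub1 (\<lambda>x. z * ub x)"
    and ua_sq: "\<And>d. d \<in> I \<Longrightarrow> sq_integrable (tail a d) ua"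
    and ub_sq: "\<And>d. d \<in> I \<Longrightarrow> sq_integrable (tail b d) ub"
    and W: "\<And>x. x \<in> I \<Longrightarrow> ub x * ua1 x - ub1 x * ua x = W" and W_nz: "W \<noteq> 0"
begin

text \<open>The weak inequality here and the strict one in \<open>right_part\<close> follow the two
  branches of \<open>green_function\<close>, so that the index sets partition the interval.\<close>

definition left_part :: "(real \<Rightarrow> complex) \<Rightarrow> real \<Rightarrow> complex" where
  "left_part g x = (LINT y|lebesgue_on I. indicator {y \<in> I. y \<le> x} y *\<^sub>R (ua y * g y * complex_of_real (r y)))"

definition right_part :: "(real \<Rightarrow> complex) \<Rightarrow> real \<Rightarrow> complex" where
  "right_part g x = (LINT y|lebesgue_on I. indicator {y \<in> I. x < y} y *\<^sub>R (ub y * g y * complex_of_real (r y)))"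

definition green_op :: "(real \<Rightarrow> complex) \<Rightarrow> real \<Rightarrow> complex" where
  "green_op g x = inverse W * (ub x * left_part g x + ua x * right_part g x)"

text \<open>The candidate quasi-derivative. Differentiating the two integrals contributes
  \<open>ub * ua * g * r\<close> with opposite signs, so only the solutions themselves appear
  differentiated.\<close>

definition green_op1 :: "(real \<Rightarrow> complex) \<Rightarrow> real \<Rightarrow> complex" where
  "green_op1 g x = inverse W * (ub1 x * left_part g x + ua1 x * right_part g x)"

lemma u_measurable: "ua \<in> borel_measurable (lebesgue_on I)" "ub \<in> borel_measurable (lebesgue_on I)"
  using ua ub by (auto intro: continuous_measurable system_continuous)

lemma half_sets [simp]:
  "{y \<in> I. y \<le> x} \<in> sets lebesgue" "{y \<in> I. x < y} \<in> sets lebesgue"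
proof -
  have "I \<inter> {..x} \<in> sets lebesgue" "I \<inter> {x<..} \<in> sets lebesgue" by (intro sets.Int; simp)+
  moreover have "I \<inter> {..x} = {y \<in> I. y \<le> x}" "I \<inter> {x<..} = {y \<in> I. x < y}" by auto
  ultimately show "{y \<in> I. y \<le> x} \<in> sets lebesgue" "{y \<in> I. x < y} \<in> sets lebesgue" by simp_all
qed

lemma half_integrable:
  assumes g: "g \<in> L2 (weighted I r)" and x: "x \<in> I"
  shows "integrable (lebesgue_on I) (\<lambda>y. indicator {y \<in> I. y \<le> x} y *\<^sub>R (ua y * g y * complex_of_real (r y)))"
    and "integrable (lebesgue_on I) (\<lambda>y. indicator {y \<in> I. x < y} y *\<^sub>R (ub y * g y * complex_of_real (r y)))"
proof -
  \<comment> \<open>The set \<open>y \<le> x\<close> contains \<open>x\<close> and so does not fit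
    into the open tail at \<open>x\<close>; the larger point \<open>d\<close> makes room.\<close>
  obtain c d where cd: "c < x" "x < d" "c \<in> I" "d \<in> I" by (rule einterval_box[OF x])
  have gm: "g \<in> borel_measurable (lebesgue_on I)" "sq_integrable I g" using g by (auto simp: L2_iff)
  have 1: "{y \<in> I. y \<le> x} \<subseteq> tail a d" using cd by (auto simp: einterval_iff)
  have 2: "{y \<in> I. x < y} \<subseteq> tail b x" using x ab by (auto simp: einterval_iff)
  show "integrable (lebesgue_on I) (\<lambda>y. indicator {y \<in> I. y \<le> x} y *\<^sub>R (ua y * g y * complex_of_real (r y)))"
    by (subst integrable_indicator_iff)
      (auto intro!: set_integrable_product u_measurable gm sq_integrable_subset[OF ua_sq[OF cd(4)] _ 1] sq_integrable_subset[OF gm(2)])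
  show "integrable (lebesgue_on I) (\<lambda>y. indicator {y \<in> I. x < y} y *\<^sub>R (ub y * g y * complex_of_real (r y)))"
    by (subst integrable_indicator_iff)
      (auto intro!: set_integrable_product u_measurable gm sq_integrable_subset[OF ub_sq[OF x] _ 2] sq_integrable_subset[OF gm(2)])
qed

lemma product_Icc:
  assumes g: "g \<in> L2 (weighted I r)" and u: "continuous_on I u" and "c \<in> I" "d \<in> I"
  shows "set_integrable lebesgue {c..d} (\<lambda>y. u y * g y * complex_of_real (r y))"
proof -
  have sub: "{c..d} \<subseteq> I" using assms einterval_subset by blast
  show ?thesis
    using g sub by (intro set_integrable_product[OF sub _ sq_integrable_Icc[OF u assms(3,4)] _ continuous_measurable[OF u]])
      (auto simp: L2_iff intro: sq_integrable_subset)
qed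

lemma product_loc_integrable:
  assumes g: "g \<in> L2 (weighted I r)" and u: "continuous_on I u"
  shows "loc_integrable a b (\<lambda>y. u y * g y * complex_of_real (r y))"
  unfolding loc_integrable_def using product_Icc[OF assms] by (simp add: set_integrable_eq)

lemma left_part_deriv:
  assumes g: "g \<in> L2 (weighted I r)"
  shows "AC_deriv a b (left_part g) (\<lambda>y. ua y * g y * complex_of_real (r y))"
proof (rule AC_derivI_integral)
  show "loc_integrable a b (\<lambda>y. ua y * g y * complex_of_real (r y))"
    using product_loc_integrable[OF g system_continuous(1)[OF ua]] .
  fix c d assume cd: "c \<in> I" "d \<in> I" "c \<le> d"
  let ?h = "\<lambda>y. ua y * g y * complex_of_real (r y)"
  have "left_part g d - left_part g c =
      (LINT y|lebesgue_on I. indicator {y \<in> I. y \<le> d} y *\<^sub>R ?h y - indicator {y \<in> I. y \<le> c} y *\<^sub>R ?h y)"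
    unfolding left_part_def using half_integrable(1)[OF g] cd
    by (intro Bochner_Integration.integral_diff[symmetric])
  also have "\<dots> = (LINT y|lebesgue_on I. indicator {c<..d} y *\<^sub>R ?h y)"
    using cd by (intro Bochner_Integration.integral_cong) (auto simp: indicator_def)
  also have "\<dots> = integral {c..d} ?h"
    using product_Icc[OF g system_continuous(1)[OF ua]] cd by (intro LINT_indicator_interval)
  finally show "left_part g d - left_part g c = integral {c..d} ?h" .
qed

lemma right_part_deriv:
  assumes g: "g \<in> L2 (weighted I r)"
  shows "AC_deriv a b (right_part g) (\<lambda>y. - (ub y * g y * complex_of_real (r y)))"
proof (rule AC_derivI_integral)
  show "loc_integrable a b (\<lambda>y. - (ub y * g y * complex_of_real (r y)))"
    using product_loc_integrable[OF g system_continuous(1)[OF ub]] by (simp add: loc_integrable_def)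
  fix c d assume cd: "c \<in> I" "d \<in> I" "c \<le> d"
  let ?h = "\<lambda>y. ub y * g y * complex_of_real (r y)"
  have "right_part g c - right_part g d =
      (LINT y|lebesgue_on I. indicator {y \<in> I. c < y} y *\<^sub>R ?h y - indicator {y \<in> I. d < y} y *\<^sub>R ?h y)"
    unfolding right_part_def using half_integrable(2)[OF g] cd
    by (intro Bochner_Integration.integral_diff[symmetric])
  also have "\<dots> = (LINT y|lebesgue_on I. indicator {c<..d} y *\<^sub>R ?h y)"
    using cd by (intro Bochner_Integration.integral_cong) (auto simp: indicator_def)
  also have "\<dots> = integral {c..d} ?h"
    using product_Icc[OF g system_continuous(1)[OF ub]] cd by (intro LINT_indicator_interval)
  finally show "right_part g d - right_part g c = integral {c..d} (\<lambda>y. - ?h y)"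
    by (simp add: algebra_simps)
qed

text \<open>In the first equation the derivatives of the two integrals cancel. In the second they
  combine to \<open>- W * g * r\<close>, and the factor \<open>inverse W\<close> turns this into the
  inhomogeneity \<open>- r * g\<close>.\<close>

lemma green_op_system:
  assumes g: "g \<in> L2 (weighted I r)"
  shows "system (green_op g) (green_op1 g) (\<lambda>x. z * green_op g x + g x)"
  unfolding system_def
proof
  note A = left_part_deriv[OF g] and B = right_part_deriv[OF g]
  note ua' = ua[unfolded system_def] and ub' = ub[unfolded system_def]
  show "AC_deriv a b (green_op g) (\<lambda>x. of_real (inverse (p x)) * green_op1 g x - of_real (s x) * green_op g x)"
    by (rule AC_deriv_cong[OF AC_deriv_cmult[of a b _ _ "inverse W", OF AC_deriv_add[OF AC_deriv_mult[OF ub'[THEN conjunct1] A]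
        AC_deriv_mult[OF ua'[THEN conjunct1] B]]]])
      (auto simp: green_op_def green_op1_def algebra_simps intro!: AE_I2)
  show "AC_deriv a b (green_op1 g) (\<lambda>x. of_real (s x) * green_op1 g x + of_real (q x) * green_op g x -
      of_real (r x) * (z * green_op g x + g x))"
  proof (rule AC_deriv_cong[OF AC_deriv_cmult[of a b _ _ "inverse W", OF AC_deriv_add[OF AC_deriv_mult[OF ub'[THEN conjunct2] A]
        AC_deriv_mult[OF ua'[THEN conjunct2] B]]]], simp add: green_op1_def, rule AE_I2)
    fix x assume "x \<in> space (lebesgue_on I)"
    then have "x \<in> I" by simp
    have w: "inverse W * (ub x * ua1 x - ub1 x * ua x) = 1" using W[OF \<open>x \<in> I\<close>] W_nz by simp
    \<comment> \<open>Inserting the factor 1 in the form of the normalised Wronskian makes the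
      claimed equation an identity of polynomials.\<close>
    have e: "of_real (r x) * (z * green_op g x + g x) = of_real (r x) * (z * green_op g x) +
        inverse W * (ub x * ua1 x - ub1 x * ua x) * (of_real (r x) * g x)"
      unfolding w by (simp add: distrib_left)
    show "of_real (s x) * green_op1 g x + of_real (q x) * green_op g x -
        of_real (r x) * (z * green_op g x + g x) =
      inverse W * ((of_real (s x) * ub1 x + of_real (q x) * ub x - of_real (r x) * (z * ub x)) * left_part g x +
        ub1 x * (ua x * g x * of_real (r x)) +
       ((of_real (s x) * ua1 x + of_real (q x) * ua x - of_real (r x) * (z * ua x)) * right_part g x +
        ua1 x * - (ub x * g x * of_real (r x))))"
      unfolding e unfolding green_op_def green_op1_def by (simp add: algebra_simps)
  qed
qed

text \<open>The Wronskian in \<open>green_function\<close> is evaluated at the outer variable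
  \<open>x\<close>, so it is the constant \<open>W\<close> and leaves the integral.\<close>

lemma green_op_eq:
  assumes g: "g \<in> L2 (weighted I r)" and x: "x \<in> I"
  shows "integrable (lebesgue_on I) (\<lambda>y. green_function a b p s ua ub x y * g y * complex_of_real (r y))"
    and "(LINT y|lebesgue_on I. green_function a b p s ua ub x y * g y * complex_of_real (r y)) = green_op g x"
proof -
  let ?L = "\<lambda>y. indicator {y \<in> I. y \<le> x} y *\<^sub>R (ua y * g y * complex_of_real (r y))"
  let ?R = "\<lambda>y. indicator {y \<in> I. x < y} y *\<^sub>R (ub y * g y * complex_of_real (r y))"
  have w: "wronskian a b p s ub ua x = W"
    using W[OF x] system_quasi_deriv[OF ua x] system_quasi_deriv[OF ub x] by (simp add: wronskian_def)
  have eq: "green_function a b p s ua ub x y * g y * complex_of_real (r y) =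
     inverse W * (ub x * ?L y + ua x * ?R y)" if "y \<in> I" for y
    using that by (auto simp: green_function_def w divide_simps W_nz indicator_def)
  have int: "integrable (lebesgue_on I) ?L" "integrable (lebesgue_on I) ?R"
    using half_integrable[OF g x] by auto
  have "integrable (lebesgue_on I) (\<lambda>y. green_function a b p s ua ub x y * g y * complex_of_real (r y)) \<longleftrightarrow>
     integrable (lebesgue_on I) (\<lambda>y. inverse W * (ub x * ?L y + ua x * ?R y))"
    by (rule Bochner_Integration.integrable_cong) (auto simp: eq)
  moreover have "integrable (lebesgue_on I) (\<lambda>y. inverse W * (ub x * ?L y + ua x * ?R y))"
    by (intro integrable_mult_right Bochner_Integration.integrable_add int)
  ultimately show "integrable (lebesgue_on I) (\<lambda>y. green_function a b p s ua ub x y * g y * complex_of_real (r y))"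
    by blast
  have "(LINT y|lebesgue_on I. green_function a b p s ua ub x y * g y * complex_of_real (r y)) =
     (LINT y|lebesgue_on I. inverse W * (ub x * ?L y + ua x * ?R y))"
    by (rule Bochner_Integration.integral_cong) (auto simp: eq)
  also have "\<dots> = inverse W * (ub x * integral\<^sup>L (lebesgue_on I) ?L + ua x * integral\<^sup>L (lebesgue_on I) ?R)"
  proof -
    have "(LINT y|lebesgue_on I. inverse W * (ub x * ?L y + ua x * ?R y)) =
       inverse W * (LINT y|lebesgue_on I. ub x * ?L y + ua x * ?R y)" by (rule integral_mult_right_zero)
    also have "(LINT y|lebesgue_on I. ub x * ?L y + ua x * ?R y) =
       (LINT y|lebesgue_on I. ub x * ?L y) + (LINT y|lebesgue_on I. ua x * ?R y)"
      by (intro Bochner_Integration.integral_add integrable_mult_right int)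
    finally show ?thesis by (simp only: integral_mult_right_zero)
  qed
  finally show "(LINT y|lebesgue_on I. green_function a b p s ua ub x y * g y * complex_of_real (r y)) = green_op g x"
    by (simp add: green_op_def left_part_def right_part_def)
qed

text \<open>To the left of the support the integral over \<open>y \<le> x\<close> is zero and the
  other one no longer depends on \<open>x\<close>; to the right the roles are exchanged.\<close>

lemma green_op_truncate_near:
  assumes cd: "c \<in> I" "d \<in> I"
  shows "\<exists>k. \<forall>x \<in> tail a c. green_op (truncate c d g) x = k * ua x \<and> green_op1 (truncate c d g) x = k * ua1 x"
    and "\<exists>k. \<forall>x \<in> tail b d. green_op (truncate c d g) x = k * ub x \<and> green_op1 (truncate c d g) x = k * ub1 x"
proof -
  let ?g = "truncate c d g"
  define ka where "ka = (LINT y|lebesgue_on I. ua y * ?g y * complex_of_real (r y))"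
  define kb where "kb = (LINT y|lebesgue_on I. ub y * ?g y * complex_of_real (r y))"
  have "left_part ?g x = 0 \<and> right_part ?g x = kb" if "x \<in> tail a c" for x
  proof
    have "left_part ?g x = (LINT y|lebesgue_on I. 0)" unfolding left_part_def
      using that by (intro Bochner_Integration.integral_cong) (auto simp: indicator_def einterval_iff)
    then show "left_part ?g x = 0" by simp
    show "right_part ?g x = kb" unfolding right_part_def kb_def
      using that by (intro Bochner_Integration.integral_cong) (auto simp: indicator_def einterval_iff)
  qed
  then show "\<exists>k. \<forall>x \<in> tail a c. green_op ?g x = k * ua x \<and> green_op1 ?g x = k * ua1 x"
    by (intro exI[of _ "inverse W * kb"]) (simp add: green_op_def green_op1_def)
  have "left_part ?g x = ka \<and> right_part ?g x = 0" if "x \<in> tail b d" for x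
  proof
    have "b \<noteq> a" using ab by auto
    then have x: "x > d" using that by (auto simp: einterval_iff)
    have "right_part ?g x = (LINT y|lebesgue_on I. 0)" unfolding right_part_def
      using x by (intro Bochner_Integration.integral_cong) (auto simp: indicator_def)
    then show "right_part ?g x = 0" by simp
    show "left_part ?g x = ka" unfolding left_part_def ka_def
      using x by (intro Bochner_Integration.integral_cong) (auto simp: indicator_def)
  qed
  then show "\<exists>k. \<forall>x \<in> tail b d. green_op ?g x = k * ub x \<and> green_op1 ?g x = k * ub1 x"
    by (intro exI[of _ "inverse W * ka"]) (simp add: green_op_def green_op1_def)
qed

lemma green_op_continuous: "g \<in> L2 (weighted I r) \<Longrightarrow> continuous_on I (green_op g)"
  by (rule system_continuous(1)[OF green_op_system])

lemma green_op_truncate_L2: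
  assumes g: "g \<in> L2 (weighted I r)" and cd: "c \<in> I" "d \<in> I"
  shows "green_op (truncate c d g) \<in> L2 (weighted I r)"
proof -
  note cont = green_op_continuous[OF truncate_L2[OF g, of c d]]
  obtain ka where ka: "\<And>x. x \<in> tail a c \<Longrightarrow> green_op (truncate c d g) x = ka * ua x"
    using green_op_truncate_near(1)[OF cd] by blast
  obtain kb where kb: "\<And>x. x \<in> tail b d \<Longrightarrow> green_op (truncate c d g) x = kb * ub x"
    using green_op_truncate_near(2)[OF cd] by blast
  have "sq_integrable (tail a c) (green_op (truncate c d g))"
    by (rule sq_integrable_bound[OF ua_sq[OF cd(1)] ua_sq[OF cd(1)] tail_subset[OF cd(1)] tail_sets continuous_measurable[OF cont], of "norm ka"])
      (use ka in \<open>simp add: norm_mult mult_left_mono\<close>)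
  moreover have "sq_integrable (tail b d) (green_op (truncate c d g))"
    by (rule sq_integrable_bound[OF ub_sq[OF cd(2)] ub_sq[OF cd(2)] tail_subset[OF cd(2)] tail_sets continuous_measurable[OF cont], of "norm kb"])
      (use kb in \<open>simp add: norm_mult mult_left_mono\<close>)
  ultimately show ?thesis
    using sq_integrable_tails[OF cont] cd continuous_measurable[OF cont] by (simp add: L2_iff)
qed

text \<open>The Green operator need not a priori map into the Hilbert space, so it is compared with the
  resolvent on truncated data and the limit is taken by Fatou's lemma.\<close>

lemma green_op_identification:
  assumes g: "g \<in> L2 (weighted I r)" and f: "continuous_on I f" and fL: "f \<in> L2 (weighted I r)"
    and bd: "\<And>c d. c \<in> I \<Longrightarrow> d \<in> I \<Longrightarrow> L2_norm (weighted I r) (\<lambda>x. f x - green_op (truncate c d g) x) \<le>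
       C * L2_norm (weighted I r) (\<lambda>x. g x - truncate c d g x)"
    and x: "x \<in> I"
  shows "f x = green_op g x"
proof -
  \<comment> \<open>An exhaustion by compact intervals; each point eventually lies inside, so the
    truncations are eventually equal to \<open>g\<close> at that point.\<close>
  obtain u l :: "nat \<Rightarrow> real" where ul: "I = (\<Union>i. {l i .. u i})" "incseq u" "decseq l"
    "\<And>i. l i < u i" "\<And>i. a < l i" "\<And>i. u i < b" "l \<longlonglongrightarrow> a" "u \<longlonglongrightarrow> b"
    by (rule einterval_Icc_approximation[OF ab], rule that, assumption+)
  have luI: "l i \<in> I" "u i \<in> I" for i
  proof -
    have "l i \<in> {l i..u i}" "u i \<in> {l i..u i}" using ul(4)[of i] by auto
    then show "l i \<in> I" "u i \<in> I" unfolding ul(1) by blast+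
  qed
  have inside: "\<forall>\<^sub>F n in sequentially. y \<in> {l n..u n}" if yI: "y \<in> I" for y
  proof -
    obtain i where "y \<in> {l i..u i}" using yI unfolding ul(1) by blast
    then have "y \<in> {l n..u n}" if "n \<ge> i" for n
      using decseqD[OF ul(3) that] incseqD[OF ul(2) that] by auto
    then show ?thesis unfolding eventually_sequentially by blast
  qed
  define \<gamma> where "\<gamma> n = truncate (l n) (u n) g" for n
  have \<gamma>ev: "\<forall>\<^sub>F n in sequentially. \<gamma> n y = g y" if "y \<in> I" for y
    using inside[OF that] by eventually_elim (simp add: \<gamma>_def)
  have \<gamma>L: "\<gamma> n \<in> L2 (weighted I r)" for n unfolding \<gamma>_def by (rule truncate_L2[OF g])
  have [measurable]: "g \<in> borel_measurable (lebesgue_on I)" "\<And>n. \<gamma> n \<in> borel_measurable (lebesgue_on I)"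
    "f \<in> borel_measurable (lebesgue_on I)" "\<And>n. green_op (\<gamma> n) \<in> borel_measurable (lebesgue_on I)"
    "green_op g \<in> borel_measurable (lebesgue_on I)"
    "r \<in> borel_measurable (lebesgue_on I)"
    using g \<gamma>L f green_op_continuous r_meas by (auto simp: L2_iff continuous_measurable)
  have gsq: "integrable (lebesgue_on I) (\<lambda>x. \<bar>r x\<bar> * (norm (g x))\<^sup>2)"
    using g by (simp add: L2_iff sq_integrable_def set_integrable_eq)
  have \<gamma>cases: "\<gamma> n y = g y \<or> \<gamma> n y = 0" for n y by (auto simp: \<gamma>_def indicator_def)
  have "(\<lambda>n. LINT x|lebesgue_on I. \<bar>r x\<bar> * (norm (g x - \<gamma> n x))\<^sup>2) \<longlonglongrightarrow> (LINT x|lebesgue_on I. 0)"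
  proof (rule integral_dominated_convergence[OF _ _ gsq])
    show "AE x in lebesgue_on I. (\<lambda>n. \<bar>r x\<bar> * (norm (g x - \<gamma> n x))\<^sup>2) \<longlonglongrightarrow> 0"
    proof (rule AE_I2)
      fix y assume "y \<in> space (lebesgue_on I)"
      then have "\<forall>\<^sub>F n in sequentially. \<bar>r y\<bar> * (norm (g y - \<gamma> n y))\<^sup>2 = 0"
        by (intro eventually_mono[OF \<gamma>ev]) auto
      then show "(\<lambda>n. \<bar>r y\<bar> * (norm (g y - \<gamma> n y))\<^sup>2) \<longlonglongrightarrow> 0" by (rule tendsto_eventually)
    qed
    show "AE x in lebesgue_on I. norm (\<bar>r x\<bar> * (norm (g x - \<gamma> n x))\<^sup>2) \<le> \<bar>r x\<bar> * (norm (g x))\<^sup>2" for n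
    proof (rule AE_I2)
      fix y
      show "norm (\<bar>r y\<bar> * (norm (g y - \<gamma> n y))\<^sup>2) \<le> \<bar>r y\<bar> * (norm (g y))\<^sup>2"
        using \<gamma>cases[of n y] by auto
    qed
  qed measurable
  then have lim1: "(\<lambda>n. L2_norm (weighted I r) (\<lambda>x. g x - \<gamma> n x)) \<longlonglongrightarrow> 0"
    using tendsto_real_sqrt by (subst L2_norm_weighted) (measurable, fastforce)
  \<comment> \<open>Truncation never increases the norm of the integrand, so the integrand for
    \<open>g\<close> itself dominates and the Green integrals converge at every point.\<close>
  have parts: "(\<lambda>n. left_part (\<gamma> n) y) \<longlonglongrightarrow> left_part g y" "(\<lambda>n. right_part (\<gamma> n) y) \<longlonglongrightarrow> right_part g y"
    if y: "y \<in> I" for y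
  proof -
    have lim: "(\<lambda>n. LINT t|lebesgue_on I. indicator A t *\<^sub>R (w t * \<gamma> n t * complex_of_real (r t))) \<longlonglongrightarrow>
       (LINT t|lebesgue_on I. indicator A t *\<^sub>R (w t * g t * complex_of_real (r t)))"
      if int: "integrable (lebesgue_on I) (\<lambda>t. indicator A t *\<^sub>R (w t * g t * complex_of_real (r t)))"
        "\<And>n. integrable (lebesgue_on I) (\<lambda>t. indicator A t *\<^sub>R (w t * \<gamma> n t * complex_of_real (r t)))" for A and w :: "real \<Rightarrow> complex"
    proof (rule integral_dominated_convergence[OF _ _ integrable_norm[OF int(1)]])
      show "AE t in lebesgue_on I. (\<lambda>n. indicator A t *\<^sub>R (w t * \<gamma> n t * complex_of_real (r t))) \<longlonglongrightarrow>
          indicator A t *\<^sub>R (w t * g t * complex_of_real (r t))"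
      proof (rule AE_I2)
        fix t assume "t \<in> space (lebesgue_on I)"
        then have "\<forall>\<^sub>F n in sequentially. indicator A t *\<^sub>R (w t * \<gamma> n t * complex_of_real (r t)) =
            indicator A t *\<^sub>R (w t * g t * complex_of_real (r t))"
          by (intro eventually_mono[OF \<gamma>ev]) auto
        then show "(\<lambda>n. indicator A t *\<^sub>R (w t * \<gamma> n t * complex_of_real (r t))) \<longlonglongrightarrow>
          indicator A t *\<^sub>R (w t * g t * complex_of_real (r t))" by (rule tendsto_eventually)
      qed
      show "AE t in lebesgue_on I. norm (indicator A t *\<^sub>R (w t * \<gamma> n t * complex_of_real (r t))) \<le>
          norm (indicator A t *\<^sub>R (w t * g t * complex_of_real (r t)))" for n
      proof (rule AE_I2)
        fix t
        show "norm (indicator A t *\<^sub>R (w t * \<gamma> n t * complex_of_real (r t))) \<le>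
          norm (indicator A t *\<^sub>R (w t * g t * complex_of_real (r t)))"
          using \<gamma>cases[of n t] by auto
      qed
    qed (use int in auto)
    show "(\<lambda>n. left_part (\<gamma> n) y) \<longlonglongrightarrow> left_part g y" "(\<lambda>n. right_part (\<gamma> n) y) \<longlonglongrightarrow> right_part g y"
      unfolding left_part_def right_part_def by (intro lim half_integrable g \<gamma>L y)+
  qed
  have ptw: "(\<lambda>n. green_op (\<gamma> n) y) \<longlonglongrightarrow> green_op g y" if "y \<in> I" for y
    unfolding green_op_def by (intro tendsto_intros parts that)
  \<comment> \<open>Nonnegative extended values let Fatou's lemma apply before
    \<open>f - green_op g\<close> is known to be square integrable. The bounds on the integrals tend
    to zero, hence so does the integral of the pointwise limit.\<close>
  define F where "F n y = ennreal (\<bar>r y\<bar> * (norm (f y - green_op (\<gamma> n) y))\<^sup>2)" for n y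
  have Fm: "F n \<in> borel_measurable (lebesgue_on I)" for n unfolding F_def by measurable
  have Fbd: "(\<integral>\<^sup>+y. F n y \<partial>lebesgue_on I) \<le> ennreal ((C * L2_norm (weighted I r) (\<lambda>x. g x - \<gamma> n x))\<^sup>2)" for n
  proof -
    have "green_op (\<gamma> n) \<in> L2 (weighted I r)" unfolding \<gamma>_def by (rule green_op_truncate_L2[OF g luI])
    then have fin: "sq_integrable I (\<lambda>y. f y - green_op (\<gamma> n) y)"
      using L2_diff[OF fL] L2_iff by blast
    have i: "integrable (lebesgue_on I) (\<lambda>y. \<bar>r y\<bar> * (norm (f y - green_op (\<gamma> n) y))\<^sup>2)"
      using fin by (simp add: sq_integrable_def set_integrable_eq)
    have nn: "0 \<le> (LINT y|lebesgue_on I. \<bar>r y\<bar> * (norm (f y - green_op (\<gamma> n) y))\<^sup>2)" by simp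
    have "(\<integral>\<^sup>+y. F n y \<partial>lebesgue_on I) = ennreal (LINT y|lebesgue_on I. \<bar>r y\<bar> * (norm (f y - green_op (\<gamma> n) y))\<^sup>2)"
      unfolding F_def by (rule nn_integral_eq_integral[OF i]) auto
    also have "\<dots> = ennreal ((L2_norm (weighted I r) (\<lambda>x. f x - green_op (\<gamma> n) x))\<^sup>2)"
      using nn by (subst L2_norm_weighted) auto
    also have "\<dots> \<le> ennreal ((C * L2_norm (weighted I r) (\<lambda>x. g x - \<gamma> n x))\<^sup>2)"
      using bd[OF luI, of n n] unfolding \<gamma>_def
      by (intro ennreal_leI power_mono) (auto simp: L2_norm_def)
    finally show ?thesis .
  qed
  have "(\<lambda>n. (C * L2_norm (weighted I r) (\<lambda>x. g x - \<gamma> n x))\<^sup>2) \<longlonglongrightarrow> (C * 0)\<^sup>2"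
    by (intro tendsto_intros lim1)
  then have "(\<lambda>n. ennreal ((C * L2_norm (weighted I r) (\<lambda>x. g x - \<gamma> n x))\<^sup>2)) \<longlonglongrightarrow> 0"
    using tendsto_ennrealI by fastforce
  then have "liminf (\<lambda>n. ennreal ((C * L2_norm (weighted I r) (\<lambda>x. g x - \<gamma> n x))\<^sup>2)) = 0"
    by (intro lim_imp_Liminf) auto
  moreover have "liminf (\<lambda>n. \<integral>\<^sup>+y. F n y \<partial>lebesgue_on I) \<le>
      liminf (\<lambda>n. ennreal ((C * L2_norm (weighted I r) (\<lambda>x. g x - \<gamma> n x))\<^sup>2))"
    using Fbd by (intro Liminf_mono always_eventually allI)
  moreover have "(\<integral>\<^sup>+y. liminf (\<lambda>n. F n y) \<partial>lebesgue_on I) \<le> liminf (\<lambda>n. \<integral>\<^sup>+y. F n y \<partial>lebesgue_on I)"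
    by (rule nn_integral_liminf[OF Fm])
  ultimately have "(\<integral>\<^sup>+y. liminf (\<lambda>n. F n y) \<partial>lebesgue_on I) = 0" by simp
  moreover have "liminf (\<lambda>n. F n y) = ennreal (\<bar>r y\<bar> * (norm (f y - green_op g y))\<^sup>2)" if "y \<in> I" for y
    unfolding F_def by (intro lim_imp_Liminf tendsto_ennrealI tendsto_intros ptw that) simp
  then have "(\<integral>\<^sup>+y. liminf (\<lambda>n. F n y) \<partial>lebesgue_on I) =
      (\<integral>\<^sup>+y. ennreal (\<bar>r y\<bar> * (norm (f y - green_op g y))\<^sup>2) \<partial>lebesgue_on I)"
    by (intro nn_integral_cong) simp
  ultimately have "(\<integral>\<^sup>+y. ennreal (\<bar>r y\<bar> * (norm (f y - green_op g y))\<^sup>2) \<partial>lebesgue_on I) = 0" by simp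
  moreover have "(\<lambda>y. ennreal (\<bar>r y\<bar> * (norm (f y - green_op g y))\<^sup>2)) \<in> borel_measurable (lebesgue_on I)"
    by measurable
  ultimately have "AE y in lebesgue_on I. ennreal (\<bar>r y\<bar> * (norm (f y - green_op g y))\<^sup>2) = 0"
    using nn_integral_0_iff_AE by blast
  \<comment> \<open>A vanishing weighted square forces equality wherever \<open>r y > 0\<close>,
    that is, almost everywhere; continuity then gives it at \<open>x\<close>.\<close>
  then have "AE y in lebesgue_on I. f y = green_op g y"
    using r_pos by eventually_elim (auto simp: ennreal_eq_0_iff mult_le_0_iff)
  then show ?thesis
    by (rule AE_eq_continuous[OF f green_op_continuous[OF g] _ x])
qed

end

section \<open>The resolvent\<close>

theorem theorem7p3:
  fixes a b :: ereal and p q r s :: "real \<Rightarrow> real"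
    and v u :: "ereal \<Rightarrow> real \<Rightarrow> complex"
    and S :: "real graph" and z :: complex
  assumes ab: "a < b"
    and meas: "p \<in> borel_measurable (lebesgue_on (einterval a b))"
      "q \<in> borel_measurable (lebesgue_on (einterval a b))"
      "r \<in> borel_measurable (lebesgue_on (einterval a b))"
      "s \<in> borel_measurable (lebesgue_on (einterval a b))"
    and loc: "L1_loc a b (\<lambda>x. inverse (p x))" "L1_loc a b q" "L1_loc a b r" "L1_loc a b s"
    and r_pos: "AE x in lebesgue_on (einterval a b). r x > 0"
    and p_nz: "AE x in lebesgue_on (einterval a b). p x \<noteq> 0"
    and v: "\<And>c. c \<in> {a, b} \<Longrightarrow> limit_circle a b p q r s c \<Longrightarrow> bc_function a b p q r s c (v c)"
    and S: "S = {(f, h) \<in> T_max a b p q r s.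
        \<forall>c \<in> {a, b}. limit_circle a b p q r s c \<longrightarrow> satisfies_bc a b p s c (v c) f}"
    and sa: "self_adjoint_op (weighted (einterval a b) r) S"
    and z: "z \<in> resolvent_set (weighted (einterval a b) r) S"
    and sol: "\<And>c. c \<in> {a, b} \<Longrightarrow> is_solution a b p q r s z (u c)"
    and nontrivial: "\<And>c. c \<in> {a, b} \<Longrightarrow> \<exists>x \<in> einterval a b. u c x \<noteq> 0"
    and u_lc: "\<And>c. c \<in> {a, b} \<Longrightarrow> limit_circle a b p q r s c \<Longrightarrow>
        satisfies_bc a b p s c (v c) (u c)"
    and u_lp: "\<And>c. c \<in> {a, b} \<Longrightarrow> limit_point a b p q r s c \<Longrightarrow> L2_near a b r c (u c)"
  shows "(\<forall>x \<in> einterval a b. wronskian a b p s (u b) (u a) x \<noteq> 0) \<and>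
    (\<forall>g \<in> L2 (weighted (einterval a b) r). \<forall>x \<in> einterval a b.
      integrable (lebesgue_on (einterval a b))
        (\<lambda>y. green_function a b p s (u a) (u b) x y * g y * complex_of_real (r y)) \<and>
      resolvent (weighted (einterval a b) r) S z g x =
        (LINT y|lebesgue_on (einterval a b).
           green_function a b p s (u a) (u b) x y * g y * complex_of_real (r y)))"
proof -
  interpret sturm_liouville a b p q r s
    using ab meas loc r_pos p_nz by unfold_locales
  let ?M = "weighted (einterval a b) r"
  let ?qd = "quasi_deriv a b p s"
  have sys: "system (u c) (?qd (u c)) (\<lambda>x. z * u c x)" if "c \<in> {a, b}" for c
    using sol[OF that] unfolding is_solution_def by (rule tau_eqD)
  note ua = sys[of a, simplified] and ub = sys[of b, simplified]
  have near: "sq_integrable (tail c d) (u c)" if c: "c \<in> {a, b}" and d: "d \<in> I" for c d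
  proof -
    have "L2_near a b r c (u c)"
    proof (cases "limit_circle a b p q r s c")
      case True
      then show ?thesis using sol[OF c] by (auto simp: limit_circle_def)
    next
      case False
      then show ?thesis using u_lp[OF c] not_limit_circle_imp_limit_point[OF c] by blast
    qed
    then show ?thesis using L2_near_iff[OF system_continuous(1)[OF sys[OF c]] d] by blast
  qed
  have S_I: "(f, h) \<in> S" if "system f f1 h" "f \<in> L2 ?M" "h \<in> L2 ?M"
    "\<And>c. c \<in> {a, b} \<Longrightarrow> limit_circle a b p q r s c \<Longrightarrow> satisfies_bc a b p s c (v c) f" for f f1 h
    using that tau_eqI[OF that(1)] by (simp add: S T_max_def)
  have S_D: "system f (?qd f) h" "f \<in> L2 ?M" "h \<in> L2 ?M"
    "\<And>c. c \<in> {a, b} \<Longrightarrow> limit_circle a b p q r s c \<Longrightarrow> satisfies_bc a b p s c (v c) f" if "(f, h) \<in> S" for f h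
    using that tau_eqD[of f h] by (auto simp: S T_max_def)
  obtain x0 where x0: "x0 \<in> I" by (rule nonempty)
  define W where "W = u b x0 * ?qd (u a) x0 - ?qd (u b) x0 * u a x0"
  have W: "u b x * ?qd (u a) x - ?qd (u b) x * u a x = W" if "x \<in> I" for x
    unfolding W_def by (rule wronskian_const[OF ub ua that x0])
  have "W \<noteq> 0"
  proof
    assume "W = 0"
    then obtain k where k: "k \<noteq> 0" "\<And>x. x \<in> I \<Longrightarrow> u a x = k * u b x"
      using wronskian_zero_dependent[OF ua ub _ _ x0] nontrivial
      by (auto simp: W_def algebra_simps)
    \<comment> \<open>The boundary condition at \<open>b\<close> involves the quasi-derivative too,
      so proportionality is needed for both components.\<close>
    have "system (u a) (\<lambda>x. k * ?qd (u b) x) (\<lambda>x. z * u a x)"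
      by (rule system_cong[OF system_cmult[OF ub, of k]]) (use k in \<open>auto intro!: AE_I2\<close>)
    then have k1: "?qd (u a) x = k * ?qd (u b) x" if "x \<in> I" for x
      using that by (rule system_quasi_deriv)
    have "sq_integrable (tail b x0) (u a)"
      by (rule sq_integrable_bound[OF near[of b, OF _ x0] near[of b, OF _ x0] tail_subset[OF x0] tail_sets
          continuous_measurable[OF system_continuous(1)[OF ua]], of "norm k"])
        (use k(2) tail_subset[OF x0, of b] in \<open>auto simp: norm_mult mult_left_mono\<close>)
    then have "sq_integrable I (u a)"
      using sq_integrable_tails[OF system_continuous(1)[OF ua] near[of a, OF _ x0] _ x0 x0] by simp
    then have ua_L2: "u a \<in> L2 ?M"
      using continuous_measurable[OF system_continuous(1)[OF ua]] by (simp add: L2_iff)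
    have "(u a, \<lambda>x. z * u a x) \<in> S"
    proof (rule S_I[OF ua ua_L2 L2_cmult[OF ua_L2]])
      fix c assume c: "c \<in> {a, b}" and lc: "limit_circle a b p q r s c"
      show "satisfies_bc a b p s c (v c) (u a)"
      proof (cases "c = a")
        case True
        then show ?thesis using u_lc[OF c lc] by simp
      next
        case False
        then have "c = b" using c by simp
        then show ?thesis
          using k k1 tail_subset[OF x0, of c] u_lc[OF c lc]
          by (intro satisfies_bc_lincomb[OF c x0 ua ub ub, of k 0]) auto
      qed
    qed
    then have "AE x in ?M. u a x = 0"
      using z unfolding resolvent_set_def by fastforce
    then have "u a x = 0" if "x \<in> I" for x
      using AE_eq_continuous[OF system_continuous(1)[OF ua] continuous_on_const _ that, of 0]
      by (simp add: AE_weighted)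
    then show False using nontrivial[of a] by auto
  qed
  interpret green_kernel a b p q r s z W "u a" "?qd (u a)" "u b" "?qd (u b)"
  proof unfold_locales
    show "sq_integrable (tail a d) (u a)" "sq_integrable (tail b d) (u b)" if "d \<in> I" for d
      using near[of a, OF _ that] near[of b, OF _ that] by (simp_all only: insert_iff simp_thms)
  qed (fact ua ub W \<open>W \<noteq> 0\<close>)+
  obtain C where C: "\<And>f h. (f, h) \<in> S \<Longrightarrow> L2_norm ?M f \<le> C * L2_norm ?M (\<lambda>x. h x - z * f x)"
    using z unfolding resolvent_set_def by blast
  \<comment> \<open>Stated for every pair in \<open>S\<close> that solves the equation, so that it
    applies to whichever representative the choice in \<open>resolvent\<close> yields.\<close>
  have ident: "f x = green_op g x"
    if fh: "(f, h) \<in> S" "AE x in ?M. h x - z * f x = g x" and g: "g \<in> L2 ?M" and x: "x \<in> I" for f h g x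
  proof (rule green_op_identification[OF g _ S_D(2)[OF fh(1)] _ x, of C])
    show "continuous_on I f" using S_D(1)[OF fh(1)] by (rule system_continuous)
    fix c d assume cd: "c \<in> I" "d \<in> I"
    let ?g = "truncate c d g"
    let ?G = "green_op ?g" and ?G1 = "green_op1 ?g"
    note gL = truncate_L2[OF g, of c d] and GL = green_op_truncate_L2[OF g cd]
    have Gsys: "system ?G ?G1 (\<lambda>x. z * ?G x + ?g x)" by (rule green_op_system[OF gL])
    have "(\<lambda>x. z * ?G x + ?g x) \<in> L2 ?M"
      using L2_diff[OF L2_cmult[OF GL, of z] L2_cmult[OF gL, of "-1"]] by simp
    moreover have "satisfies_bc a b p s e (v e) ?G" if e: "e \<in> {a, b}" and lc: "limit_circle a b p q r s e" for e
    proof (cases "e = a")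
      case True
      obtain k where "\<forall>x \<in> tail a c. ?G x = k * u a x \<and> ?G1 x = k * ?qd (u a) x"
        using green_op_truncate_near(1)[OF cd] by blast
      then show ?thesis using u_lc[OF e lc] True
        by (intro satisfies_bc_lincomb[OF e cd(1) Gsys ua ua, of k 0]) auto
    next
      case False
      then have eb: "e = b" using e by simp
      obtain k where "\<forall>x \<in> tail b d. ?G x = k * u b x \<and> ?G1 x = k * ?qd (u b) x"
        using green_op_truncate_near(2)[OF cd] by blast
      then show ?thesis using u_lc[OF e lc] eb
        by (intro satisfies_bc_lincomb[OF e cd(2) Gsys ub ub, of k 0]) auto
    qed
    ultimately have GS: "(?G, \<lambda>x. z * ?G x + ?g x) \<in> S" by (rule S_I[OF Gsys GL])
    \<comment> \<open>The difference of the resolvent value and the Green integral of the truncated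
      data again lies in \<open>S\<close>. Applying \<open>S - z\<close> to it gives
      \<open>g\<close> minus its truncation, though only almost everywhere, and the bounded inverse
      yields the estimate.\<close>
    let ?f = "\<lambda>x. f x - ?G x" and ?h = "\<lambda>x. h x - (z * ?G x + ?g x)"
    have fsys: "system ?f (\<lambda>x. ?qd f x - ?G1 x) ?h"
      by (rule system_diff[OF S_D(1)[OF fh(1)] Gsys])
    have "(?f, ?h) \<in> S"
    proof (rule S_I[OF fsys])
      show "?f \<in> L2 ?M" by (rule L2_diff[OF S_D(2)[OF fh(1)] GL])
      show "?h \<in> L2 ?M" by (rule L2_diff[OF S_D(3)[OF fh(1)] S_D(3)[OF GS]])
      fix e assume e: "e \<in> {a, b}" "limit_circle a b p q r s e"
      show "satisfies_bc a b p s e (v e) ?f"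
        by (rule satisfies_bc_lincomb[OF e(1) x0 fsys S_D(1)[OF fh(1)] Gsys _ S_D(4)[OF fh(1) e] S_D(4)[OF GS e], of 1 "-1"]) simp
    qed
    then have "L2_norm ?M ?f \<le> C * L2_norm ?M (\<lambda>x. ?h x - z * ?f x)" by (rule C)
    also have "L2_norm ?M (\<lambda>x. ?h x - z * ?f x) = L2_norm ?M (\<lambda>x. g x - ?g x)"
    proof (rule L2_norm_cong_AE)
      have "(\<lambda>x. ?h x - z * ?f x) \<in> L2 ?M" "(\<lambda>x. g x - ?g x) \<in> L2 ?M"
        using S_D(2,3)[OF \<open>(?f, ?h) \<in> S\<close>] g gL by (auto intro!: L2_diff L2_cmult)
      then show "(\<lambda>x. ?h x - z * ?f x) \<in> borel_measurable (lebesgue_on I)" "(\<lambda>x. g x - ?g x) \<in> borel_measurable (lebesgue_on I)"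
        by (auto simp: L2_iff)
      show "AE x in lebesgue_on I. ?h x - z * ?f x = g x - ?g x"
        using fh(2)[unfolded AE_weighted] by (rule eventually_mono) (simp add: algebra_simps)
    qed
    finally show "L2_norm ?M ?f \<le> C * L2_norm ?M (\<lambda>x. g x - ?g x)" .
  qed
  have "resolvent ?M S z g x = green_op g x" if g: "g \<in> L2 ?M" and x: "x \<in> I" for g x
  proof -
    have "\<exists>f h. (f, h) \<in> S \<and> (AE x in ?M. h x - z * f x = g x)"
      using z g unfolding resolvent_set_def by blast
    then have "\<exists>h. (resolvent ?M S z g, h) \<in> S \<and> (AE x in ?M. h x - z * resolvent ?M S z g x = g x)"
      unfolding resolvent_def by (rule someI_ex)
    then show ?thesis using ident g x by blast
  qed
  then show ?thesis
    using green_op_eq W \<open>W \<noteq> 0\<close> by (simp add: wronskian_def)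
qed

end
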